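(* The generalized flag manifold $SO(8)/(U(1)\times U(3))$ admits at least $2$ invariant almost complex structures up to conjugation and equivalence.
   Context: Here $U(1)\times U(3)\subset U(4)\subset SO(8)$ is embedded block-diagonally in $U(4)$, and $U(4)\subset SO(8)$ is the standard embedding. An invariant almost complex structure on $M=U/K$ is an almost complex structure $J$ (a $(1,1)$-tensor with $J^2=-\mathrm{Id}$) commuting with the differentials of the left action of $U$ on $M$ (here $U=SO(8)$). The conjugate of $J$ is $-J$. Two almost complex structures $J_1,J_2$ on $M$ are equivalent if there is a diffeomorphism $\phi:M\to M$ with $d\phi\circ J_1=J_2\circ d\phi$ (for integrable structures: $(M,J_1)$ and $(M,J_2)$ are biholomorphic). "Up to conjugation and equivalence" means modulo the equivalence relation generated by $J\sim -J$ and equivalence. *)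

theory Defs
  imports "HOL-Analysis.Analysis"
begin

section \<open>Smooth functions on subsets of a Euclidean space\<close>

text \<open>Class \<open>C\<^sup>k\<close>; meaningful for an open set \<open>U\<close>, since \<^const>\<open>frechet_derivative\<close> is taken
  at full neighbourhoods.\<close>

primrec Ck_on :: "nat \<Rightarrow> ('a::euclidean_space \<Rightarrow> real) \<Rightarrow> 'a set \<Rightarrow> bool" where
  "Ck_on 0 f U \<longleftrightarrow> continuous_on U f"
| "Ck_on (Suc k) f U \<longleftrightarrow>
     (\<forall>x\<in>U. f differentiable (at x)) \<and>
     (\<forall>v. Ck_on k (\<lambda>x. frechet_derivative f (at x) v) U)"

definition Cinf_on :: "('a::euclidean_space \<Rightarrow> real) \<Rightarrow> 'a set \<Rightarrow> bool" where
  "Cinf_on f U \<longleftrightarrow> (\<forall>k. Ck_on k f U)"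

text \<open>Smoothness on an arbitrary subset: local extendability to smooth functions on open subsets
  of the ambient space. On an embedded submanifold this is the usual notion.\<close>

definition smooth_on_subset :: "('a::euclidean_space \<Rightarrow> real) \<Rightarrow> 'a set \<Rightarrow> bool" where
  "smooth_on_subset f S \<longleftrightarrow>
     (\<forall>p\<in>S. \<exists>U F. open U \<and> p \<in> U \<and> Cinf_on F U \<and> (\<forall>x\<in>U \<inter> S. F x = f x))"


section \<open>Almost complex structures\<close>

text \<open>In this section a smooth manifold with underlying type of points \<^typ>\<open>'p\<close> is given by
  \<open>A\<close>, its set of globally defined smooth real functions. Tangent vectors are point derivations
  of \<open>A\<close>; as HOL functions are total, a derivation is required to be \<open>0\<close> outside \<open>A\<close>,
  so that it is determined by its values on \<open>A\<close>.\<close>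

type_synonym 'p tvec = "('p \<Rightarrow> real) \<Rightarrow> real"

definition tangent_space :: "('p \<Rightarrow> real) set \<Rightarrow> 'p \<Rightarrow> 'p tvec set" where
  "tangent_space A p = {v.
     (\<forall>f\<in>A. \<forall>g\<in>A. v (\<lambda>x. f x + g x) = v f + v g) \<and>
     (\<forall>c. \<forall>f\<in>A. v (\<lambda>x. c * f x) = c * v f) \<and>
     (\<forall>f\<in>A. \<forall>g\<in>A. v (\<lambda>x. f x * g x) = f p * v g + v f * g p) \<and>
     (\<forall>f. f \<notin> A \<longrightarrow> v f = 0)}"

definition smooth_vector_fields :: "('p \<Rightarrow> real) set \<Rightarrow> ('p \<Rightarrow> 'p tvec) set" where
  "smooth_vector_fields A =
     {X. (\<forall>p. X p \<in> tangent_space A p) \<and> (\<forall>f\<in>A. (\<lambda>p. X p f) \<in> A)}"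

definition diffeomorphism :: "('p \<Rightarrow> real) set \<Rightarrow> ('p \<Rightarrow> 'p) \<Rightarrow> bool" where
  "diffeomorphism A \<phi> \<longleftrightarrow>
     bij \<phi> \<and> (\<forall>f\<in>A. f \<circ> \<phi> \<in> A) \<and> (\<forall>f\<in>A. f \<circ> inv \<phi> \<in> A)"

definition differential :: "('p \<Rightarrow> real) set \<Rightarrow> ('p \<Rightarrow> 'p) \<Rightarrow> 'p tvec \<Rightarrow> 'p tvec" where
  "differential A \<phi> v = (\<lambda>f. if f \<in> A then v (f \<circ> \<phi>) else 0)"

text \<open>The values \<open>J p v\<close> for \<open>v\<close> not tangent at \<open>p\<close> are irrelevant. Two \<open>J\<close> that differ only in
  such values are equivalent in the sense of \<open>acs_equivalent\<close> below, via the identity map.\<close>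

definition almost_complex_structure ::
    "('p \<Rightarrow> real) set \<Rightarrow> ('p \<Rightarrow> 'p tvec \<Rightarrow> 'p tvec) \<Rightarrow> bool" where
  "almost_complex_structure A J \<longleftrightarrow>
     (\<forall>p. \<forall>v\<in>tangent_space A p. J p v \<in> tangent_space A p) \<and>
     (\<forall>p. \<forall>v\<in>tangent_space A p. \<forall>w\<in>tangent_space A p. \<forall>a b.
        J p (\<lambda>f. a * v f + b * w f) = (\<lambda>f. a * J p v f + b * J p w f)) \<and>
     (\<forall>p. \<forall>v\<in>tangent_space A p. J p (J p v) = (\<lambda>f. - v f)) \<and>
     (\<forall>X\<in>smooth_vector_fields A. (\<lambda>p. J p (X p)) \<in> smooth_vector_fields A)"

definition acs_conjugate ::
    "('p \<Rightarrow> 'p tvec \<Rightarrow> 'p tvec) \<Rightarrow> ('p \<Rightarrow> 'p tvec \<Rightarrow> 'p tvec)" where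
  "acs_conjugate J = (\<lambda>p v f. - J p v f)"

definition acs_equivalent ::
    "('p \<Rightarrow> real) set \<Rightarrow> ('p \<Rightarrow> 'p tvec \<Rightarrow> 'p tvec) \<Rightarrow> ('p \<Rightarrow> 'p tvec \<Rightarrow> 'p tvec) \<Rightarrow> bool" where
  "acs_equivalent A J1 J2 \<longleftrightarrow>
     (\<exists>\<phi>. diffeomorphism A \<phi> \<and>
        (\<forall>p. \<forall>v\<in>tangent_space A p.
           differential A \<phi> (J1 p v) = J2 (\<phi> p) (differential A \<phi> v)))"

definition acs_equivalent_up_to_conj ::
    "('p \<Rightarrow> real) set \<Rightarrow> ('p \<Rightarrow> 'p tvec \<Rightarrow> 'p tvec) \<Rightarrow> ('p \<Rightarrow> 'p tvec \<Rightarrow> 'p tvec) \<Rightarrow> bool" where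
  "acs_equivalent_up_to_conj A = equivclp (\<lambda>J1 J2.
     almost_complex_structure A J1 \<and> almost_complex_structure A J2 \<and>
     (J2 = acs_conjugate J1 \<or> acs_equivalent A J1 J2))"


section \<open>The groups\<close>

definition special_orthogonal_group :: "(real^'n^'n) set" where
  "special_orthogonal_group = {Q. rotation_matrix Q}"

definition conj_transpose :: "complex^'n^'m \<Rightarrow> complex^'m^'n" where
  "conj_transpose A = (\<chi> i j. cnj (A $ j $ i))"

definition unitary_group :: "(complex^'n^'n) set" where
  "unitary_group = {A. conj_transpose A ** A = mat 1 \<and> A ** conj_transpose A = mat 1}"

text \<open>The disjoint sum of index types is used for blocks: \<open>diag(A, B)\<close>, and
  \<open>A + i B \<mapsto> ((A, -B), (B, A))\<close>, which is the standard embedding of \<open>U(n)\<close> in \<open>SO(2n)\<close>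
  for \<open>z = x + i y \<mapsto> (x, y)\<close>.\<close>

definition block_diag :: "'a::zero^'m^'m \<Rightarrow> 'a^'n^'n \<Rightarrow> 'a^('m + 'n)^('m + 'n)" where
  "block_diag A B = (\<chi> i j. case (i, j) of
       (Inl i', Inl j') \<Rightarrow> A $ i' $ j'
     | (Inr i', Inr j') \<Rightarrow> B $ i' $ j'
     | _ \<Rightarrow> 0)"

definition realification :: "complex^'n^'n \<Rightarrow> real^('n + 'n)^('n + 'n)" where
  "realification A = (\<chi> i j. case (i, j) of
       (Inl i', Inl j') \<Rightarrow> Re (A $ i' $ j')
     | (Inl i', Inr j') \<Rightarrow> - Im (A $ i' $ j')
     | (Inr i', Inl j') \<Rightarrow> Im (A $ i' $ j')
     | (Inr i', Inr j') \<Rightarrow> Re (A $ i' $ j'))"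

type_synonym idx4 = "1 + 3"
type_synonym idx8 = "idx4 + idx4"

lemma card_idx8: "CARD(idx8) = 8"
  by simp

abbreviation SO8 :: "(real^idx8^idx8) set" where
  "SO8 \<equiv> special_orthogonal_group"

definition U1U3 :: "(real^idx8^idx8) set" where
  "U1U3 = {realification (block_diag A B) | (A :: complex^1^1) (B :: complex^3^3).
             A \<in> unitary_group \<and> B \<in> unitary_group}"


section \<open>The flag manifold \<open>SO(8)/(U(1) \<times> U(3))\<close>\<close>

typedef flag = "{(\<lambda>k. g ** k) ` U1U3 | g. g \<in> SO8}"
  morphisms coset_of Abs_flag
proof -
  have "mat 1 \<in> SO8"
    by (simp add: special_orthogonal_group_def rotation_matrix_def orthogonal_matrix_id)
  then show ?thesis by blast
qed

definition proj :: "real^idx8^idx8 \<Rightarrow> flag" where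
  "proj g = Abs_flag ((\<lambda>k. g ** k) ` U1U3)"

definition left_action :: "real^idx8^idx8 \<Rightarrow> flag \<Rightarrow> flag" where
  "left_action g p = Abs_flag ((\<lambda>a. g ** a) ` coset_of p)"

text \<open>The quotient smooth structure: the one for which the projection is a surjective
  submersion, i.e. \<open>f\<close> is smooth iff its pullback to \<open>SO(8)\<close> is.\<close>

definition Cinf_flag :: "(flag \<Rightarrow> real) set" where
  "Cinf_flag = {f. smooth_on_subset (\<lambda>g. f (proj g)) SO8}"

definition invariant_acs :: "(flag \<Rightarrow> flag tvec \<Rightarrow> flag tvec) set" where
  "invariant_acs = {J. almost_complex_structure Cinf_flag J \<and>
     (\<forall>g\<in>SO8. \<forall>p. \<forall>v\<in>tangent_space Cinf_flag p.
        J (left_action g p) (differential Cinf_flag (left_action g) v) =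
        differential Cinf_flag (left_action g) (J p v))}"

definition invariant_acs_rel ::
    "((flag \<Rightarrow> flag tvec \<Rightarrow> flag tvec) \<times> (flag \<Rightarrow> flag tvec \<Rightarrow> flag tvec)) set" where
  "invariant_acs_rel = {(J1, J2). J1 \<in> invariant_acs \<and> J2 \<in> invariant_acs \<and>
     acs_equivalent_up_to_conj Cinf_flag J1 J2}"

lemma equiv_invariant_acs_rel: "equiv invariant_acs invariant_acs_rel"
proof -
  have eq: "equivp (acs_equivalent_up_to_conj Cinf_flag)"
    unfolding acs_equivalent_up_to_conj_def by (rule equivp_evquivclp)
  show ?thesis
    by (rule equivI)
      (auto simp: invariant_acs_rel_def refl_on_def sym_def trans_def
        intro: equivp_reflp[OF eq] equivp_symp[OF eq] equivp_transp[OF eq])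
qed

end

theory Submission
  imports Defs
begin

text \<open>
  Write \<open>\<real>\<^sup>8 = \<complex>\<^sup>4 = \<complex> \<oplus> \<complex>\<^sup>3\<close>, let \<open>I\<close> be the multiplication by \<open>\<i>\<close> and let \<open>S\<close> be \<open>1\<close> on \<open>\<complex>\<close> and \<open>-1\<close> on
  \<open>\<complex>\<^sup>3\<close>. Then \<open>K = U(1) \<times> U(3)\<close> is the centralizer of \<open>I\<close> and \<open>S\<close> in the orthogonal group, so the
  flag manifold embeds into pairs of matrices by \<open>gK \<mapsto> (g I g\<^sup>T, g S g\<^sup>T)\<close>. The isotropy
  representation is the sum of three subspaces of \<open>so(8)\<close>, given by commuting or anticommuting with
  \<open>I\<close> and with \<open>S\<close>, and a choice of sign on each of them yields an invariant almost complex
  structure. For one choice of signs the \<open>(1,0)\<close>-vectors together with the complexified isotropy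
  algebra form a subalgebra, hence the Nijenhuis tensor vanishes; flipping one sign destroys this.
  The vanishing of the Nijenhuis tensor is invariant under equivalence and conjugation.

  Tangent vectors are derivations. That each of them comes from an element of \<open>so(8)\<close> follows from
  the lemma of Hadamard, applied to functions composed with a smooth local section of
  \<open>SO(8) \<rightarrow> SO(8)/K\<close>, which Gram-Schmidt over \<open>\<complex>\<close> provides. Vector fields then lift to
  \<open>so(8)\<close>-valued functions on \<open>SO(8)\<close>, and the Nijenhuis tensor becomes an algebraic expression.
\<close>

section \<open>Smooth functions\<close>

text \<open>Equivalence allows every diffeomorphism, not only translations by the group, so the
  property that separates the two structures has to be expressed by the algebra of smooth functions
  alone. Brackets of derivations achieve this. No charts are introduced: local statements about
  derivations are reached by multiplying with bump functions.

  Roots explain the sign that is reversed. With respect to the diagonal torus of U(4), the three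
  summands belong, up to sign, to the roots e_0 - e_j, e_0 + e_j and e_i + e_j with distinct i, j in
  {1, 2, 3}, and e_0 + e_j is the sum of a root of the first and a root of the third kind. Reversing
  the second sign therefore makes the bracket of two (1,0)-vectors a (0,1)-vector, whereas reversing
  only the first or only the third sign would give another integrable structure.\<close>

lemma Ck_on_cong:
  assumes "open U" "\<And>x. x \<in> U \<Longrightarrow> f x = g x"
  shows "Ck_on k f U \<longleftrightarrow> Ck_on k g U"
  using assms(2)
proof (induction k arbitrary: f g)
  case 0
  then show ?case by (auto intro: continuous_on_eq)
next
  case (Suc k)
  have *: "(f has_derivative D) (at x) \<longleftrightarrow> (g has_derivative D) (at x)" if "x \<in> U" for x D
    using has_derivative_transform_within_open[OF _ assms(1) that, of f D UNIV g]
      has_derivative_transform_within_open[OF _ assms(1) that, of g D UNIV f] Suc.prems by auto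
  then have d: "f differentiable (at x) \<longleftrightarrow> g differentiable (at x)" if "x \<in> U" for x
    using that by (auto simp: differentiable_def)
  have fd: "frechet_derivative f (at x) = frechet_derivative g (at x)" if "x \<in> U" for x
    using * that by (auto simp: frechet_derivative_def)
  have "Ck_on k (\<lambda>x. frechet_derivative f (at x) v) U \<longleftrightarrow>
      Ck_on k (\<lambda>x. frechet_derivative g (at x) v) U" for v
    by (rule Suc.IH) (simp add: fd)
  with d show ?case by auto
qed

lemma Cinf_on_cong:
  assumes "open U" "\<And>x. x \<in> U \<Longrightarrow> f x = g x"
  shows "Cinf_on f U \<longleftrightarrow> Cinf_on g U"
  unfolding Cinf_on_def using Ck_on_cong[of U f g] assms by simp

lemma Ck_on_subset: "Ck_on k f U \<Longrightarrow> V \<subseteq> U \<Longrightarrow> Ck_on k f V"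
  by (induction k arbitrary: f) (auto intro: continuous_on_subset)

lemma Cinf_on_subset: "Cinf_on f U \<Longrightarrow> V \<subseteq> U \<Longrightarrow> Cinf_on f V"
  using Ck_on_subset unfolding Cinf_on_def by blast

lemma Ck_on_SucD: "Ck_on (Suc k) f U \<Longrightarrow> Ck_on k f U"
proof (induction k arbitrary: f)
  case 0
  then show ?case
    by (auto intro!: continuous_at_imp_continuous_on differentiable_imp_continuous_within)
next
  case (Suc k)
  then show ?case by (metis Ck_on.simps(2))
qed

lemma Cinf_onD: "Cinf_on f U \<Longrightarrow> Ck_on k f U"
  by (simp add: Cinf_on_def)

lemma Cinf_onI: "(\<And>k. Ck_on k f U) \<Longrightarrow> Cinf_on f U"
  by (simp add: Cinf_on_def)

lemma Cinf_on_differentiable: "Cinf_on f U \<Longrightarrow> x \<in> U \<Longrightarrow> f differentiable (at x)"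
  using Cinf_onD[of f U "Suc 0"] by simp

lemma Cinf_on_continuous: "Cinf_on f U \<Longrightarrow> continuous_on U f"
  using Cinf_onD[of f U 0] by simp

lemma Cinf_on_frechet:
  assumes "Cinf_on f U"
  shows "Cinf_on (\<lambda>x. frechet_derivative f (at x) v) U"
proof (rule Cinf_onI)
  show "Ck_on k (\<lambda>x. frechet_derivative f (at x) v) U" for k
    using Cinf_onD[OF assms, of "Suc k"] by simp
qed

text \<open>\<open>frechet_derivative\<close> is a choice. This rule exchanges it for an explicit
  derivative, and most inductions over the degree of smoothness run through it.\<close>

lemma Ck_on_SucI:
  assumes "open U" "\<And>x. x \<in> U \<Longrightarrow> (f has_derivative D x) (at x)"
    and "\<And>v. Ck_on k (\<lambda>x. D x v) U"
  shows "Ck_on (Suc k) f U"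
proof -
  have "frechet_derivative f (at x) = D x" if "x \<in> U" for x
    using assms(2)[OF that] frechet_derivative_at by metis
  then have "Ck_on k (\<lambda>x. frechet_derivative f (at x) v) U" for v
    using assms(3)[of v] Ck_on_cong[OF assms(1), of "\<lambda>x. D x v" "\<lambda>x. frechet_derivative f (at x) v"]
    by simp
  then show ?thesis using assms(2) by (auto simp: differentiable_def)
qed

lemma Ck_on_const: "open U \<Longrightarrow> Ck_on k (\<lambda>x. c) U"
  by (induction k arbitrary: c) (auto simp: differentiable_def)

lemma Ck_on_linear:
  assumes "open U" "bounded_linear f"
  shows "Ck_on k f U"
proof (cases k)
  case 0
  then show ?thesis using assms by (auto intro: linear_continuous_on)
next
  case (Suc m)
  show ?thesis unfolding Suc
    by (rule Ck_on_SucI[where D = "\<lambda>_. f"])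
      (use assms in \<open>auto intro: bounded_linear_imp_has_derivative Ck_on_const\<close>)
qed

lemma Ck_on_has_derivative:
  "Ck_on (Suc k) f U \<Longrightarrow> x \<in> U \<Longrightarrow> (f has_derivative frechet_derivative f (at x)) (at x)"
  by (simp add: frechet_derivative_works)

lemma Ck_on_add:
  assumes "open U"
  shows "Ck_on k f U \<Longrightarrow> Ck_on k g U \<Longrightarrow> Ck_on k (\<lambda>x. f x + g x) U"
proof (induction k arbitrary: f g)
  case 0
  then show ?case by (auto intro: continuous_intros)
next
  case (Suc k)
  show ?case
  proof (rule Ck_on_SucI[OF assms])
    show "((\<lambda>x. f x + g x) has_derivative
        (\<lambda>v. frechet_derivative f (at x) v + frechet_derivative g (at x) v)) (at x)"
      if "x \<in> U" for x
      using Suc.prems that by (intro has_derivative_add Ck_on_has_derivative)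
    show "Ck_on k (\<lambda>x. frechet_derivative f (at x) v + frechet_derivative g (at x) v) U" for v
      using Suc.prems by (intro Suc.IH) auto
  qed
qed

lemma Ck_on_mult:
  assumes "open U"
  shows "Ck_on k f U \<Longrightarrow> Ck_on k g U \<Longrightarrow> Ck_on k (\<lambda>x. f x * g x) U"
proof (induction k arbitrary: f g)
  case 0
  then show ?case by (auto intro: continuous_intros)
next
  case (Suc k)
  show ?case
  proof (rule Ck_on_SucI[OF assms])
    show "((\<lambda>x. f x * g x) has_derivative
        (\<lambda>v. f x * frechet_derivative g (at x) v + frechet_derivative f (at x) v * g x)) (at x)"
      if "x \<in> U" for x
      using Suc.prems that by (intro has_derivative_mult Ck_on_has_derivative) 
    fix v
    have "Ck_on k f U" "Ck_on k g U" using Suc.prems Ck_on_SucD by blast+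
    moreover have "Ck_on k (\<lambda>x. frechet_derivative f (at x) v) U"
      "Ck_on k (\<lambda>x. frechet_derivative g (at x) v) U" using Suc.prems by auto
    ultimately show "Ck_on k (\<lambda>x. f x * frechet_derivative g (at x) v
        + frechet_derivative f (at x) v * g x) U"
      by (intro Ck_on_add[OF assms] Suc.IH)
  qed
qed

lemma Ck_on_sum:
  assumes "open U" "\<And>i. i \<in> S \<Longrightarrow> Ck_on k (f i) U"
  shows "Ck_on k (\<lambda>x. \<Sum>i\<in>S. f i x) U"
  using assms(2)
  by (induction S rule: infinite_finite_induct) (auto intro: Ck_on_const Ck_on_add assms(1))

text \<open>Only \<open>f\<close> varies in the induction: by the chain rule the derivative consists
  of derivatives of the components of \<open>g\<close> and of directional derivatives of
  \<open>f\<close> composed with the same \<open>g\<close>.\<close>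

lemma Ck_on_compose:
  fixes g :: "'a::euclidean_space \<Rightarrow> 'b::euclidean_space"
  assumes "open U" "open V" "g ` U \<subseteq> V"
  shows "Ck_on k f V \<Longrightarrow> (\<And>b. b \<in> Basis \<Longrightarrow> Ck_on k (\<lambda>x. g x \<bullet> b) U) \<Longrightarrow> Ck_on k (\<lambda>x. f (g x)) U"
proof (induction k arbitrary: f)
  case 0
  then have "continuous_on U g"
    by (auto simp: continuous_on_componentwise[of U g])
  with 0 show ?case using assms(3) by (auto intro: continuous_on_compose2)
next
  case (Suc k)
  let ?D = "\<lambda>x v. \<Sum>b\<in>Basis. frechet_derivative (\<lambda>x. g x \<bullet> b) (at x) v *\<^sub>R b"
  have g: "(g has_derivative ?D x) (at x)" if "x \<in> U" for x
    unfolding has_derivative_componentwise_within[of g _ x UNIV]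
    using Ck_on_has_derivative[OF Suc.prems(2) that] by (simp add: inner_sum_left_Basis)
  have f: "(f has_derivative frechet_derivative f (at y)) (at y)" if "y \<in> V" for y
    using Ck_on_has_derivative[OF Suc.prems(1) that] .
  have lin: "linear (frechet_derivative f (at y))" if "y \<in> V" for y
    using f[OF that] has_derivative_linear by blast
  show ?case
  proof (rule Ck_on_SucI[OF assms(1)])
    show "((\<lambda>x. f (g x)) has_derivative (\<lambda>v. \<Sum>b\<in>Basis.
        frechet_derivative (\<lambda>x. g x \<bullet> b) (at x) v * frechet_derivative f (at (g x)) b)) (at x)"
      if "x \<in> U" for x
    proof -
      have gx: "g x \<in> V" using that assms(3) by auto
      have "((\<lambda>x. f (g x)) has_derivative (\<lambda>v. frechet_derivative f (at (g x)) (?D x v))) (at x)"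
        using has_derivative_compose[OF g[OF that] f[OF gx]] .
      then show ?thesis by (simp add: linear_sum[OF lin[OF gx]] linear_scale[OF lin[OF gx]])
    qed
    fix v
    have "Ck_on k (\<lambda>x. g x \<bullet> b) U" if "b \<in> Basis" for b
      using Suc.prems(2)[OF that] Ck_on_SucD by blast
    moreover have "Ck_on k (\<lambda>y. frechet_derivative f (at y) b) V" for b
      using Suc.prems(1) by auto
    ultimately have "Ck_on k (\<lambda>x. frechet_derivative f (at (g x)) b) U" for b
      by (intro Suc.IH[of "\<lambda>y. frechet_derivative f (at y) b"])
    then show "Ck_on k (\<lambda>x. \<Sum>b\<in>Basis.
        frechet_derivative (\<lambda>x. g x \<bullet> b) (at x) v * frechet_derivative f (at (g x)) b) U"
      using Suc.prems(2) by (intro Ck_on_sum Ck_on_mult assms(1)) auto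
  qed
qed

lemma Cinf_on_const: "open U \<Longrightarrow> Cinf_on (\<lambda>x. c) U"
  by (simp add: Cinf_on_def Ck_on_const)

lemma Cinf_on_linear: "open U \<Longrightarrow> bounded_linear f \<Longrightarrow> Cinf_on f U"
  by (simp add: Cinf_on_def Ck_on_linear)

lemma Cinf_on_add: "open U \<Longrightarrow> Cinf_on f U \<Longrightarrow> Cinf_on g U \<Longrightarrow> Cinf_on (\<lambda>x. f x + g x) U"
  by (rule Cinf_onI, rule Ck_on_add) (auto dest: Cinf_onD)

lemma Cinf_on_mult: "open U \<Longrightarrow> Cinf_on f U \<Longrightarrow> Cinf_on g U \<Longrightarrow> Cinf_on (\<lambda>x. f x * g x) U"
  by (rule Cinf_onI, rule Ck_on_mult) (auto dest: Cinf_onD)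

lemma Cinf_on_sum:
  "open U \<Longrightarrow> (\<And>i. i \<in> S \<Longrightarrow> Cinf_on (f i) U) \<Longrightarrow> Cinf_on (\<lambda>x. \<Sum>i\<in>S. f i x) U"
  by (rule Cinf_onI, rule Ck_on_sum) (auto dest: Cinf_onD)

section \<open>Smooth maps between Euclidean spaces\<close>

definition smooth_map :: "('a::euclidean_space \<Rightarrow> 'b::euclidean_space) \<Rightarrow> 'a set \<Rightarrow> bool" where
  "smooth_map g U \<longleftrightarrow> (\<forall>b\<in>Basis. Cinf_on (\<lambda>x. g x \<bullet> b) U)"

lemma smooth_map_real: "smooth_map f U \<longleftrightarrow> Cinf_on f U" for f :: "'a::euclidean_space \<Rightarrow> real"
  by (simp add: smooth_map_def)

lemma Cinf_on_compose:
  "open U \<Longrightarrow> open V \<Longrightarrow> g ` U \<subseteq> V \<Longrightarrow> Cinf_on f V \<Longrightarrow> smooth_map g U \<Longrightarrow> Cinf_on (\<lambda>x. f (g x)) U"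
  by (rule Cinf_onI, rule Ck_on_compose[of U V g]) (auto simp: smooth_map_def dest: Cinf_onD)

lemma smooth_map_compose:
  "open U \<Longrightarrow> open V \<Longrightarrow> g ` U \<subseteq> V \<Longrightarrow> smooth_map f V \<Longrightarrow> smooth_map g U \<Longrightarrow> smooth_map (\<lambda>x. f (g x)) U"
  unfolding smooth_map_def[of "\<lambda>x. f (g x)"]
  by (intro ballI, rule Cinf_on_compose[of U V g "\<lambda>x. f x \<bullet> _"]) (auto simp: smooth_map_def[of f])

lemma smooth_map_subset: "smooth_map f U \<Longrightarrow> V \<subseteq> U \<Longrightarrow> smooth_map f V"
  unfolding smooth_map_def using Cinf_on_subset by blast

lemma smooth_map_has_derivative:
  assumes "smooth_map g U" "x \<in> U"
  shows "(g has_derivative frechet_derivative g (at x)) (at x)"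
proof -
  have "\<forall>b\<in>Basis. (\<lambda>x. g x \<bullet> b) differentiable (at x)"
    using assms Cinf_on_differentiable unfolding smooth_map_def by blast
  then have "g differentiable (at x)"
    using differentiable_componentwise_within[of g x UNIV] by simp
  then show ?thesis by (simp add: frechet_derivative_works)
qed

lemma smooth_map_continuous:
  assumes "smooth_map g U"
  shows "continuous_on U g"
  using assms Cinf_on_continuous continuous_on_componentwise[of U g]
  unfolding smooth_map_def by blast

lemma smooth_map_linear:
  assumes "open U" "bounded_linear f"
  shows "smooth_map f U"
  unfolding smooth_map_def
  using assms by (auto intro!: Cinf_on_linear bounded_linear_compose[OF bounded_linear_inner_left])

lemma smooth_map_const: "open U \<Longrightarrow> smooth_map (\<lambda>x. c) U"
  by (simp add: smooth_map_def Cinf_on_const)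

lemma smooth_map_add: "open U \<Longrightarrow> smooth_map f U \<Longrightarrow> smooth_map g U \<Longrightarrow> smooth_map (\<lambda>x. f x + g x) U"
  by (auto simp: smooth_map_def inner_add_left intro!: Cinf_on_add)

lemma smooth_map_scaleR:
  "open U \<Longrightarrow> Cinf_on f U \<Longrightarrow> smooth_map g U \<Longrightarrow> smooth_map (\<lambda>x. f x *\<^sub>R g x) U"
  by (auto simp: smooth_map_def intro!: Cinf_on_mult)

lemma smooth_map_sum:
  "open U \<Longrightarrow> (\<And>i. i \<in> S \<Longrightarrow> smooth_map (f i) U) \<Longrightarrow> smooth_map (\<lambda>x. \<Sum>i\<in>S. f i x) U"
  by (auto simp: smooth_map_def inner_sum_left intro!: Cinf_on_sum)

lemma smooth_map_uminus: "open U \<Longrightarrow> smooth_map f U \<Longrightarrow> smooth_map (\<lambda>x. - f x) U"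
  using smooth_map_scaleR[OF _ Cinf_on_const, of U f "-1"] by simp

lemma smooth_map_diff:
  "open U \<Longrightarrow> smooth_map f U \<Longrightarrow> smooth_map g U \<Longrightarrow> smooth_map (\<lambda>x. f x - g x) U"
  using smooth_map_add[OF _ _ smooth_map_uminus, of U f g] by simp

lemma smooth_map_bounded_linear:
  "open U \<Longrightarrow> bounded_linear h \<Longrightarrow> smooth_map f U \<Longrightarrow> smooth_map (\<lambda>x. h (f x)) U"
  using smooth_map_compose[of U UNIV f h] smooth_map_linear[of UNIV h] by simp

lemma smooth_map_bilinear:
  fixes h :: "'b::euclidean_space \<Rightarrow> 'c::euclidean_space \<Rightarrow> 'd::euclidean_space"
  assumes h: "bounded_bilinear h" and "open U" "smooth_map f U" "smooth_map g U"
  shows "smooth_map (\<lambda>x. h (f x) (g x)) U"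
proof -
  interpret bounded_bilinear h by (rule h)
  have *: "h (f x) (g x) = (\<Sum>b\<in>Basis. \<Sum>c\<in>Basis. (f x \<bullet> b) *\<^sub>R (g x \<bullet> c) *\<^sub>R h b c)" for x
  proof -
    have "h (f x) (g x) = h (\<Sum>b\<in>Basis. (f x \<bullet> b) *\<^sub>R b) (\<Sum>b\<in>Basis. (g x \<bullet> b) *\<^sub>R b)"
      by (simp add: euclidean_representation)
    then show ?thesis
      by (simp add: sum_left sum_right scaleR_left scaleR_right scaleR_sum_right)
        (subst sum.swap, simp add: mult.commute)
  qed
  show ?thesis unfolding *
    using assms by (intro smooth_map_sum smooth_map_scaleR smooth_map_const) (auto simp: smooth_map_def)
qed

lemma smooth_map_Pair:
  assumes "open U" "smooth_map f U" "smooth_map g U"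
  shows "smooth_map (\<lambda>x. (f x, g x)) U"
  using assms by (auto simp: smooth_map_def Basis_prod_def inner_Pair)

section \<open>Families closed under differentiation, and bump functions\<close>

lemma Cinf_on_family:
  fixes F :: "'i \<Rightarrow> real \<Rightarrow> real"
  assumes "open U" and "\<And>i x. x \<in> U \<Longrightarrow> (F i has_real_derivative F (d i) x) (at x)"
  shows "Cinf_on (F i) U"
proof -
  have "Ck_on k (F i) U" for k
  proof (induction k arbitrary: i)
    case 0
    have "isCont (F i) x" if "x \<in> U" for x
      using assms(2)[OF that] DERIV_isCont by blast
    then show ?case by (simp add: continuous_at_imp_continuous_on)
  next
    case (Suc k)
    show ?case
      by (rule Ck_on_SucI[OF assms(1) assms(2)[unfolded has_field_derivative_def]])
        (assumption, intro Ck_on_mult Ck_on_const assms(1) Suc)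
  qed
  then show ?thesis by (simp add: Cinf_on_def)
qed

lemma Cinf_on_powr: "Cinf_on (\<lambda>x. x powr a) {0<..}" 
proof -
  have "Cinf_on ((\<lambda>(c, a) x. c * x powr a) (1, a)) {0<..}"
    by (rule Cinf_on_family[where d = "\<lambda>(c, a). (c * a, a - 1)"])
      (auto intro!: derivative_eq_intros)
  then show ?thesis by simp
qed

text \<open>The factor \<open>p\<close> makes the functions p(1/x) exp(-1/x) a family closed under
  differentiation. As the derivative of y = 1/x is -y^2, differentiation replaces p by y^2 (p - p'),
  which is \<open>[:0, 0, 1:] * (p - pderiv p)\<close>.\<close>

definition flat_exp :: "real poly \<Rightarrow> real \<Rightarrow> real" where
  "flat_exp p x = (if x > 0 then poly p (1 / x) * exp (- (1 / x)) else 0)"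

lemma poly_exp_tendsto: "((\<lambda>y. poly p y * exp (- y)) \<longlongrightarrow> 0) at_top" for p :: "real poly"
proof -
  have "((\<lambda>y. \<Sum>i\<le>degree p. coeff p i * (y ^ i / exp y)) \<longlongrightarrow> (\<Sum>i\<le>degree p. coeff p i * 0)) at_top"
    by (intro tendsto_sum tendsto_mult tendsto_const tendsto_power_div_exp_0)
  moreover have "(\<lambda>y. \<Sum>i\<le>degree p. coeff p i * (y ^ i / exp y)) = (\<lambda>y. poly p y * exp (- y))"
    by (simp add: poly_altdef sum_divide_distrib exp_minus divide_inverse[symmetric])
  ultimately show ?thesis by simp
qed

lemma flat_exp_tendsto: "(flat_exp p \<longlongrightarrow> 0) (at 0)"
proof -
  have "((\<lambda>x. poly p (inverse x) * exp (- (inverse x))) \<longlongrightarrow> 0) (at_right 0)"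
    using filterlim_compose[OF poly_exp_tendsto filterlim_inverse_at_top_right] .
  then have "(flat_exp p \<longlongrightarrow> 0) (at_right 0)"
    by (rule filterlim_cong[THEN iffD1, rotated 3])
      (auto simp: flat_exp_def eventually_at_right_field inverse_eq_divide intro!: exI[of _ 1])
  moreover have "(flat_exp p \<longlongrightarrow> 0) (at_left 0)"
    by (rule tendsto_eventually) (auto simp: flat_exp_def eventually_at_left_field intro!: exI[of _ "-1"])
  ultimately show ?thesis by (simp add: filterlim_split_at)
qed

lemma flat_exp_has_derivative:
  "(flat_exp p has_real_derivative flat_exp ([:0, 0, 1:] * (p - pderiv p)) x) (at x)"
proof -
  consider "x > 0" | "x < 0" | "x = 0" by linarith
  then show ?thesis
  proof cases
    case 1
    have "((\<lambda>x. poly p (1 / x) * exp (- (1 / x))) has_real_derivative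
        flat_exp ([:0, 0, 1:] * (p - pderiv p)) x) (at x)"
      using 1 by (auto intro!: derivative_eq_intros simp: flat_exp_def power2_eq_square divide_simps, algebra)
    then show ?thesis
      by (rule has_field_derivative_transform_within_open[where S = "{0<..}"])
        (use 1 in \<open>auto simp: flat_exp_def\<close>)
  next
    case 2
    have "((\<lambda>x. 0) has_real_derivative flat_exp ([:0, 0, 1:] * (p - pderiv p)) x) (at x)"
      using 2 by (auto simp: flat_exp_def)
    then show ?thesis
      by (rule has_field_derivative_transform_within_open[where S = "{..<0}"])
        (use 2 in \<open>auto simp: flat_exp_def\<close>)
  next
    case 3
    \<comment> \<open>Dividing by h multiplies the polynomial in 1/h by its variable, so the
      difference quotient at 0 is again a member of the family, and its limit is known.\<close>
    have "(\<lambda>h. (flat_exp p (0 + h) - flat_exp p 0) / h) = flat_exp (pCons 0 p)"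
      by (auto simp: flat_exp_def fun_eq_iff)
    then show ?thesis
      using flat_exp_tendsto[of "pCons 0 p"] by (simp add: 3 DERIV_def flat_exp_def)
  qed
qed

lemma Cinf_on_flat_exp: "Cinf_on (flat_exp p) UNIV"
  by (rule Cinf_on_family[where d = "\<lambda>p. [:0, 0, 1:] * (p - pderiv p)"])
    (auto intro: flat_exp_has_derivative simp del: mult_pCons_left)

lemma smooth_bump_exists:
  fixes a :: "'a::euclidean_space"
  assumes "r > 0"
  obtains \<beta> where "Cinf_on \<beta> UNIV" "\<beta> a = (1::real)" "\<And>x. dist a x \<ge> r \<Longrightarrow> \<beta> x = 0"
proof
  \<comment> \<open>The witness is exp(-1/(r^2 - |x - a|^2)), extended by 0 and divided by its value
    at the centre.\<close>
  let ?e = "flat_exp 1" and ?q = "\<lambda>x. r\<^sup>2 + (-1) * ((x - a) \<bullet> (x - a))"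
  let ?b = "\<lambda>x. (1 / ?e (r\<^sup>2)) * ?e (?q x)"
  have "smooth_map (\<lambda>x. x - a) UNIV"
    by (intro smooth_map_diff smooth_map_linear smooth_map_const) auto
  then have "smooth_map (\<lambda>x. (x - a) \<bullet> (x - a)) UNIV"
    by (intro smooth_map_bilinear[OF bounded_bilinear_inner]) auto
  then have "Cinf_on ?q UNIV"
    by (intro Cinf_on_add Cinf_on_mult Cinf_on_const) (auto simp: smooth_map_real)
  then have "Cinf_on (\<lambda>x. ?e (?q x)) UNIV"
    using Cinf_on_compose[of UNIV UNIV ?q ?e] Cinf_on_flat_exp by (simp add: smooth_map_real)
  then show "Cinf_on ?b UNIV"
    by (intro Cinf_on_mult Cinf_on_const) auto
  show "?b a = 1" using assms by (simp add: flat_exp_def)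
  fix x assume "dist a x \<ge> r"
  then have "(norm (x - a))\<^sup>2 \<ge> r\<^sup>2"
    using assms by (intro power_mono) (auto simp: dist_norm norm_minus_commute)
  then have "?q x \<le> 0" by (simp add: power2_norm_eq_inner)
  then have "?e (?q x) = 0" by (simp add: flat_exp_def)
  then show "?b x = 0" by simp
qed

lemma Ck_on_Un:
  assumes "open U" "open V"
  shows "Ck_on k f U \<Longrightarrow> Ck_on k f V \<Longrightarrow> Ck_on k f (U \<union> V)"
  by (induction k arbitrary: f) (use assms in \<open>auto intro: continuous_on_open_Un\<close>)

lemma Cinf_on_Un: "open U \<Longrightarrow> open V \<Longrightarrow> Cinf_on f U \<Longrightarrow> Cinf_on f V \<Longrightarrow> Cinf_on f (U \<union> V)"
  by (rule Cinf_onI, rule Ck_on_Un) (auto dest: Cinf_onD)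

text \<open>Because s < r, the open ball of radius r and the complement of the closed ball of radius
  s cover the space, and on the latter the function is identically 0.\<close>

lemma Cinf_on_cutoff:
  fixes a :: "'a::euclidean_space"
  assumes "Cinf_on H (ball a r)" "Cinf_on \<beta> UNIV" "s < r" "\<And>x. dist a x \<ge> s \<Longrightarrow> \<beta> x = 0"
  shows "Cinf_on (\<lambda>x. if x \<in> ball a r then \<beta> x * H x else 0) UNIV" (is "Cinf_on ?f _")
proof -
  have "Cinf_on (\<lambda>x. \<beta> x * H x) (ball a r)"
    using assms by (intro Cinf_on_mult) (auto intro: Cinf_on_subset)
  then have 1: "Cinf_on ?f (ball a r)"
    using Cinf_on_cong[of "ball a r" ?f "\<lambda>x. \<beta> x * H x"] by simp
  have "Cinf_on ?f (- cball a s)"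
    using Cinf_on_cong[of "- cball a s" ?f "\<lambda>x. 0"] Cinf_on_const[of "- cball a s" 0] assms(4)
    by (simp add: open_Compl)
  with 1 have "Cinf_on ?f (ball a r \<union> - cball a s)"
    by (intro Cinf_on_Un) (auto simp: open_Compl)
  moreover have "ball a r \<union> - cball a s = UNIV" using assms(3) by auto
  ultimately show ?thesis by simp
qed

section \<open>Radial integrals and the lemma of Hadamard\<close>

lemma segment_in_ball:
  fixes a :: "'a::real_normed_vector"
  assumes "y \<in> ball a r" "t \<in> cbox 0 (1::real)"
  shows "a + t *\<^sub>R (y - a) \<in> ball a r"
proof -
  have "\<bar>t\<bar> * norm (y - a) \<le> 1 * norm (y - a)"
    using assms(2) by (intro mult_right_mono) auto
  then show ?thesis using assms(1) by (auto simp: dist_norm norm_minus_commute)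
qed

lemma continuous_on_radial:
  fixes a :: "'a::real_normed_vector" and f :: "'a \<Rightarrow> real"
  assumes "continuous_on (ball a r) f"
  shows "continuous_on (ball a r \<times> cbox 0 1) (\<lambda>(y, t). t ^ n * f (a + t *\<^sub>R (y - a)))"
proof -
  have "continuous_on (ball a r \<times> cbox 0 (1::real)) (\<lambda>z. f (a + snd z *\<^sub>R (fst z - a)))"
  proof (rule continuous_on_compose2[OF assms])
    show "continuous_on (ball a r \<times> cbox 0 (1::real)) (\<lambda>z. a + snd z *\<^sub>R (fst z - a))"
      by (intro continuous_intros)
    show "(\<lambda>z. a + snd z *\<^sub>R (fst z - a)) ` (ball a r \<times> cbox 0 (1::real)) \<subseteq> ball a r"
      using segment_in_ball[of _ a r] by force
  qed
  then have "continuous_on (ball a r \<times> cbox 0 (1::real))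
      (\<lambda>z. snd z ^ n * f (a + snd z *\<^sub>R (fst z - a)))"
    by (intro continuous_intros)
  then show ?thesis by (simp add: case_prod_unfold)
qed

lemma continuous_on_radial_slice:
  fixes a :: "'a::real_normed_vector" and f :: "'a \<Rightarrow> real"
  assumes "continuous_on (ball a r) f" "y \<in> ball a r"
  shows "continuous_on (cbox 0 1) (\<lambda>t. t ^ n * f (a + t *\<^sub>R (y - a)))"
proof -
  have "continuous_on (cbox 0 1) (\<lambda>t. case (y, t) of (y, t) \<Rightarrow> t ^ n * f (a + t *\<^sub>R (y - a)))"
    by (rule continuous_on_compose2[OF continuous_on_radial[OF assms(1)]])
      (use assms(2) in \<open>auto intro!: continuous_intros\<close>)
  then show ?thesis by simp
qed

text \<open>The weight t^n makes the induction work: differentiating in y under the integral sign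
  releases a factor t from a + t (y - a), which turns t^n into t^(n+1).\<close>

lemma Ck_on_radial_integral:
  fixes a :: "'a::euclidean_space"
  shows "Ck_on k f (ball a r) \<Longrightarrow>
    Ck_on k (\<lambda>y. integral (cbox 0 1) (\<lambda>t. t ^ n * f (a + t *\<^sub>R (y - a)))) (ball a r)"
proof (induction k arbitrary: f n)
  case 0
  then show ?case
    using integral_continuous_on_param[OF continuous_on_radial[of a r f n]] by simp
next
  case (Suc k)
  let ?B = "ball a r" and ?D = "\<lambda>x. frechet_derivative f (at x)"
  let ?p = "\<lambda>y t. a + t *\<^sub>R (y - a)"
  have fD: "(f has_derivative ?D x) (at x)" if "x \<in> ?B" for x
    using Ck_on_has_derivative[OF Suc.prems that] .
  have lin: "linear (?D x)" if "x \<in> ?B" for x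
    using fD[OF that] has_derivative_linear by blast
  have contD: "continuous_on ?B (\<lambda>x. ?D x v)" for v
  proof -
    have "Ck_on k (\<lambda>x. ?D x v) ?B" using Suc.prems by simp
    then have "Ck_on 0 (\<lambda>x. ?D x v) ?B"
      by (induction k) (auto dest: Ck_on_SucD simp del: Ck_on.simps)
    then show ?thesis by simp
  qed
  \<comment> \<open>The rule for differentiation under the integral takes the derivative as a
    bounded linear operator that is continuous in both variables.\<close>
  define L where "L y t = Blinfun (\<lambda>v. t ^ Suc n * ?D (?p y t) v)" for y t
  have L: "blinfun_apply (L y t) = (\<lambda>v. t ^ Suc n * ?D (?p y t) v)"
    if "y \<in> ?B" "t \<in> cbox 0 1" for y t
    unfolding L_def using fD[OF segment_in_ball[OF that]]
    by (intro bounded_linear_Blinfun_apply bounded_linear_const_mult has_derivative_bounded_linear)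
  have contL: "continuous_on (?B \<times> cbox 0 1) (\<lambda>(y, t). L y t)"
  proof (rule continuous_on_blinfun_componentwise)
    fix i :: 'a
    have "continuous_on (?B \<times> cbox 0 1) (\<lambda>(y, t). t ^ Suc n * ?D (?p y t) i)"
      by (rule continuous_on_radial[OF contD])
    then show "continuous_on (?B \<times> cbox 0 1) (\<lambda>z. blinfun_apply (case z of (y, t) \<Rightarrow> L y t) i)"
      by (rule continuous_on_eq) (auto simp: L)
  qed
  have der: "((\<lambda>y. integral (cbox 0 1) (\<lambda>t. t ^ n * f (?p y t))) has_derivative
      blinfun_apply (integral (cbox 0 1) (L y))) (at y)" if y: "y \<in> ?B" for y
  proof -
    have "((\<lambda>y. integral (cbox 0 1) (\<lambda>t. t ^ n * f (?p y t))) has_derivative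
      blinfun_apply (integral (cbox 0 1) (L y))) (at y within ?B)"
    proof (rule leibniz_rule[OF _ _ contL y convex_ball])
      fix y and t :: real assume yt: "y \<in> ?B" "t \<in> cbox 0 1"
      have "((\<lambda>y. f (?p y t)) has_derivative (\<lambda>v. ?D (?p y t) (t *\<^sub>R v))) (at y)"
        by (rule has_derivative_compose[of "\<lambda>y. ?p y t", OF _ fD[OF segment_in_ball[OF yt]]])
          (auto intro!: derivative_eq_intros)
      then have "((\<lambda>y. t ^ n * f (?p y t)) has_derivative (\<lambda>v. t ^ n * ?D (?p y t) (t *\<^sub>R v))) (at y)"
        by (rule has_derivative_mult_right)
      moreover have "(\<lambda>v. t ^ n * ?D (?p y t) (t *\<^sub>R v)) = blinfun_apply (L y t)"
        by (simp add: L[OF yt] linear_scale[OF lin[OF segment_in_ball[OF yt]]] ac_simps)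
      ultimately show "((\<lambda>y. t ^ n * f (?p y t)) has_derivative blinfun_apply (L y t)) (at y within ?B)"
        using has_derivative_at_withinI by metis
    next
      fix y assume "y \<in> ?B"
      have "continuous_on ?B f"
        using fD has_derivative_continuous by (blast intro: continuous_at_imp_continuous_on)
      then show "(\<lambda>t. t ^ n * f (?p y t)) integrable_on cbox 0 1"
        using \<open>y \<in> ?B\<close> by (intro integrable_continuous continuous_on_radial_slice)
    qed
    then show ?thesis using y at_within_open[of y ?B] by simp
  qed
  show ?case
  proof (rule Ck_on_SucI[OF open_ball der])
    fix v
    have "Ck_on k (\<lambda>y. integral (cbox 0 1) (\<lambda>t. t ^ Suc n * ?D (?p y t) v)) ?B"
      using Suc.prems by (intro Suc.IH[of "\<lambda>x. ?D x v"]) simp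
    moreover have "integral (cbox 0 1) (\<lambda>t. t ^ Suc n * ?D (?p y t) v)
        = blinfun_apply (integral (cbox 0 1) (L y)) v" if y: "y \<in> ?B" for y
    proof -
      have "continuous_on (cbox 0 1) (L y)"
        using continuous_on_compose2[OF contL, of "cbox 0 1" "\<lambda>t. (y, t)"] y
        by (simp add: continuous_on_Pair image_subset_iff)
      then have "blinfun_apply (integral (cbox 0 1) (L y)) v = integral (cbox 0 1) (\<lambda>t. blinfun_apply (L y t) v)"
        by (intro blinfun_apply_integral integrable_continuous)
      also have "\<dots> = integral (cbox 0 1) (\<lambda>t. t ^ Suc n * ?D (?p y t) v)"
        by (rule integral_cong) (simp add: L[OF y])
      finally show ?thesis by simp
    qed
    ultimately show "Ck_on k (\<lambda>y. blinfun_apply (integral (cbox 0 1) (L y)) v) ?B"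
      using Ck_on_cong[OF open_ball] by (metis (no_types, lifting))
  qed
qed

text \<open>Integrating the derivative of \<open>f\<close> along the segment from \<open>a\<close>
  to \<open>x\<close>, and expanding the direction x - a in the basis, leaves as coefficients the
  averages of the partial derivatives. These are radial integrals with weight t^0.\<close>

lemma hadamard:
  fixes a :: "'a::euclidean_space"
  assumes f: "Cinf_on f (ball a r)" and "r > 0"
  obtains H where "\<And>b. Cinf_on (H b) (ball a r)"
    and "\<And>x. x \<in> ball a r \<Longrightarrow> f x = f a + (\<Sum>b\<in>Basis. ((x - a) \<bullet> b) * H b x)"
    and "\<And>b. H b a = frechet_derivative f (at a) b"
proof
  let ?D = "\<lambda>x. frechet_derivative f (at x)" and ?p = "\<lambda>y t. a + t *\<^sub>R (y - a)"
  define H where "H b = (\<lambda>y. integral (cbox 0 1) (\<lambda>t. t ^ 0 * ?D (?p y t) b))" for b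
  show "Cinf_on (H b) (ball a r)" for b
    unfolding H_def
    by (rule Cinf_onI, rule Ck_on_radial_integral, rule Cinf_onD, rule Cinf_on_frechet[OF f])
  show "H b a = ?D a b" for b by (simp add: H_def)
  fix x assume x: "x \<in> ball a r"
  have fD: "(f has_derivative ?D y) (at y)" if "y \<in> ball a r" for y
    using Cinf_on_differentiable[OF f that] by (simp add: frechet_derivative_works)
  have der: "((\<lambda>t. f (?p x t)) has_vector_derivative ?D (?p x t) (x - a)) (at t within {0..1})"
    if "t \<in> {0..1}" for t
  proof -
    have t: "?p x t \<in> ball a r" using segment_in_ball[OF x] that by simp
    have "((\<lambda>t. f (?p x t)) has_derivative (\<lambda>s. ?D (?p x t) (s *\<^sub>R (x - a)))) (at t)"
      by (rule has_derivative_compose[of "?p x", OF _ fD[OF t]]) (auto intro!: derivative_eq_intros)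
    then show ?thesis
      by (simp add: has_vector_derivative_def has_derivative_at_withinI
          linear_scale[OF has_derivative_linear[OF fD[OF t]]])
  qed
  have cont: "continuous_on (cbox 0 1) (\<lambda>t. ?D (?p x t) b)" for b
    using continuous_on_radial_slice[OF Cinf_on_continuous[OF Cinf_on_frechet[OF f]] x, of 0 b] by simp
  have exp: "?D (?p x t) (x - a) = (\<Sum>b\<in>Basis. ((x - a) \<bullet> b) * ?D (?p x t) b)" if "t \<in> cbox 0 1" for t
  proof -
    have "linear (?D (?p x t))" using fD[OF segment_in_ball[OF x that]] has_derivative_linear by blast
    then have "?D (?p x t) (\<Sum>b\<in>Basis. ((x - a) \<bullet> b) *\<^sub>R b) = (\<Sum>b\<in>Basis. ((x - a) \<bullet> b) * ?D (?p x t) b)"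
      by (simp add: linear_sum linear_scale)
    then show ?thesis by (simp add: euclidean_representation)
  qed
  have "f x - f a = integral (cbox 0 1) (\<lambda>t. ?D (?p x t) (x - a))"
    using fundamental_theorem_of_calculus[of 0 1, OF _ der] by (simp add: integral_unique)
  also have "\<dots> = integral (cbox 0 1) (\<lambda>t. \<Sum>b\<in>Basis. ((x - a) \<bullet> b) * ?D (?p x t) b)"
    by (rule integral_cong) (rule exp)
  also have "\<dots> = (\<Sum>b\<in>Basis. ((x - a) \<bullet> b) * H b x)"
    unfolding H_def
    by (subst integral_sum)
      (auto intro!: integrable_continuous_real continuous_on_mult_left cont[unfolded cbox_interval])
  finally show "f x = f a + (\<Sum>b\<in>Basis. ((x - a) \<bullet> b) * H b x)" by simp
qed

section \<open>Derivations of function algebras\<close>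

definition function_algebra :: "('p \<Rightarrow> real) set \<Rightarrow> bool" where
  "function_algebra A \<longleftrightarrow> (\<forall>c. (\<lambda>_. c) \<in> A) \<and>
     (\<forall>f\<in>A. \<forall>g\<in>A. (\<lambda>x. f x + g x) \<in> A) \<and> (\<forall>f\<in>A. \<forall>g\<in>A. (\<lambda>x. f x * g x) \<in> A)"

lemma function_algebra_const: "function_algebra A \<Longrightarrow> (\<lambda>_. c) \<in> A"
  and function_algebra_add: "function_algebra A \<Longrightarrow> f \<in> A \<Longrightarrow> g \<in> A \<Longrightarrow> (\<lambda>x. f x + g x) \<in> A"
  and function_algebra_mult: "function_algebra A \<Longrightarrow> f \<in> A \<Longrightarrow> g \<in> A \<Longrightarrow> (\<lambda>x. f x * g x) \<in> A"
  by (auto simp: function_algebra_def)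

lemma function_algebra_sum:
  "function_algebra A \<Longrightarrow> (\<And>i. i \<in> S \<Longrightarrow> F i \<in> A) \<Longrightarrow> (\<lambda>x. \<Sum>i\<in>S. F i x) \<in> A"
  by (induction S rule: infinite_finite_induct)
    (auto intro: function_algebra_const function_algebra_add)

lemma tangent_space_add:
  "v \<in> tangent_space A p \<Longrightarrow> f \<in> A \<Longrightarrow> g \<in> A \<Longrightarrow> v (\<lambda>x. f x + g x) = v f + v g"
  and tangent_space_scale: "v \<in> tangent_space A p \<Longrightarrow> f \<in> A \<Longrightarrow> v (\<lambda>x. c * f x) = c * v f"
  and tangent_space_mult:
  "v \<in> tangent_space A p \<Longrightarrow> f \<in> A \<Longrightarrow> g \<in> A \<Longrightarrow> v (\<lambda>x. f x * g x) = f p * v g + v f * g p"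
  and tangent_space_outside: "v \<in> tangent_space A p \<Longrightarrow> f \<notin> A \<Longrightarrow> v f = 0"
  by (simp_all add: tangent_space_def)

lemma tangent_space_const:
  assumes "function_algebra A" "v \<in> tangent_space A p"
  shows "v (\<lambda>_. c) = 0"
proof -
  have 1: "(\<lambda>_. 1) \<in> A" using assms(1) by (rule function_algebra_const)
  show ?thesis
    using tangent_space_mult[OF assms(2) 1 1] tangent_space_scale[OF assms(2) 1, of c] by simp
qed

lemma tangent_space_sum:
  assumes "function_algebra A" "v \<in> tangent_space A p"
  shows "(\<And>i. i \<in> S \<Longrightarrow> F i \<in> A) \<Longrightarrow> v (\<lambda>x. \<Sum>i\<in>S. F i x) = (\<Sum>i\<in>S. v (F i))"
proof (induction S rule: infinite_finite_induct)
  case (insert i S)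
  then have "F i \<in> A" "(\<lambda>x. \<Sum>i\<in>S. F i x) \<in> A"
    using function_algebra_sum[OF assms(1), of S F] by auto
  then have "v (\<lambda>x. F i x + (\<Sum>i\<in>S. F i x)) = v (F i) + v (\<lambda>x. \<Sum>i\<in>S. F i x)"
    by (rule tangent_space_add[OF assms(2)])
  with insert show ?case by simp
qed (simp_all add: tangent_space_const[OF assms])

text \<open>The map \<open>x\<close> serves as a system of global coordinates, and \<open>f\<close>
  is a function of them only near \<open>p\<close>. In the expansion of Hadamard, a derivation
  annihilates the constant and each factor x - a vanishes at the point, so the coefficients enter
  only by their values there, the partial derivatives. The bump function turns the local expansion
  into an identity between elements of \<open>A\<close>.\<close>

lemma tangent_vector_chain:
  fixes x :: "'p \<Rightarrow> 'e::euclidean_space"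
  assumes alg: "function_algebra A" and v: "v \<in> tangent_space A p"
    and x: "\<And>\<Psi>. Cinf_on \<Psi> UNIV \<Longrightarrow> (\<lambda>q. \<Psi> (x q)) \<in> A"
    and "open U" "x p \<in> U" "Cinf_on \<Psi> U"
    and f: "f \<in> A" "\<And>q. x q \<in> U \<Longrightarrow> f q = \<Psi> (x q)"
  shows "v f = frechet_derivative \<Psi> (at (x p)) (\<Sum>b\<in>Basis. v (\<lambda>q. x q \<bullet> b) *\<^sub>R b)"
proof -
  let ?a = "x p"
  obtain r where r: "r > 0" "ball ?a r \<subseteq> U"
    using \<open>open U\<close> \<open>x p \<in> U\<close> open_contains_ball by blast
  have \<Psi>: "Cinf_on \<Psi> (ball ?a r)" using r(2) \<open>Cinf_on \<Psi> U\<close> Cinf_on_subset by blast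
  obtain H where H: "\<And>b. Cinf_on (H b) (ball ?a r)"
    and Hf: "\<And>x. x \<in> ball ?a r \<Longrightarrow> \<Psi> x = \<Psi> ?a + (\<Sum>b\<in>Basis. ((x - ?a) \<bullet> b) * H b x)"
    and Ha: "\<And>b. H b ?a = frechet_derivative \<Psi> (at ?a) b"
    using hadamard[OF \<Psi> r(1)] by metis
  obtain \<beta> where \<beta>: "Cinf_on \<beta> UNIV" "\<beta> ?a = (1::real)" "\<And>x. dist ?a x \<ge> r / 2 \<Longrightarrow> \<beta> x = 0"
    using smooth_bump_exists[of "r / 2"] r(1) by (metis half_gt_zero)
  define G where "G b = (\<lambda>x. if x \<in> ball ?a r then \<beta> x * H b x else 0)" for b
  have "Cinf_on (G b) UNIV" for b
    unfolding G_def using r(1) by (intro Cinf_on_cutoff[where s = "r / 2", OF H \<beta>(1) _ \<beta>(3)]) auto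
  then have GA: "(\<lambda>q. G b (x q)) \<in> A" for b by (rule x)
  have \<beta>A: "(\<lambda>q. \<beta> (x q)) \<in> A" using \<beta>(1) by (rule x)
  have "Cinf_on (\<lambda>y. y \<bullet> b) UNIV" for b :: 'e
    by (rule Cinf_on_linear) (auto intro: bounded_linear_inner_left)
  then have xA: "(\<lambda>q. x q \<bullet> b) \<in> A" for b by (rule x)
  have dA: "(\<lambda>q. x q \<bullet> b + (- (?a \<bullet> b))) \<in> A" for b
    by (intro function_algebra_add[OF alg] xA function_algebra_const[OF alg])
  have vadd: "v (\<lambda>x. f x + g x) = v f + v g" and vmult: "v (\<lambda>x. f x * g x) = f p * v g + v f * g p"
    if "f \<in> A" "g \<in> A" for f g
    using tangent_space_add[OF v that] tangent_space_mult[OF v that] .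
  have fa: "f p = \<Psi> ?a" using f(2) \<open>x p \<in> U\<close> by blast
  have "\<beta> (x q) * f q = \<Psi> ?a * \<beta> (x q) + (\<Sum>b\<in>Basis. (x q \<bullet> b + (- (?a \<bullet> b))) * G b (x q))" for q
  proof (cases "x q \<in> ball ?a r")
    case True
    then have "f q = \<Psi> ?a + (\<Sum>b\<in>Basis. ((x q - ?a) \<bullet> b) * H b (x q))"
      using Hf f(2) r(2) by auto
    with True show ?thesis
      by (simp add: G_def distrib_left sum_distrib_left inner_diff_left mult.left_commute
          mult.commute[of "\<Psi> ?a"])
  next
    case False
    then have "\<beta> (x q) = 0" using \<beta>(3) r(1) by auto
    with False show ?thesis by (simp add: G_def)
  qed
  then have "v (\<lambda>q. \<beta> (x q) * f q)
      = v (\<lambda>q. \<Psi> ?a * \<beta> (x q) + (\<Sum>b\<in>Basis. (x q \<bullet> b + (- (?a \<bullet> b))) * G b (x q)))"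
    by presburger
  also have "\<dots> = v (\<lambda>q. \<Psi> ?a * \<beta> (x q)) + (\<Sum>b\<in>Basis. v (\<lambda>q. (x q \<bullet> b + (- (?a \<bullet> b))) * G b (x q)))"
    by (subst vadd)
      (auto intro!: function_algebra_mult[OF alg] function_algebra_sum[OF alg] \<beta>A GA
        dA[unfolded add_uminus_conv_diff]
        function_algebra_const[OF alg] tangent_space_sum[OF alg v])
  also have "(\<Sum>b\<in>Basis. v (\<lambda>q. (x q \<bullet> b + (- (?a \<bullet> b))) * G b (x q)))
      = (\<Sum>b\<in>Basis. v (\<lambda>q. x q \<bullet> b) * frechet_derivative \<Psi> (at ?a) b)"
  proof (rule sum.cong)
    fix b :: 'e
    have "v (\<lambda>q. (x q \<bullet> b + (- (?a \<bullet> b))) * G b (x q)) = v (\<lambda>q. x q \<bullet> b + (- (?a \<bullet> b))) * G b ?a"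
      by (subst vmult[OF dA GA]) simp
    also have "v (\<lambda>q. x q \<bullet> b + (- (?a \<bullet> b))) = v (\<lambda>q. x q \<bullet> b)"
      by (subst vadd) (simp_all add: xA function_algebra_const[OF alg] tangent_space_const[OF alg v])
    also have "G b ?a = frechet_derivative \<Psi> (at ?a) b" using r(1) \<beta>(2) by (simp add: G_def Ha)
    finally show "v (\<lambda>q. (x q \<bullet> b + (- (?a \<bullet> b))) * G b (x q))
        = v (\<lambda>q. x q \<bullet> b) * frechet_derivative \<Psi> (at ?a) b" .
  qed simp
  also have "v (\<lambda>q. \<Psi> ?a * \<beta> (x q)) = \<Psi> ?a * v (\<lambda>q. \<beta> (x q))"
    by (rule tangent_space_scale[OF v \<beta>A])
  \<comment> \<open>By the product rule the left-hand side is v f plus \<Psi>(a) times the value of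
    \<open>v\<close> on the bump function; the second term also occurs on the right and
    cancels.\<close>
  finally have "v f = (\<Sum>b\<in>Basis. v (\<lambda>q. x q \<bullet> b) * frechet_derivative \<Psi> (at ?a) b)"
    using vmult[OF \<beta>A f(1)] \<beta>(2) fa by simp
  moreover have "linear (frechet_derivative \<Psi> (at ?a))"
    using Cinf_on_differentiable[OF \<open>Cinf_on \<Psi> U\<close> \<open>x p \<in> U\<close>] linear_frechet_derivative by blast
  ultimately show ?thesis by (simp add: linear_sum linear_scale)
qed

section \<open>Matrices graded by a complex structure and a reflection\<close>

lemma matrix_mult_bilinear: "bounded_bilinear ((**) :: real^'n^'m \<Rightarrow> real^'p^'n \<Rightarrow> real^'p^'m)"
proof -
  have "bilinear ((**) :: real^'n^'m \<Rightarrow> real^'p^'n \<Rightarrow> real^'p^'m)"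
    by (auto simp: bilinear_def linear_iff matrix_matrix_mult_def vec_eq_iff sum.distrib
        sum_distrib_left algebra_simps)
  then show ?thesis by (simp add: bilinear_conv_bounded_bilinear)
qed

interpretation mm: bounded_bilinear "(**) :: real^'n^'m \<Rightarrow> real^'p^'n \<Rightarrow> real^'p^'m"
  by (rule matrix_mult_bilinear)

lemmas matrix_algebra = mm.add_left mm.add_right mm.diff_left mm.diff_right mm.minus_left
  mm.minus_right mm.scaleR_left mm.scaleR_right matrix_mul_assoc[symmetric]

lemma transpose_linear: "bounded_linear (transpose :: real^'n^'m \<Rightarrow> real^'m^'n)"
  by (rule linear_conv_bounded_linear[THEN iffD1]) (simp add: linear_iff transpose_def vec_eq_iff)

lemma transpose_algebra:
  fixes A B :: "real^'n^'m" and C :: "real^'p^'n"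
  shows "transpose (A + B) = transpose A + transpose B" "transpose (A - B) = transpose A - transpose B"
    "transpose (- A) = - transpose A" "transpose (c *\<^sub>R A) = c *\<^sub>R transpose A"
    "transpose (A ** C) = transpose C ** transpose A"
  by (simp_all add: transpose_def vec_eq_iff matrix_matrix_mult_def mult.commute)

definition skew :: "real^'n^'n \<Rightarrow> bool" where
  "skew A \<longleftrightarrow> transpose A = - A"

definition comm :: "real^'n^'n \<Rightarrow> real^'n^'n \<Rightarrow> real^'n^'n" where
  "comm A B = A ** B - B ** A"

lemma skew_add: "skew A \<Longrightarrow> skew B \<Longrightarrow> skew (A + B)"
  and skew_diff: "skew A \<Longrightarrow> skew B \<Longrightarrow> skew (A - B)"
  and skew_scaleR: "skew A \<Longrightarrow> skew (c *\<^sub>R A)"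
  and skew_comm: "skew A \<Longrightarrow> skew B \<Longrightarrow> skew (comm A B)"
  and skew_conj: "skew A \<Longrightarrow> skew (Q ** A ** transpose Q)"
  by (simp_all add: skew_def comm_def transpose_algebra matrix_algebra)

locale two_structures =
  fixes I S :: "real^'n^'n"
  assumes II: "I ** I = - mat 1" and SS: "S ** S = mat 1" and IS: "S ** I = I ** S"
    and I_skew: "transpose I = - I" and S_sym: "transpose S = S"
begin

text \<open>In products associated to the right, these rules bring each block of adjacent factors
  \<open>I\<close> and \<open>S\<close> into a normal form, with \<open>I\<close> before
  \<open>S\<close> and neither repeated.\<close>

lemma II': "I ** (I ** A) = - A" and SS': "S ** (S ** A) = A" and IS': "S ** (I ** A) = I ** (S ** A)"
  using II SS IS by (simp_all add: matrix_mul_assoc) (simp add: matrix_algebra)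

lemmas relations = II SS IS II' SS' IS'

text \<open>The projection onto the matrices that anticommute with \<open>I\<close>. For
  \<open>S\<close>, \<open>offd\<close> does the same; the opposite sign comes from \<open>S\<close>
  squaring to 1 instead of -1.\<close>

definition anti :: "real^'n^'n \<Rightarrow> real^'n^'n" where
  "anti A = (1/2) *\<^sub>R (A + I ** A ** I)"

definition offd :: "real^'n^'n \<Rightarrow> real^'n^'n" where
  "offd A = (1/2) *\<^sub>R (A - S ** A ** S)"

text \<open>Inclusion-exclusion for two commuting projections. The kernel is the centralizer of
  \<open>I\<close> and \<open>S\<close>; on skew matrices this is the projection along the isotropy
  algebra.\<close>

definition mproj :: "real^'n^'n \<Rightarrow> real^'n^'n" where
  "mproj A = anti A + offd A - offd (anti A)"

text \<open>The three summands of the complement of the isotropy algebra consist of the matrices that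
  commute with \<open>I\<close> and anticommute with \<open>S\<close>, that anticommute with both, and that anticommute with
  \<open>I\<close> and commute with \<open>S\<close>. The factor \<open>S\<close> on the first one keeps the image skew. The parameter
  \<open>e\<close> is the sign on the second one.\<close>

definition acs :: "real \<Rightarrow> real^'n^'n \<Rightarrow> real^'n^'n" where
  "acs e A = I ** S ** offd (A - anti A) + e *\<^sub>R (I ** offd (anti A)) + I ** (anti A - offd (anti A))"

lemma anti_linear: "bounded_linear anti" and offd_linear: "bounded_linear offd"
  unfolding anti_def offd_def
  by (intro bounded_linear_intros bounded_linear_compose[OF mm.bounded_linear_left]
      bounded_linear_compose[OF mm.bounded_linear_right])+

interpretation an: bounded_linear anti by (rule anti_linear)
interpretation od: bounded_linear offd by (rule offd_linear)

lemma mproj_linear: "bounded_linear mproj"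
  unfolding mproj_def
  by (intro bounded_linear_add bounded_linear_sub bounded_linear_compose[OF offd_linear] anti_linear offd_linear)

lemma acs_linear: "bounded_linear (acs e)"
  unfolding acs_def
  by (intro bounded_linear_add bounded_linear_sub bounded_linear_compose[OF offd_linear] anti_linear
      bounded_linear_ident bounded_linear_compose[OF mm.bounded_linear_right]
      bounded_linear_compose[OF bounded_linear_scaleR_right])

interpretation mp: bounded_linear mproj by (rule mproj_linear)
interpretation ac: bounded_linear "acs e" by (rule acs_linear)

lemma anti_comm: "anti A = - (1/2) *\<^sub>R (comm A I ** I)"
  by (simp add: anti_def comm_def matrix_algebra relations algebra_simps)

lemma offd_comm: "offd A = (1/2) *\<^sub>R (comm A S ** S)"
  by (simp add: offd_def comm_def matrix_algebra relations algebra_simps)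

lemma anti_anti: "anti (anti A) = anti A"
proof -
  have "I ** (A + I ** A ** I) ** I = A + I ** A ** I"
    by (simp add: matrix_algebra relations)
  then have "anti (A + I ** A ** I) = A + I ** A ** I"
    unfolding anti_def[of "A + I ** A ** I"] by (simp only: scaleR_half_double)
  then show ?thesis by (simp add: anti_def[of A] an.scaleR)
qed

lemma offd_offd: "offd (offd A) = offd A"
proof -
  have "S ** (A - S ** A ** S) ** S = - (A - S ** A ** S)"
    by (simp add: matrix_algebra relations)
  then have "offd (A - S ** A ** S) = A - S ** A ** S"
    unfolding offd_def[of "A - S ** A ** S"] by (simp only: diff_minus_eq_add scaleR_half_double)
  then show ?thesis by (simp add: offd_def[of A] od.scaleR)
qed

lemma anti_offd: "anti (offd A) = offd (anti A)"
  by (simp add: anti_def offd_def matrix_algebra relations algebra_simps)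

lemma mproj_eq_0:
  assumes "mproj A = 0"
  shows "A ** I = I ** A" "A ** S = S ** A"
proof -
  have "anti (mproj A) = anti A" "offd (mproj A) = offd A"
    by (simp_all add: mproj_def an.add an.diff od.add od.diff anti_anti offd_offd anti_offd)
  then have "anti A = 0" "offd A = 0" using assms by (simp_all add: an.zero od.zero)
  then have "comm A I ** I ** I = 0" "comm A S ** S ** S = 0"
    by (simp_all add: anti_comm offd_comm)
  then show "A ** I = I ** A" "A ** S = S ** A"
    by (simp_all add: comm_def matrix_algebra relations)
qed

lemma mproj_mproj: "mproj (mproj A) = mproj A"
  by (simp add: mproj_def an.add an.diff od.add od.diff anti_anti offd_offd anti_offd)

text \<open>Recovers \<open>A\<close>, modulo the centralizer, from its commutators with \<open>I\<close> and \<open>S\<close>.\<close>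

definition recover :: "real^'n^'n \<Rightarrow> real^'n^'n \<Rightarrow> real^'n^'n" where
  "recover X Y = - (1/2) *\<^sub>R (X ** I) + (1/2) *\<^sub>R (Y ** S) + (1/2) *\<^sub>R offd (X ** I)"

lemma recover_comm: "recover (comm A I) (comm A S) = mproj A"
  by (simp add: recover_def mproj_def anti_comm offd_comm[of A] od.scaleR od.neg)

text \<open>The grading by Z/2 x Z/2, with the signs entered as real numbers: the effect of
  \<open>mproj\<close> and \<open>acs\<close> on a homogeneous matrix is then described by
  coefficients that are polynomial in \<open>a\<close> and \<open>b\<close>.\<close>

definition graded :: "real \<Rightarrow> real \<Rightarrow> real^'n^'n \<Rightarrow> bool" where
  "graded a b A \<longleftrightarrow> A ** I = a *\<^sub>R (I ** A) \<and> A ** S = b *\<^sub>R (S ** A)"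

lemma graded_left:
  assumes "graded a b A"
  shows "A ** I = a *\<^sub>R (I ** A)" "A ** S = b *\<^sub>R (S ** A)"
    "A ** (I ** X) = a *\<^sub>R (I ** (A ** X))" "A ** (S ** X) = b *\<^sub>R (S ** (A ** X))"
  using assms by (simp_all add: graded_def matrix_mul_assoc mm.scaleR_left)

lemma graded_mult:
  assumes "graded a b A" "graded c d B"
  shows "graded (a * c) (b * d) (A ** B)"
  by (simp add: graded_def matrix_algebra graded_left[OF assms(1)] graded_left[OF assms(2)] mult.commute)

lemma graded_I: "graded a b A \<Longrightarrow> graded a b (I ** A)"
  and graded_S: "graded a b A \<Longrightarrow> graded a b (S ** A)"
  by (simp_all add: graded_def matrix_algebra relations algebra_simps)

lemma graded_anti: "graded a b A \<Longrightarrow> anti A = ((1 - a) / 2) *\<^sub>R A"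
  by (simp add: graded_def anti_def matrix_algebra relations) (simp add: vec_eq_iff field_simps)

lemma graded_offd: "graded a b A \<Longrightarrow> offd A = ((1 - b) / 2) *\<^sub>R A"
  by (simp add: graded_def offd_def matrix_algebra relations) (simp add: vec_eq_iff field_simps)

lemma graded_mproj:
  assumes "graded a b A"
  shows "mproj A = (1 - (1 + a) * (1 + b) / 4) *\<^sub>R A"
  unfolding mproj_def graded_anti[OF assms] graded_offd[OF assms] od.scaleR
  by (simp add: vec_eq_iff field_simps)

text \<open>For signs (a, b), the first coefficient is 1 on (1, -1) and 0 elsewhere; the second is
  \<open>e\<close> on (-1, -1), 1 on (-1, 1) and 0 elsewhere.\<close>

lemma graded_acs:
  assumes "graded a b A"
  shows "acs e A = ((1 + a) * (1 - b) / 4) *\<^sub>R (I ** (S ** A))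
    + ((1 - a) * (e * (1 - b) + (1 + b)) / 4) *\<^sub>R (I ** A)"
  unfolding acs_def od.diff graded_anti[OF assms] graded_offd[OF assms] od.scaleR matrix_algebra
  by (simp add: vec_eq_iff field_simps)

lemma graded_parts:
  "graded 1 (-1) (offd (A - anti A))" "graded (-1) (-1) (offd (anti A))"
  "graded (-1) 1 (anti A - offd (anti A))"
proof -
  have a: "anti A ** I = - (I ** anti A)" for A
    by (simp add: anti_def matrix_algebra relations algebra_simps)
  have o: "offd A ** S = - (S ** offd A)" for A
    by (simp add: offd_def matrix_algebra relations algebra_simps)
  have "A - anti A = (1/2) *\<^sub>R (A - I ** A ** I)" "A - offd A = (1/2) *\<^sub>R (A + S ** A ** S)" for A
    by (simp_all add: anti_def offd_def vec_eq_iff field_simps)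
  then have l: "(A - anti A) ** I = I ** (A - anti A)" and d: "(A - offd A) ** S = S ** (A - offd A)" for A
    by (simp_all add: matrix_algebra relations add.commute)
  show "graded 1 (-1) (offd (A - anti A))" using o[of "A - anti A"] l[of "offd A"]
    by (simp add: graded_def od.diff anti_offd)
  show "graded (-1) (-1) (offd (anti A))" using o[of "anti A"] a[of "offd A"]
    by (simp add: graded_def anti_offd)
  show "graded (-1) 1 (anti A - offd (anti A))" using d[of "anti A"] a[of "A - offd A"]
    by (simp add: graded_def anti_offd an.diff)
qed

lemma graded_decomposition:
  obtains A0 A1 A2 A3 where "A = A0 + A1 + A2 + A3"
    "graded 1 1 A0" "graded 1 (-1) A1" "graded (-1) (-1) A2" "graded (-1) 1 A3"
    "mproj A = A1 + A2 + A3"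
proof
  show "graded 1 1 (A - mproj A)"
    using mproj_eq_0[of "A - mproj A"] by (simp add: graded_def mp.diff mproj_mproj)
  show "A = A - mproj A + offd (A - anti A) + offd (anti A) + (anti A - offd (anti A))"
    "mproj A = offd (A - anti A) + offd (anti A) + (anti A - offd (anti A))"
    by (simp_all add: mproj_def od.diff)
qed (rule graded_parts)+

text \<open>On the homogeneous parts \<open>acs e\<close> is multiplication by I S, by e I or by I.
  Each of these squares to -1, and the part that commutes with both \<open>I\<close> and
  \<open>S\<close> is sent to 0.\<close>

lemma acs_acs:
  assumes "e = 1 \<or> e = -1"
  shows "acs e (acs e A) = - mproj A" "mproj (acs e A) = acs e A" "acs e (mproj A) = acs e A"
proof -
  obtain A0 A1 A2 A3 where A: "A = A0 + A1 + A2 + A3"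
    and g: "graded 1 1 A0" "graded 1 (-1) A1" "graded (-1) (-1) A2" "graded (-1) 1 A3"
    and m: "mproj A = A1 + A2 + A3"
    by (rule graded_decomposition)
  have J: "acs e A0 = 0" "acs e A1 = I ** (S ** A1)" "acs e A2 = e *\<^sub>R (I ** A2)" "acs e A3 = I ** A3"
    using g[THEN graded_acs[where e = e]] by simp_all
  note g' = g(2)[THEN graded_S, THEN graded_I] g(3)[THEN graded_I] g(4)[THEN graded_I]
  have e2: "e * e = 1" using assms by auto
  show "acs e (acs e A) = - mproj A" "mproj (acs e A) = acs e A" "acs e (mproj A) = acs e A"
    using g'[THEN graded_acs[where e = e]] g'[THEN graded_mproj] e2
    by (simp_all add: m, simp_all add: A ac.add mp.add J ac.scaleR mp.scaleR matrix_algebra relations)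
qed

text \<open>Since \<open>I\<close> is skew and \<open>S\<close> is symmetric, the transpose of
  \<open>Q\<close> commutes with both as well. Through these identities the structure descends from
  SO(8) to the quotient.\<close>

lemma equivariance:
  assumes "orthogonal_matrix Q" "Q ** I = I ** Q" "Q ** S = S ** Q"
  shows "mproj (Q ** A ** transpose Q) = Q ** mproj A ** transpose Q"
    "acs e (Q ** A ** transpose Q) = Q ** acs e A ** transpose Q"
proof -
  have t: "transpose Q ** I = I ** transpose Q" "transpose Q ** S = S ** transpose Q"
  proof -
    have "transpose (Q ** I) = transpose (I ** Q)" "transpose (Q ** S) = transpose (S ** Q)"
      using assms by simp_all
    then show "transpose Q ** I = I ** transpose Q" "transpose Q ** S = S ** transpose Q"
      by (simp_all add: transpose_algebra I_skew S_sym mm.minus_left mm.minus_right)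
  qed
  have l: "Q ** (I ** X) = I ** (Q ** X)" "Q ** (S ** X) = S ** (Q ** X)"
    "transpose Q ** (I ** X) = I ** (transpose Q ** X)"
    "transpose Q ** (S ** X) = S ** (transpose Q ** X)" for X
    using assms t by (simp_all add: matrix_mul_assoc)
  have an: "anti (Q ** A ** transpose Q) = Q ** anti A ** transpose Q"
    and od: "offd (Q ** A ** transpose Q) = Q ** offd A ** transpose Q" for A
    by (simp_all add: anti_def offd_def matrix_algebra l t assms)
  show "mproj (Q ** A ** transpose Q) = Q ** mproj A ** transpose Q"
    by (simp add: mproj_def an od mm.add_left mm.add_right mm.diff_left mm.diff_right)
  show "acs e (Q ** A ** transpose Q) = Q ** acs e A ** transpose Q"
    unfolding acs_def an od
    unfolding mm.diff_left[symmetric] mm.diff_right[symmetric] od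
    by (simp add: matrix_algebra l t)
qed

lemma skew_mproj: "skew A \<Longrightarrow> skew (mproj A)" and skew_acs: "skew A \<Longrightarrow> skew (acs e A)"
proof -
  assume A: "skew A"
  have an: "skew (anti A)" if "skew A" for A
    using that by (simp add: skew_def anti_def transpose_algebra I_skew matrix_algebra
        flip: scaleR_minus_right)
  have od: "skew (offd A)" if "skew A" for A
    using that by (simp add: skew_def offd_def transpose_algebra S_sym matrix_algebra
        flip: scaleR_minus_right)
  show "skew (mproj A)" using A by (auto simp: mproj_def intro!: skew_add skew_diff an od)
  have aI: "skew (I ** B)" if "skew B" "graded (-1) b B" for B b
    using that by (simp add: skew_def graded_def transpose_algebra I_skew matrix_algebra)
  have oIS: "skew (I ** (S ** B))" if "skew B" "graded 1 (-1) B" for B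
    using that by (simp add: skew_def graded_def transpose_algebra I_skew S_sym matrix_algebra relations)
  note 1 = graded_parts[of A]
  show "skew (acs e A)" unfolding acs_def
    using 1 A by (auto simp: matrix_mul_assoc[symmetric] intro!: skew_add skew_scaleR skew_diff an od aI oIS)
qed

text \<open>The Nijenhuis tensor of an invariant structure at the base point, with the brackets of
  so(8) projected to the complement. As \<open>acs e\<close> contains this projection,
  \<open>mproj\<close> appears only in the first and the last term.\<close>

definition nij :: "real \<Rightarrow> real^'n^'n \<Rightarrow> real^'n^'n \<Rightarrow> real^'n^'n" where
  "nij e A B = mproj (comm (acs e A) (acs e B)) - acs e (comm (acs e A) B)
     - acs e (comm A (acs e B)) - mproj (comm A B)"

lemma comm_add_left: "comm (A + B) C = comm A C + comm B C"
  and comm_add_right: "comm A (B + C) = comm A B + comm A C"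
  by (simp_all add: comm_def matrix_algebra algebra_simps)

lemma nij_add_left: "nij e (A + B) C = nij e A C + nij e B C"
  and nij_add_right: "nij e A (B + C) = nij e A B + nij e A C"
  by (simp_all add: nij_def ac.add mp.add comm_add_left comm_add_right algebra_simps)

text \<open>Products of homogeneous matrices are homogeneous, so for each pair of degrees the
  expression reduces to AB and BA multiplied by \<open>I\<close> and \<open>S\<close>. The second
  part concerns \<open>A\<close> in the first and \<open>B\<close> in the third summand, whose
  bracket lies in the summand on which \<open>e\<close> acts.\<close>

lemma nij_graded:
  assumes A: "graded a b A" and B: "graded c d B"
    and "(a, b) \<in> {(1, -1), (-1, -1), (-1, 1)}" "(c, d) \<in> {(1, -1), (-1, -1), (-1, 1)}"
  shows "nij 1 A B = 0"
    "a = 1 \<Longrightarrow> d = 1 \<Longrightarrow> nij (-1) A B = (-2) *\<^sub>R (S ** (A ** B + B ** A) + A ** B - B ** A)"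
proof -
  note AB = graded_mult[OF A B] graded_mult[OF B A]
  note c = graded_left[OF A] graded_left[OF B]
  note Gm = AB[THEN graded_mproj] AB[THEN graded_I, THEN graded_mproj]
    AB[THEN graded_S, THEN graded_mproj] AB[THEN graded_S, THEN graded_I, THEN graded_mproj]
  note Ga = AB[THEN graded_acs] AB[THEN graded_I, THEN graded_acs] AB[THEN graded_S, THEN graded_acs]
    AB[THEN graded_S, THEN graded_I, THEN graded_acs]
  note red = nij_def graded_acs[OF A] graded_acs[OF B] comm_def mp.add mp.diff mp.neg mp.scaleR mp.zero
    ac.add ac.diff ac.neg ac.scaleR ac.zero matrix_algebra c relations
  show "nij 1 A B = 0"
    using assms(3,4) Gm Ga by (elim insertE emptyE) (simp_all add: red)
  show "nij (-1) A B = (-2) *\<^sub>R (S ** (A ** B + B ** A) + A ** B - B ** A)" if "a = 1" "d = 1"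
  proof -
    have bc: "b = -1" "c = -1" using assms(3,4) that by auto
    show ?thesis
      by (simp add: red Gm Ga that bc) (simp add: vec_eq_iff)
  qed
qed

lemma nij_1_eq_0: "mproj A = A \<Longrightarrow> mproj B = B \<Longrightarrow> nij 1 A B = 0"
proof -
  assume "mproj A = A" "mproj B = B"
  moreover obtain A1 A2 A3 where "mproj A = A1 + A2 + A3"
    and gA: "graded 1 (-1) A1" "graded (-1) (-1) A2" "graded (-1) 1 A3"
    by (rule graded_decomposition)
  moreover obtain B1 B2 B3 where "mproj B = B1 + B2 + B3"
    and gB: "graded 1 (-1) B1" "graded (-1) (-1) B2" "graded (-1) 1 B3"
    by (rule graded_decomposition)
  ultimately show ?thesis
    using gA[THEN nij_graded(1), OF gB(1)] gA[THEN nij_graded(1), OF gB(2)] gA[THEN nij_graded(1), OF gB(3)]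
    by (metis (no_types, lifting) nij_add_left nij_add_right add.right_neutral insertCI)
qed

end

section \<open>\<open>U(1) \<times> U(3)\<close> as a centralizer\<close>

lemma sum_UNIV_Plus:
  fixes f :: "'a::finite + 'b::finite \<Rightarrow> 'c::comm_monoid_add"
  shows "(\<Sum>i\<in>UNIV. f i) = (\<Sum>a\<in>UNIV. f (Inl a)) + (\<Sum>b\<in>UNIV. f (Inr b))"
  using sum.Plus[of "UNIV :: 'a set" "UNIV :: 'b set" f] by simp

lemma all_Plus: "(\<forall>i. P i) \<longleftrightarrow> (\<forall>a. P (Inl a)) \<and> (\<forall>b. P (Inr b))"
  by (metis sum.exhaust)

lemma realification_mult: "realification (A ** B) = realification A ** realification B"
  by (simp add: vec_eq_iff all_Plus realification_def matrix_matrix_mult_def sum_UNIV_Plus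
      flip: sum.distrib sum_subtractf sum_negf) (simp add: algebra_simps sum.distrib sum_subtractf sum_negf)

lemma realification_transpose: "transpose (realification A) = realification (conj_transpose A)"
  by (simp add: vec_eq_iff all_Plus realification_def conj_transpose_def transpose_def)

lemma realification_one: "realification (mat 1) = mat 1"
  by (simp add: vec_eq_iff all_Plus realification_def mat_def)

lemma realification_eq_iff: "realification A = realification B \<longleftrightarrow> A = B"
  by (auto simp: vec_eq_iff all_Plus realification_def complex_eq_iff)

lemma block_diag_mult: "block_diag A B ** block_diag C D = block_diag (A ** C) (B ** D)"
  by (simp add: vec_eq_iff all_Plus block_diag_def matrix_matrix_mult_def sum_UNIV_Plus)

lemma block_diag_conj_transpose:
  "conj_transpose (block_diag A B) = block_diag (conj_transpose A) (conj_transpose B)"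
  by (simp add: vec_eq_iff all_Plus block_diag_def conj_transpose_def)

lemma block_diag_one: "block_diag (mat 1) (mat 1) = mat 1"
  by (simp add: vec_eq_iff all_Plus block_diag_def mat_def)

lemma block_diag_eq_iff: "block_diag A B = block_diag C D \<longleftrightarrow> A = C \<and> B = D"
  by (auto simp: vec_eq_iff all_Plus block_diag_def)

text \<open>The realification of \<open>\<i>\<close> times the identity.\<close>

definition I0 :: "real^('n::finite + 'n)^('n + 'n)" where
  "I0 = (\<chi> i j. case (i, j) of (Inl a, Inr b) \<Rightarrow> if a = b then - 1 else 0
     | (Inr a, Inl b) \<Rightarrow> if a = b then 1 else 0 | _ \<Rightarrow> 0)"

definition S0_entry :: "idx8 \<Rightarrow> real" where
  "S0_entry i = (if i = Inl (Inl 1) \<or> i = Inr (Inl 1) then 1 else - 1)"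

definition S0 :: "real^idx8^idx8" where
  "S0 = (\<chi> i j. if i = j then S0_entry i else 0)"

lemma mult_I0:
  fixes A :: "real^('n::finite + 'n)^'m" and B :: "real^'m^('n + 'n)"
  shows
  "(A ** I0) $ i $ Inl b = A $ i $ Inr b" "(A ** I0) $ i $ Inr b = - A $ i $ Inl b"
  "(I0 ** B) $ Inl a $ j = - B $ Inr a $ j" "(I0 ** B) $ Inr a $ j = B $ Inl a $ j"
  by (simp_all add: matrix_matrix_mult_def I0_def sum_UNIV_Plus if_distrib[of "\<lambda>x. _ * x"]
      if_distrib[of "\<lambda>x. x * _"] sum.delta sum.delta' cong: if_cong)

lemma mult_S0: "(A ** S0) $ i $ j = A $ i $ j * S0_entry j" "(S0 ** B) $ i $ j = S0_entry i * B $ i $ j"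
  by (simp_all add: matrix_matrix_mult_def S0_def if_distrib[of "\<lambda>x. _ * x"]
      if_distrib[of "\<lambda>x. x * _"] sum.delta sum.delta' cong: if_cong)

lemma S0_entry_swap: "S0_entry (Inl a) = S0_entry (Inr a)"
  by (simp add: S0_entry_def)

lemma S0_entry_simps [simp]: "S0_entry (Inl (Inl a)) = 1" "S0_entry (Inr (Inl a)) = 1"
  "S0_entry (Inl (Inr b)) = - 1" "S0_entry (Inr (Inr b)) = - 1"
  by (simp_all add: S0_entry_def)

interpretation I0S0: two_structures "I0 :: real^idx8^idx8" S0
proof
  show "I0 ** I0 = - mat 1"
    by (simp add: vec_eq_iff all_Plus mult_I0) (simp add: I0_def mat_def)
  show "S0 ** S0 = mat 1"
    by (simp add: vec_eq_iff mult_S0) (simp add: S0_def S0_entry_def mat_def)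
  show "S0 ** I0 = I0 ** S0"
    by (simp add: vec_eq_iff mult_S0) (simp add: I0_def all_Plus S0_entry_swap)
  show "transpose I0 = - I0"
    by (simp add: vec_eq_iff all_Plus transpose_def I0_def)
  show "transpose S0 = S0"
    by (simp add: vec_eq_iff all_Plus transpose_def S0_def)
qed

text \<open>Commuting with \<open>I0\<close> is complex linearity, and commuting with
  \<open>S0\<close> is preservation of its two eigenspaces, hence block form.\<close>

lemma commutes_I0_S0_iff:
  "Q ** I0 = I0 ** Q \<and> Q ** S0 = S0 ** Q \<longleftrightarrow>
    (\<exists>(A :: complex^1^1) (B :: complex^3^3). Q = realification (block_diag A B))"
proof
  assume *: "Q ** I0 = I0 ** Q \<and> Q ** S0 = S0 ** Q"
  \<comment> \<open>A matrix that commutes with \<open>I0\<close> is determined by its left half,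
    where the real parts stand above the imaginary parts.\<close>
  let ?c = "\<lambda>i j. Complex (Q $ Inl i $ Inl j) (Q $ Inr i $ Inl j)"
  have I: "(Q ** I0) $ i $ j = (I0 ** Q) $ i $ j" and S: "(Q ** S0) $ i $ j = (S0 ** Q) $ i $ j" for i j
    using * by simp_all
  have Z: "Q $ Inl (Inl a) $ Inl (Inr b) = 0" "Q $ Inr (Inl a) $ Inl (Inr b) = 0"
    "Q $ Inl (Inr b) $ Inl (Inl a) = 0" "Q $ Inr (Inr b) $ Inl (Inl a) = 0" for a b
    using S[of "Inl (Inl a)" "Inl (Inr b)"] S[of "Inr (Inl a)" "Inl (Inr b)"]
      S[of "Inl (Inr b)" "Inl (Inl a)"] S[of "Inr (Inr b)" "Inl (Inl a)"]
    by (simp_all add: mult_S0)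
  have "Q = realification (block_diag (\<chi> i j. ?c (Inl i) (Inl j)) (\<chi> i j. ?c (Inr i) (Inr j)))"
    using I[of "Inl _" "Inl _"] I[of "Inr _" "Inl _"] Z
    by (simp add: vec_eq_iff all_Plus realification_def block_diag_def mult_I0 mult_S0)
  then show "\<exists>(A :: complex^1^1) (B :: complex^3^3). Q = realification (block_diag A B)" by blast
next
  assume "\<exists>(A :: complex^1^1) (B :: complex^3^3). Q = realification (block_diag A B)"
  then show "Q ** I0 = I0 ** Q \<and> Q ** S0 = S0 ** Q"
    by (auto simp: vec_eq_iff all_Plus realification_def block_diag_def mult_I0 mult_S0)
qed

text \<open>\<open>realification\<close> and \<open>block_diag\<close> are injective, multiplicative
  and compatible with adjoints, so orthogonality of the large matrix is unitarity of both
  blocks.\<close>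

lemma U1U3_iff: "Q \<in> U1U3 \<longleftrightarrow> orthogonal_matrix Q \<and> Q ** I0 = I0 ** Q \<and> Q ** S0 = S0 ** Q"
proof -
  have "orthogonal_matrix (realification (block_diag A B)) \<longleftrightarrow> A \<in> unitary_group \<and> B \<in> unitary_group"
    for A :: "complex^1^1" and B :: "complex^3^3"
    by (auto simp: orthogonal_matrix_def unitary_group_def realification_transpose
        block_diag_conj_transpose block_diag_mult realification_eq_iff block_diag_eq_iff
        simp flip: realification_mult realification_one block_diag_one)
  then show ?thesis unfolding commutes_I0_S0_iff U1U3_def by blast
qed

lemma U1U3_one: "mat 1 \<in> U1U3"
  by (simp add: U1U3_iff orthogonal_matrix_id)

lemma U1U3_mult:
  assumes "Q \<in> U1U3" "R \<in> U1U3" shows "Q ** R \<in> U1U3"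
proof -
  have "(Q ** R) ** X = X ** (Q ** R)" if "Q ** X = X ** Q" "R ** X = X ** R" for X
  proof -
    have "(Q ** R) ** X = Q ** (X ** R)" using that(2) by (simp add: matrix_mul_assoc[symmetric])
    also have "\<dots> = X ** (Q ** R)" using that(1) by (simp add: matrix_mul_assoc)
    finally show ?thesis .
  qed
  then show ?thesis using assms by (simp add: U1U3_iff orthogonal_matrix_mul)
qed

lemma U1U3_transpose:
  assumes "Q \<in> U1U3" shows "transpose Q \<in> U1U3"
proof -
  have "transpose (Q ** I0) = transpose (I0 ** Q)" "transpose (Q ** S0) = transpose (S0 ** Q)"
    using assms by (simp_all add: U1U3_iff)
  then show ?thesis using assms
    by (simp add: U1U3_iff transpose_algebra I0S0.I_skew I0S0.S_sym mm.minus_left mm.minus_right)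
qed

text \<open>Entries at the positions 1, 2 and 2, 3 of the \<open>4 \<times> 4\<close> blocks, where \<open>\<complex>\<^sup>4 = \<complex> \<oplus> \<complex>\<^sup>3\<close>.\<close>

lemma nij_minus_1_nonzero:
  obtains A B :: "real^idx8^idx8" where "skew A" "skew B" "I0S0.mproj A = A" "I0S0.mproj B = B"
    "I0S0.nij (-1) A B \<noteq> 0"
proof -
  define E :: "idx8 \<Rightarrow> idx8 \<Rightarrow> real^idx8^idx8" where
    "E p q = (\<chi> i j. (if i = p \<and> j = q then 1 else 0) - (if i = q \<and> j = p then 1 else 0))" for p q
  let ?l0 = "Inl (Inl 1) :: idx8" and ?r0 = "Inr (Inl 1) :: idx8"
  let ?l1 = "Inl (Inr 1) :: idx8" and ?r1 = "Inr (Inr 1) :: idx8"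
  let ?l2 = "Inl (Inr 2) :: idx8" and ?r2 = "Inr (Inr 2) :: idx8"
  \<comment> \<open>\<open>?A\<close> repeats one real block on real and imaginary parts and is
    therefore complex linear; the minus sign makes \<open>?B\<close> antilinear. As
    \<open>?A\<close> exchanges the two eigenspaces of \<open>S0\<close> while \<open>?B\<close>
    preserves them, they lie in the first and the third summand.\<close>
  let ?A = "E ?l0 ?l1 + E ?r0 ?r1" and ?B = "E ?l1 ?l2 - E ?r1 ?r2"
  have "skew (E p q)" for p q
  proof -
    have "transpose (E p q) $ i $ j = (- E p q) $ i $ j" for i j
      by (simp add: E_def transpose_def conj_commute)
    then show ?thesis unfolding skew_def vec_eq_iff by blast
  qed
  then have sk: "skew ?A" "skew ?B" by (simp_all add: skew_add skew_diff)
  have gA: "I0S0.graded 1 (-1) ?A"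
    by (simp add: I0S0.graded_def vec_eq_iff all_Plus mult_I0 mult_S0) (auto simp: E_def)
  have gB: "I0S0.graded (-1) 1 ?B"
    by (simp add: I0S0.graded_def vec_eq_iff all_Plus mult_I0 mult_S0) (auto simp: E_def)
  have mp: "I0S0.mproj ?A = ?A" "I0S0.mproj ?B = ?B"
    using I0S0.graded_mproj[OF gA] I0S0.graded_mproj[OF gB] by simp_all
  have ne: "(1::3) \<noteq> 2" by simp
  have "?A $ ?l0 $ k = (if k = ?l1 then 1 else 0)" "?B $ ?l0 $ k = 0" for k
    by (auto simp: E_def)
  moreover have "?B $ ?l1 $ ?l2 = 1" using ne by (simp add: E_def)
  ultimately have "(?A ** ?B) $ ?l0 $ ?l2 = 1" "(?B ** ?A) $ ?l0 $ ?l2 = 0"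
    by (simp_all add: matrix_matrix_mult_def if_distrib[of "\<lambda>x. x * _"] sum.delta cong: if_cong
       del: vector_add_component vector_minus_component)
  \<comment> \<open>In this row the diagonal entry of \<open>S0\<close> is 1, so the formula gives
    -2 (1 (1 + 0) + 1 - 0).\<close>
  then have "I0S0.nij (-1) ?A ?B $ ?l0 $ ?l2 = - 4"
    using I0S0.nij_graded(2)[OF gA gB]
    by (simp add: mult_S0)
  then have "I0S0.nij (-1) ?A ?B \<noteq> 0" by auto
  with sk mp show ?thesis by (rule that)
qed

section \<open>A local section of the projection\<close>

lemma matrix_vector_bilinear: "bounded_bilinear ((*v) :: real^'n^'m \<Rightarrow> real^'n \<Rightarrow> real^'m)"
proof -
  have "bilinear ((*v) :: real^'n^'m \<Rightarrow> real^'n \<Rightarrow> real^'m)"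
    by (auto simp: bilinear_def linear_iff matrix_vector_mult_def vec_eq_iff sum.distrib
        sum_distrib_left algebra_simps)
  then show ?thesis by (simp add: bilinear_conv_bounded_bilinear)
qed

interpretation mv: bounded_bilinear "(*v) :: real^'n^'m \<Rightarrow> real^'n \<Rightarrow> real^'m"
  by (rule matrix_vector_bilinear)

text \<open>Normalisation, written with a real power because \<open>Cinf_on_powr\<close> provides
  its smoothness on the positive axis.\<close>

definition unit :: "real^'n \<Rightarrow> real^'n" where
  "unit w = ((w \<bullet> w) powr (-1/2)) *\<^sub>R w"

lemma unit_inner: "w \<bullet> w > 0 \<Longrightarrow> unit w \<bullet> unit w = 1"
  by (simp add: unit_def powr_minus powr_half_sqrt field_simps)

lemma unit_of_unit: "w \<bullet> w = 1 \<Longrightarrow> unit w = w"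
  by (simp add: unit_def)

lemma smooth_map_unit:
  assumes "open U" "smooth_map w U" "\<And>z. z \<in> U \<Longrightarrow> w z \<bullet> w z > 0"
  shows "smooth_map (\<lambda>z. unit (w z)) U"
proof -
  have "smooth_map (\<lambda>z. w z \<bullet> w z) U"
    by (rule smooth_map_bilinear[OF bounded_bilinear_inner assms(1,2,2)])
  then have "Cinf_on (\<lambda>z. (w z \<bullet> w z) powr (-1/2)) U"
    using assms(3) by (intro Cinf_on_compose[OF assms(1), of "{0<..}"] Cinf_on_powr) auto
  then show ?thesis unfolding unit_def by (rule smooth_map_scaleR[OF assms(1) _ assms(2)])
qed

lemma open_inner_self_pos:
  assumes "open U" "smooth_map w U"
  shows "open {z \<in> U. w z \<bullet> w z > 0}"
proof -
  have "continuous_on U (\<lambda>z. w z \<bullet> w z)"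
    using smooth_map_continuous[OF assms(2)] by (intro continuous_intros)
  then have "open (U \<inter> (\<lambda>z. w z \<bullet> w z) -` {0<..})"
    by (rule continuous_open_preimage[OF _ assms(1)]) simp
  moreover have "U \<inter> (\<lambda>z. w z \<bullet> w z) -` {0<..} = {z \<in> U. w z \<bullet> w z > 0}" by auto
  ultimately show ?thesis by simp
qed

text \<open>One step of complex Gram-Schmidt in real terms: for an orthogonal complex structure
  \<open>A\<close> and a unit vector \<open>u\<close>, the vectors u and A u form an orthonormal
  basis of the complex line through \<open>u\<close>.\<close>

definition hperp :: "real^'n^'n \<Rightarrow> real^'n \<Rightarrow> real^'n \<Rightarrow> real^'n" where
  "hperp A u v = v - (v \<bullet> u) *\<^sub>R u - (v \<bullet> (A *v u)) *\<^sub>R (A *v u)"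

lemma smooth_map_hperp:
  assumes "open U" "smooth_map A U" "smooth_map u U" "smooth_map v U"
  shows "smooth_map (\<lambda>z. hperp (A z) (u z) (v z)) U"
proof -
  note Au = smooth_map_bilinear[OF matrix_vector_bilinear assms(1,2,3)]
  note inn = smooth_map_bilinear[OF bounded_bilinear_inner assms(1), unfolded smooth_map_real]
  show ?thesis unfolding hperp_def
    by (intro smooth_map_diff smooth_map_scaleR inn Au assms)
qed

lemma inner_matrix: "(A *v x) \<bullet> y = x \<bullet> (transpose A *v y)" for A :: "real^'n^'m"
  by (simp add: dot_lmul_matrix[symmetric] inner_commute)

context two_structures
begin

lemma inner_I: "(I *v x) \<bullet> y = - (x \<bullet> (I *v y))"
  by (simp only: inner_matrix I_skew) (simp add: matrix_vector_mult_def inner_vec_def sum_negf)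

lemma I_I_vec: "I *v (I *v x) = - x"
  by (simp only: matrix_vector_mul_assoc II) (simp add: matrix_vector_mult_def mat_def vec_eq_iff
    if_distrib[of "\<lambda>c. c * _"] sum_negf if_distrib[of uminus] cong: if_cong)

lemma inner_I_self: "x \<bullet> (I *v x) = 0"
  using inner_I[of x x] by (simp add: inner_commute)

lemma inner_I_I: "(I *v x) \<bullet> (I *v y) = x \<bullet> y"
  by (simp add: inner_I I_I_vec)

lemma inner_S: "(S *v x) \<bullet> y = x \<bullet> (S *v y)"
  by (simp only: inner_matrix S_sym)

lemma hperp_perp:
  assumes "u \<bullet> u = 1"
  shows "hperp I u v \<bullet> u = 0" "hperp I u v \<bullet> (I *v u) = 0"
  using assms inner_I_self[of u] inner_I_I[of u u]
  by (simp_all add: hperp_def inner_diff_left inner_commute[of "I *v u" u])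

lemma hperp_preserves_perp:
  assumes "v \<bullet> x = 0" "v \<bullet> (I *v x) = 0" "u \<bullet> x = 0" "u \<bullet> (I *v x) = 0"
  shows "hperp I u v \<bullet> x = 0" "hperp I u v \<bullet> (I *v x) = 0"
  using assms by (simp_all add: hperp_def inner_diff_left inner_I inner_I_I I_I_vec)

lemma hperp_S:
  assumes "S *v u = - u" "S *v v = - v"
  shows "S *v hperp I u v = - hperp I u v"
proof -
  have "S *v (I *v u) = I *v (S *v u)"
    by (simp add: matrix_vector_mul_assoc IS)
  then show ?thesis using assms
    by (simp add: hperp_def mv.diff_right mv.scaleR_right mv.minus_right)
qed

end

lemma smooth_map_component: "open U \<Longrightarrow> smooth_map w U \<Longrightarrow> Cinf_on (\<lambda>z. w z $ i) U"
  using smooth_map_bounded_linear[of U "\<lambda>x. x $ i" w]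
  by (simp add: smooth_map_real bounded_linear_vec_nth)

lemma smooth_map_matrixI:
  fixes f :: "_ \<Rightarrow> real^'n^'m"
  assumes "\<And>i j. Cinf_on (\<lambda>z. f z $ i $ j) U"
  shows "smooth_map f U"
  using assms by (auto simp: smooth_map_def Basis_vec_def inner_axis)

lemma I0_axis: "I0 *v axis (Inl a) 1 = axis (Inr a) 1"
  unfolding matrix_vector_mult_basis by (auto simp: vec_eq_iff all_Plus column_def I0_def axis_def)

lemma S0_axis: "S0 *v axis i 1 = S0_entry i *\<^sub>R axis i 1"
  unfolding matrix_vector_mult_basis by (auto simp: vec_eq_iff column_def S0_def axis_def)

text \<open>A smooth choice of a unitary frame adapted to \<open>(A, B)\<close>, by Gram-Schmidt over \<open>\<complex>\<close>, where \<open>A\<close>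
  is the multiplication by \<open>\<i>\<close>. It is a local section of \<open>SO(8) \<rightarrow> SO(8)/(U(1) \<times> U(3))\<close>.\<close>

lemma frame_exists:
  obtains U s where "open U" "(I0, S0) \<in> U" "smooth_map s U" "s (I0, S0) = mat 1"
    "\<And>A B. (A, B) \<in> U \<Longrightarrow> two_structures A B \<Longrightarrow>
      s (A, B) \<in> SO8 \<and> s (A, B) ** I0 = A ** s (A, B) \<and> s (A, B) ** S0 = B ** s (A, B)"
proof -
  define e where "e a = (axis (Inl a) 1 :: real^idx8)" for a
  \<comment> \<open>If the second matrix is a symmetric involution, these are the orthogonal
    projections of standard basis vectors to its eigenspaces for 1 and -1.\<close>
  define v0 where "v0 z = (1/2) *\<^sub>R (e (Inl 1) + snd z *v e (Inl 1))"
    for z :: "(real^idx8^idx8) \<times> (real^idx8^idx8)"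
  define v where "v i z = (1/2) *\<^sub>R (e (Inr i) - snd z *v e (Inr i))"
    for i and z :: "(real^idx8^idx8) \<times> (real^idx8^idx8)"
  define u0 where "u0 z = unit (v0 z)" for z
  define u1 where "u1 z = unit (v 1 z)" for z
  define w2 where "w2 z = hperp (fst z) (u1 z) (v 2 z)" for z
  define u2 where "u2 z = unit (w2 z)" for z
  define w3 where "w3 z = hperp (fst z) (u2 z) (hperp (fst z) (u1 z) (v 3 z))" for z
  define u3 where "u3 z = unit (w3 z)" for z
  \<comment> \<open>Each domain shrinks to the open set on which the next vector can be
    normalised.\<close>
  define U1 where "U1 = {z \<in> UNIV. v0 z \<bullet> v0 z > 0}"
  define U2 where "U2 = {z \<in> U1. v 1 z \<bullet> v 1 z > 0}"
  define U3 where "U3 = {z \<in> U2. w2 z \<bullet> w2 z > 0}"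
  define U4 where "U4 = {z \<in> U3. w3 z \<bullet> w3 z > 0}"
  define u where "u z a = (case a of Inl _ \<Rightarrow> u0 z | Inr i \<Rightarrow> if i = 1 then u1 z else if i = 2 then u2 z else u3 z)"
    for z and a :: idx4
  define c where "c z j = (case j of Inl a \<Rightarrow> u z a | Inr a \<Rightarrow> fst z *v u z a)" for z and j :: idx8
  define s where "s z = (\<chi> i j. c z j $ i)" for z
  \<comment> \<open>Adapted frames are orthogonal matrices; a positive determinant selects those in
    SO(8).\<close>
  define U where "U = {z \<in> U4. det (s z) > 0}"
  have sub: "U2 \<subseteq> U1" "U3 \<subseteq> U2" "U4 \<subseteq> U3" "U \<subseteq> U4"
    by (auto simp: U2_def U3_def U4_def U_def)
  have lin: "smooth_map fst V" "smooth_map snd V" if "open V"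
    for V :: "((real^idx8^idx8) \<times> (real^idx8^idx8)) set"
    using that by (auto intro: smooth_map_linear bounded_linear_fst bounded_linear_snd)
  have sv: "smooth_map v0 V" "smooth_map (v i) V" if "open V" for V i
  proof -
    have "smooth_map (\<lambda>z. snd z *v x) V" for x
      by (rule smooth_map_bilinear[OF matrix_vector_bilinear that lin(2)[OF that] smooth_map_const[OF that]])
    then show "smooth_map v0 V" "smooth_map (v i) V"
      unfolding v0_def v_def
      by (intro smooth_map_scaleR smooth_map_add smooth_map_diff smooth_map_const Cinf_on_const that; assumption)+
  qed
  have o1: "open U1" unfolding U1_def by (rule open_inner_self_pos[OF open_UNIV sv(1)[OF open_UNIV]])
  have o2: "open U2" unfolding U2_def by (rule open_inner_self_pos[OF o1 sv(2)[OF o1]])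
  have s1: "smooth_map u1 U2"
    unfolding u1_def using sv(2)[OF o2] by (rule smooth_map_unit[OF o2]) (auto simp: U2_def)
  have sw2: "smooth_map w2 U2"
    unfolding w2_def by (rule smooth_map_hperp[OF o2 lin(1)[OF o2] s1 sv(2)[OF o2]])
  have o3: "open U3" unfolding U3_def by (rule open_inner_self_pos[OF o2 sw2])
  have s2: "smooth_map u2 U3"
    unfolding u2_def using smooth_map_subset[OF sw2 sub(2)] by (rule smooth_map_unit[OF o3]) (auto simp: U3_def)
  have sw3: "smooth_map w3 U3"
    unfolding w3_def using sub s1 smooth_map_subset
    by (intro smooth_map_hperp[OF o3 lin(1)[OF o3] s2] smooth_map_hperp[OF o3 lin(1)[OF o3] _ sv(2)[OF o3]]) blast
  have o4: "open U4" unfolding U4_def by (rule open_inner_self_pos[OF o3 sw3])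
  have s3: "smooth_map u3 U4"
    unfolding u3_def using smooth_map_subset[OF sw3 sub(3)] by (rule smooth_map_unit[OF o4]) (auto simp: U4_def)
  have s0: "smooth_map u0 U1"
    unfolding u0_def using sv(1)[OF o1] by (rule smooth_map_unit[OF o1]) (auto simp: U1_def)
  have su: "smooth_map (\<lambda>z. u z a) U4" for a
  proof -
    have "U4 \<subseteq> U1" "U4 \<subseteq> U2" using sub by auto
    then have "smooth_map u0 U4" "smooth_map u1 U4" "smooth_map u2 U4"
      using smooth_map_subset[OF s0] smooth_map_subset[OF s1] smooth_map_subset[OF s2] sub(3)
      by simp_all
    with s3 show ?thesis
      unfolding u_def by (cases a; cases "projr a = 1"; cases "projr a = 2") simp_all
  qed
  have sc: "smooth_map (\<lambda>z. c z j) U4" for j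
    using su smooth_map_bilinear[OF matrix_vector_bilinear o4 lin(1)[OF o4] su]
    unfolding c_def by (cases j) auto
  have ss: "smooth_map s U4"
    by (rule smooth_map_matrixI) (use smooth_map_component[OF o4 sc] in \<open>simp add: s_def\<close>)
  have oU: "open U"
  proof -
    have "continuous_on U4 (\<lambda>z. det (s z))"
      unfolding det_def
      using smooth_map_continuous[OF ss]
      by (intro continuous_intros) auto
    then have "open (U4 \<inter> (\<lambda>z. det (s z)) -` {0<..})"
      by (rule continuous_open_preimage[OF _ o4]) simp
    moreover have "U4 \<inter> (\<lambda>z. det (s z)) -` {0<..} = U" by (auto simp: U_def)
    ultimately show ?thesis by simp
  qed
  \<comment> \<open>At the base point the eigenvectors are standard basis vectors already, and
    Gram-Schmidt leaves them unchanged.\<close>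
  let ?z = "(I0, S0) :: (real^idx8^idx8) \<times> (real^idx8^idx8)"
  have ee: "e a \<bullet> e b = (if a = b then 1 else 0)" for a b
    by (simp add: e_def inner_axis_axis)
  have eI: "e a \<bullet> (I0 *v e b) = 0" for a b
    by (simp add: e_def I0_axis inner_axis_axis)
  have z: "v0 ?z = e (Inl 1)" "v i ?z = e (Inr i)" for i
    by (simp_all add: v0_def v_def e_def S0_axis)
  have z1: "u0 ?z = e (Inl 1)" "u1 ?z = e (Inr 1)"
    by (simp_all add: u0_def u1_def z unit_of_unit ee)
  have z2: "w2 ?z = e (Inr 2)" by (simp add: w2_def z z1 hperp_def ee eI)
  have z2': "u2 ?z = e (Inr 2)" by (simp add: u2_def z2 unit_of_unit ee)
  have z3: "w3 ?z = e (Inr 3)" by (simp add: w3_def z z1 z2' hperp_def ee eI)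
  have z3': "u3 ?z = e (Inr 3)" by (simp add: u3_def z3 unit_of_unit ee)
  have uz: "u ?z a = e a" for a
    using exhaust_3 by (auto simp: u_def z1 z2' z3' split: sum.splits)
  have cz: "c ?z j = axis j 1" for j
    by (cases j) (simp_all add: c_def uz e_def I0_axis)
  have sz: "s ?z = mat 1"
    by (simp add: vec_eq_iff s_def cz mat_def axis_def)
  have "?z \<in> U"
    by (simp add: U_def U4_def U3_def U2_def U1_def z z2 z3 ee sz del: inner_gt_zero_iff)
  moreover have "smooth_map s U" using ss sub(4) smooth_map_subset by blast
  moreover have "s (A, B) \<in> SO8 \<and> s (A, B) ** I0 = A ** s (A, B) \<and> s (A, B) ** S0 = B ** s (A, B)"
    if AB: "(A, B) \<in> U" "two_structures A B" for A B
  proof -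
    interpret two_structures A B by (rule AB(2))
    let ?y = "(A, B)"
    have BBv: "B *v (B *v x) = x" for x by (simp add: matrix_vector_mul_assoc SS)
    have ABv: "B *v (A *v x) = A *v (B *v x)" for x by (simp add: matrix_vector_mul_assoc IS)
    have pos: "v0 ?y \<bullet> v0 ?y > 0" "v 1 ?y \<bullet> v 1 ?y > 0" "w2 ?y \<bullet> w2 ?y > 0" "w3 ?y \<bullet> w3 ?y > 0"
      using AB(1) by (simp_all add: U_def U4_def U3_def U2_def U1_def)
    have nrm: "u0 ?y \<bullet> u0 ?y = 1" "u1 ?y \<bullet> u1 ?y = 1" "u2 ?y \<bullet> u2 ?y = 1" "u3 ?y \<bullet> u3 ?y = 1"
      using pos by (simp_all add: u0_def u1_def u2_def u3_def unit_inner)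
    have Bv: "B *v v0 ?y = v0 ?y" "B *v v i ?y = - v i ?y" for i
      by (simp_all add: v0_def v_def mv.scaleR_right mv.add_right mv.diff_right BBv add.commute
          flip: scaleR_minus_right)
    have B01: "B *v u0 ?y = u0 ?y" "B *v u1 ?y = - u1 ?y"
      by (simp_all add: u0_def u1_def unit_def mv.scaleR_right Bv)
    have B2: "B *v u2 ?y = - u2 ?y"
      using hperp_S[OF B01(2) Bv(2)] by (simp add: u2_def w2_def unit_def mv.scaleR_right)
    have B3: "B *v u3 ?y = - u3 ?y"
      using hperp_S[OF B2 hperp_S[OF B01(2) Bv(2)]] by (simp add: u3_def w3_def unit_def mv.scaleR_right)
    \<comment> \<open>Orthogonality for the Hermitian form, whose real and imaginary parts are, up
      to sign, these two inner products.\<close>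
    define perp where "perp x y \<longleftrightarrow> x \<bullet> y = 0 \<and> x \<bullet> (A *v y) = 0" for x y
    have perp_sym: "perp y x" if "perp x y" for x y
      using that inner_I[of y x] by (simp add: perp_def inner_commute)
    have perp_unit: "perp (unit w) x" if "perp w x" for w x
      using that by (simp add: perp_def unit_def)
    have perpB: "perp x y" if "B *v x = x" "B *v y = - y" for x y
    proof -
      have "x \<bullet> y = - (x \<bullet> y)" if "B *v y = - y" for y
        using inner_S[of x y] that \<open>B *v x = x\<close> by simp
      from this[of y] this[of "A *v y"] show ?thesis
        using that(2) by (simp add: perp_def ABv mv.minus_right)
    qed
    have p0: "perp (u0 ?y) (u1 ?y)" "perp (u0 ?y) (u2 ?y)" "perp (u0 ?y) (u3 ?y)"
      by (simp_all add: perpB B01 B2 B3)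
    have p12: "perp (u2 ?y) (u1 ?y)"
      unfolding u2_def by (rule perp_unit) (simp add: perp_def w2_def hperp_perp nrm)
    have "perp (w3 ?y) (u1 ?y)"
      using p12 hperp_preserves_perp[of "hperp A (u1 ?y) (v 3 ?y)" "u1 ?y" "u2 ?y"] nrm
      by (simp add: perp_def w3_def hperp_perp)
    then have p13: "perp (u3 ?y) (u1 ?y)"
      unfolding u3_def by (rule perp_unit)
    have p23: "perp (u3 ?y) (u2 ?y)"
      unfolding u3_def by (rule perp_unit) (simp add: perp_def w3_def hperp_perp nrm)
    note p = p0 p12 p13 p23
    have perp_u: "perp (u ?y a) (u ?y b)" if "a \<noteq> b" for a b
      using that p p[THEN perp_sym] by (auto simp: u_def split: sum.splits) (metis exhaust_3)
    have unit_u: "u ?y a \<bullet> u ?y a = 1" for a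
      using nrm by (auto simp: u_def split: sum.splits)
    have Bu: "B *v u ?y a = S0_entry (Inl a) *\<^sub>R u ?y a" for a
      by (auto simp: u_def B01 B2 B3 split: sum.splits)
    have uu: "u ?y a \<bullet> u ?y b = (if a = b then 1 else 0)" "u ?y a \<bullet> (A *v u ?y b) = 0" for a b
      using perp_u[of a b] unit_u inner_I_self by (auto simp: perp_def)
    have cc: "c ?y i \<bullet> c ?y j = (if i = j then 1 else 0)" for i j
      by (cases i; cases j) (simp_all add: c_def uu inner_I I_I_vec)
    have "(transpose (s ?y) ** s ?y) $ i $ j = c ?y i \<bullet> c ?y j" for i j
      by (simp add: matrix_matrix_mult_def transpose_def s_def inner_vec_def)
    then have orth: "orthogonal_matrix (s ?y)"
      by (simp add: orthogonal_matrix vec_eq_iff cc mat_def)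
    then have "s ?y \<in> SO8"
      using det_orthogonal_matrix[OF orth] AB(1)
      by (auto simp: special_orthogonal_group_def rotation_matrix_def U_def)
    moreover have mult: "(M ** s ?y) $ i $ j = (M *v c ?y j) $ i" for M :: "real^idx8^idx8" and i j
      by (simp add: matrix_matrix_mult_def matrix_vector_mult_def s_def)
    \<comment> \<open>Multiplication by \<open>I0\<close> from the right exchanges the two halves of
      the columns up to sign, and the second half is \<open>A\<close> applied to the first.\<close>
    have "(s ?y ** I0) $ i $ j = (A ** s ?y) $ i $ j" for i j
      by (cases j) (simp_all add: mult mult_I0, simp_all add: s_def c_def I_I_vec)
    then have "s ?y ** I0 = A ** s ?y" by (simp add: vec_eq_iff)
    moreover have "B *v c ?y j = S0_entry j *\<^sub>R c ?y j" for j
      by (cases j) (simp_all add: c_def Bu ABv mv.scaleR_right S0_entry_swap)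
    then have "s ?y ** S0 = B ** s ?y"
      by (simp add: vec_eq_iff mult mult_S0) (simp add: s_def mult.commute)
    ultimately show ?thesis by blast
  qed
  ultimately show ?thesis using that oU sz by blast
qed

section \<open>Left-invariant derivatives on \<open>SO(8)\<close>\<close>

lemma SO8_iff: "Q \<in> SO8 \<longleftrightarrow> orthogonal_matrix Q \<and> det Q = 1"
  by (simp add: special_orthogonal_group_def rotation_matrix_def)

lemma SO8_mult: "Q \<in> SO8 \<Longrightarrow> R \<in> SO8 \<Longrightarrow> Q ** R \<in> SO8"
  and SO8_transpose: "Q \<in> SO8 \<Longrightarrow> transpose Q \<in> SO8"
  and SO8_one: "mat 1 \<in> SO8"
  by (simp_all add: SO8_iff orthogonal_matrix_mul det_mul orthogonal_matrix_id)

lemma SO8_cancel: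
  assumes "Q \<in> SO8"
  shows "transpose Q ** Q = mat 1" "Q ** transpose Q = mat 1"
    "transpose Q ** (Q ** X) = X" "Q ** (transpose Q ** X) = X"
  using assms by (simp_all add: SO8_iff orthogonal_matrix_def matrix_mul_assoc)

section \<open>The Cayley transform and curves in SO(8)\<close>

definition cayley :: "real^'n^'n \<Rightarrow> real^'n^'n" where
  "cayley S = matrix_inv (mat 1 - S) ** (mat 1 + S)"

lemma skew_quadratic: "skew S \<Longrightarrow> x \<bullet> (S *v x) = 0"
  using inner_matrix[of S x x] by (simp add: skew_def mv.minus_left inner_commute del: transpose_matrix_vector)

lemma skew_invertible:
  assumes "skew S"
  shows "matrix_inv (mat 1 - S) ** (mat 1 - S) = mat 1" "(mat 1 - S) ** matrix_inv (mat 1 - S) = mat 1"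
proof -
  have "x = 0" if "(mat 1 - S) *v x = 0" for x
  proof -
    have "x = S *v x" using that by (simp add: mv.diff_left)
    then have "x \<bullet> x = 0" using skew_quadratic[OF assms, of x] by simp
    then show ?thesis by simp
  qed
  then obtain B where "B ** (mat 1 - S) = mat 1" using matrix_left_invertible_ker by blast
  then have "invertible (mat 1 - S)" using matrix_left_right_inverse invertible_def by blast
  then show "matrix_inv (mat 1 - S) ** (mat 1 - S) = mat 1" "(mat 1 - S) ** matrix_inv (mat 1 - S) = mat 1"
    unfolding matrix_inv_def invertible_def by (metis (mono_tags, lifting) someI_ex)+
qed

text \<open>In this fixed-point form the inverse has disappeared, so the velocity of
  \<open>curve\<close> is found by norm estimates without differentiating matrix inversion.\<close>

lemma cayley_eq:
  assumes "skew S"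
  shows "cayley S = mat 1 + S ** (mat 1 + cayley S)"
proof -
  have "(mat 1 - S) ** cayley S = mat 1 + S"
    by (simp add: cayley_def matrix_mul_assoc skew_invertible[OF assms])
  then show ?thesis by (simp add: matrix_algebra algebra_simps)
qed

lemma cayley_commute:
  assumes "skew S" "M ** S = S ** M"
  shows "M ** cayley S = cayley S ** M"
proof -
  let ?N = "mat 1 - S" and ?Ni = "matrix_inv (mat 1 - S)"
  have "M ** ?N = ?N ** M" "M ** (mat 1 + S) = (mat 1 + S) ** M"
    using assms(2) by (simp_all add: matrix_algebra)
  note MN = this
  have "?Ni ** (M ** ?N) ** ?Ni = ?Ni ** (?N ** M) ** ?Ni" using MN(1) by simp
  then have "?Ni ** M ** (?N ** ?Ni) = ?Ni ** ?N ** M ** ?Ni"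
    by (simp only: matrix_mul_assoc)
  then have Ni: "M ** ?Ni = ?Ni ** M" by (simp add: skew_invertible[OF assms(1)])
  have "M ** cayley S = ?Ni ** (M ** (mat 1 + S))"
    by (simp add: cayley_def matrix_mul_assoc Ni)
  then show ?thesis by (simp add: cayley_def MN(2) matrix_mul_assoc)
qed

text \<open>The matrices 1 - S and 1 + S are transposes of each other, hence have equal
  determinants, and both commute with the Cayley transform, their quotient.\<close>

lemma cayley_orthogonal:
  assumes "skew S"
  shows "orthogonal_matrix (cayley S)" "det (cayley S) = 1"
proof -
  let ?N = "mat 1 - S" and ?P = "mat 1 + S" and ?Ni = "matrix_inv (mat 1 - S)"
  have tN: "transpose ?N = ?P" "transpose ?P = ?N"
    using assms by (simp_all add: skew_def transpose_algebra)
  have NP: "?N ** ?P = ?P ** ?N" by (simp add: matrix_algebra algebra_simps)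
  have C: "?P ** cayley S = cayley S ** ?P"
    by (rule cayley_commute[OF assms]) (simp add: matrix_algebra)
  have NC: "?N ** cayley S = ?P"
    by (simp add: cayley_def matrix_mul_assoc skew_invertible[OF assms])
  have "transpose (cayley S) ** ?P = ?N"
    using NC tN by (metis matrix_transpose_mul)
  then have "transpose (cayley S) ** (?N ** cayley S) = ?N" using NC by simp
  moreover have "?N ** cayley S = cayley S ** ?N"
    by (rule cayley_commute[OF assms]) (simp add: matrix_algebra)
  ultimately have "transpose (cayley S) ** cayley S ** ?N ** ?Ni = ?N ** ?Ni"
    by (simp add: matrix_mul_assoc)
  then have "transpose (cayley S) ** cayley S ** (?N ** ?Ni) = ?N ** ?Ni"
    by (simp add: matrix_mul_assoc)
  then show "orthogonal_matrix (cayley S)"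
    by (simp add: orthogonal_matrix skew_invertible[OF assms])
  have "det (?Ni ** ?N) = 1" using skew_invertible[OF assms] by simp
  moreover have "det ?P = det ?N" using tN(1) det_transpose by metis
  ultimately show "det (cayley S) = 1" by (simp add: cayley_def det_mul)
qed

text \<open>A rational substitute for the one-parameter group exp(t X). The factor 1/2 makes its
  velocity at 0 equal to \<open>X\<close>; like the exponential, it takes values in the special
  orthogonal group and is compatible with conjugation.\<close>

definition curve :: "real^'n^'n \<Rightarrow> real \<Rightarrow> real^'n^'n" where
  "curve X t = cayley ((t / 2) *\<^sub>R X)"

lemma curve_0: "curve X 0 = mat 1"
  using cayley_eq[of 0] by (simp add: curve_def skew_def transpose_def vec_eq_iff)

lemma curve_SO8: "skew X \<Longrightarrow> curve X t \<in> SO8"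
  by (simp add: curve_def SO8_iff cayley_orthogonal skew_scaleR)

lemma curve_commute: "skew X \<Longrightarrow> M ** X = X ** M \<Longrightarrow> M ** curve X t = curve X t ** M"
  unfolding curve_def by (rule cayley_commute) (simp_all add: skew_scaleR matrix_algebra)

lemma curve_has_vector_derivative:
  fixes X :: "real^'n^'n"
  assumes "skew X"
  shows "(curve X has_vector_derivative X) (at 0)"
proof -
  let ?c = "curve X" and ?n = "norm (mat 1 :: real^'n^'n)"
  obtain K where K: "K > 0" "\<And>(a :: real^'n^'n) (b :: real^'n^'n). norm (a ** b) \<le> norm a * norm b * K"
    using mm.pos_bounded by blast
  have eq: "?c t - mat 1 = (t / 2) *\<^sub>R (X ** (mat 1 + ?c t))" for t
    using cayley_eq[OF skew_scaleR[OF assms, of "t / 2"]] by (simp add: curve_def matrix_algebra algebra_simps)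
  have le: "norm (?c t - mat 1) \<le> \<bar>t\<bar> * (norm X * K) * (?n + norm (?c t)) / 2" for t
  proof -
    have "norm (X ** (mat 1 + ?c t)) \<le> norm X * norm (mat 1 + ?c t) * K" by (rule K(2))
    also have "\<dots> \<le> norm X * (?n + norm (?c t)) * K"
      using K(1) by (intro mult_right_mono mult_left_mono norm_triangle_ineq) auto
    finally have "\<bar>t / 2\<bar> * norm (X ** (mat 1 + ?c t)) \<le> \<bar>t / 2\<bar> * (norm X * (?n + norm (?c t)) * K)"
      by (rule mult_left_mono) simp
    then show ?thesis unfolding eq norm_scaleR by (simp add: field_simps)
  qed
  have small: "eventually (\<lambda>t. \<bar>t\<bar> * (norm X * K) < 1) (at 0)"
  proof -
    have "((\<lambda>t. \<bar>t\<bar> * (norm X * K)) \<longlongrightarrow> \<bar>0\<bar> * (norm X * K)) (at 0)"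
      by (intro tendsto_intros)
    then show ?thesis by (rule order_tendstoD) simp
  qed
  \<comment> \<open>A bootstrap: the estimate \<open>le\<close> has the norm of the curve on both
    sides. For small t this bounds that norm by 3 times the norm of the identity, and reinserting
    the bound leaves a multiple of |t|.\<close>
  have "eventually (\<lambda>t. norm (?c t - mat 1) \<le> \<bar>t\<bar> * (norm X * K) * (2 * ?n)) (at 0)"
    using small
  proof eventually_elim
    case (elim t)
    let ?s = "\<bar>t\<bar> * (norm X * K)"
    have "norm (?c t) \<le> ?n + norm (?c t - mat 1)"
      using norm_triangle_ineq[of "mat 1" "?c t - mat 1"] by simp
    moreover have "?s * (?n + norm (?c t)) \<le> 1 * (?n + norm (?c t))"
      using elim by (intro mult_right_mono) (auto intro: add_nonneg_nonneg)
    ultimately have "norm (?c t) \<le> 3 * ?n" using le[of t] by simp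
    then have "?s * (?n + norm (?c t)) \<le> ?s * (?n + 3 * ?n)"
      using K(1) by (intro mult_left_mono) auto
    then show ?case using le[of t] by simp
  qed
  moreover have "((\<lambda>t. \<bar>t\<bar> * (norm X * K) * (2 * ?n)) \<longlongrightarrow> \<bar>0\<bar> * (norm X * K) * (2 * ?n)) (at 0)"
    by (intro tendsto_intros)
  ultimately have "((\<lambda>t. ?c t - mat 1) \<longlongrightarrow> 0) (at 0)"
    using Lim_null_comparison by fastforce
  then have "((\<lambda>t. (1/2) *\<^sub>R (X ** (?c t - mat 1))) \<longlongrightarrow> (1/2) *\<^sub>R (X ** 0)) (at 0)"
    by (intro tendsto_intros mm.tendsto)
  then have "((\<lambda>t. norm ((1/2) *\<^sub>R (X ** (?c t - mat 1)))) \<longlongrightarrow> 0) (at 0)"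
    using tendsto_norm_zero by fastforce
  moreover have "eventually (\<lambda>t. norm ((1/2) *\<^sub>R (X ** (?c t - mat 1)))
      = norm (?c (0 + t) - ?c 0 - t *\<^sub>R X) / norm t) (at 0)"
    unfolding eventually_at_filter
  proof (intro always_eventually allI impI)
    fix t :: real assume "t \<noteq> 0"
    have "?c (0 + t) - ?c 0 - t *\<^sub>R X = t *\<^sub>R ((1/2) *\<^sub>R (X ** (?c t - mat 1)))"
    proof -
      have "?c (0 + t) - ?c 0 - t *\<^sub>R X = (t / 2) *\<^sub>R (X + X ** ?c t) - t *\<^sub>R X"
        using eq[of t] by (simp add: curve_0 mm.add_right)
      also have "\<dots> = t *\<^sub>R ((1/2) *\<^sub>R (X ** ?c t - X))"
        by (simp add: vec_eq_iff field_simps)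
      finally show ?thesis by (simp add: mm.diff_right)
    qed
    then show "norm ((1/2) *\<^sub>R (X ** (?c t - mat 1))) = norm (?c (0 + t) - ?c 0 - t *\<^sub>R X) / norm t"
      using \<open>t \<noteq> 0\<close> by simp
  qed
  ultimately have "((\<lambda>t. norm (?c (0 + t) - ?c 0 - t *\<^sub>R X) / norm t) \<longlongrightarrow> 0) (at 0)"
    by (rule Lim_transform_eventually)
  then show ?thesis
    unfolding has_vector_derivative_def has_derivative_at
    using bounded_linear_scaleR_left by simp
qed

section \<open>Smooth maps on subsets of a Euclidean space\<close>

definition smooth_on_set :: "('a::euclidean_space \<Rightarrow> 'b::euclidean_space) \<Rightarrow> 'a set \<Rightarrow> bool" where
  "smooth_on_set F S \<longleftrightarrow>
    (\<forall>p\<in>S. \<exists>U G. open U \<and> p \<in> U \<and> smooth_map G U \<and> (\<forall>x\<in>U \<inter> S. G x = F x))"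

lemma smooth_on_set_real: "smooth_on_set f S \<longleftrightarrow> smooth_on_subset f S"
  for f :: "'a::euclidean_space \<Rightarrow> real"
  by (simp add: smooth_on_set_def smooth_on_subset_def smooth_map_real)

lemma smooth_on_set_cong:
  assumes "smooth_on_set F S" "\<And>x. x \<in> S \<Longrightarrow> F x = G x"
  shows "smooth_on_set G S"
  using assms unfolding smooth_on_set_def by (metis IntE)

lemma smooth_on_set_map: "smooth_map F UNIV \<Longrightarrow> smooth_on_set F S"
  unfolding smooth_on_set_def by (metis UNIV_I open_UNIV)

lemma smooth_on_set_compose:
  assumes "smooth_on_set F S" "open V" "smooth_map \<Psi> V" "\<And>x. x \<in> S \<Longrightarrow> F x \<in> V"
  shows "smooth_on_set (\<lambda>x. \<Psi> (F x)) S"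
  unfolding smooth_on_set_def
proof
  fix p assume p: "p \<in> S"
  then obtain U G where U: "open U" "p \<in> U" "smooth_map G U" "\<forall>x\<in>U \<inter> S. G x = F x"
    using assms(1) unfolding smooth_on_set_def by blast
  let ?W = "U \<inter> G -` V"
  have W: "open ?W"
    by (rule continuous_open_preimage[OF smooth_map_continuous[OF U(3)] U(1) assms(2)])
  moreover have "p \<in> ?W" using p U(2,4) assms(4) by auto
  moreover have "smooth_map (\<lambda>x. \<Psi> (G x)) ?W"
    by (rule smooth_map_compose[OF W assms(2) _ assms(3) smooth_map_subset[OF U(3)]]) auto
  moreover have "\<forall>x\<in>?W \<inter> S. \<Psi> (G x) = \<Psi> (F x)" using U(4) by auto
  ultimately show "\<exists>U G. open U \<and> p \<in> U \<and> smooth_map G U \<and> (\<forall>x\<in>U \<inter> S. G x = \<Psi> (F x))"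
    by (intro exI[of _ ?W] exI[of _ "\<lambda>x. \<Psi> (G x)"]) auto
qed

lemma smooth_on_set_Pair:
  assumes "smooth_on_set F S" "smooth_on_set G S"
  shows "smooth_on_set (\<lambda>x. (F x, G x)) S"
  unfolding smooth_on_set_def
proof
  fix p assume p: "p \<in> S"
  from p assms(1) obtain U F' where U: "open U" "p \<in> U" "smooth_map F' U" "\<forall>x\<in>U \<inter> S. F' x = F x"
    unfolding smooth_on_set_def by blast
  from p assms(2) obtain V G' where V: "open V" "p \<in> V" "smooth_map G' V" "\<forall>x\<in>V \<inter> S. G' x = G x"
    unfolding smooth_on_set_def by blast
  have "smooth_map (\<lambda>x. (F' x, G' x)) (U \<inter> V)"
    using U V by (intro smooth_map_Pair) (auto intro: smooth_map_subset)
  then show "\<exists>U H. open U \<and> p \<in> U \<and> smooth_map H U \<and> (\<forall>x\<in>U \<inter> S. H x = (F x, G x))"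
    using U V by (intro exI[of _ "U \<inter> V"] exI[of _ "\<lambda>x. (F' x, G' x)"]) auto
qed

lemma smooth_on_set_const: "smooth_on_set (\<lambda>x. c) S"
  by (intro smooth_on_set_map smooth_map_const open_UNIV)

lemma smooth_on_set_linear: "bounded_linear L \<Longrightarrow> smooth_on_set F S \<Longrightarrow> smooth_on_set (\<lambda>x. L (F x)) S"
  using smooth_on_set_compose[of F S UNIV L] smooth_map_linear[of UNIV L] by simp

lemma smooth_on_set_bilinear:
  assumes "bounded_bilinear h" "smooth_on_set F S" "smooth_on_set G S"
  shows "smooth_on_set (\<lambda>x. h (F x) (G x)) S"
proof -
  have "smooth_map (\<lambda>z. h (fst z) (snd z)) UNIV"
    by (intro smooth_map_bilinear[OF assms(1)] smooth_map_linear bounded_linear_fst bounded_linear_snd) auto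
  from smooth_on_set_compose[OF smooth_on_set_Pair[OF assms(2,3)] open_UNIV this]
  show ?thesis by simp
qed

lemma smooth_on_set_add: "smooth_on_set F S \<Longrightarrow> smooth_on_set G S \<Longrightarrow> smooth_on_set (\<lambda>x. F x + G x) S"
  using smooth_on_set_linear[OF bounded_linear_add[OF bounded_linear_fst bounded_linear_snd]
    smooth_on_set_Pair, of F S G] by simp

lemma smooth_on_set_sum:
  "(\<And>i. i \<in> T \<Longrightarrow> smooth_on_set (F i) S) \<Longrightarrow> smooth_on_set (\<lambda>x. \<Sum>i\<in>T. F i x) S"
  by (induction T rule: infinite_finite_induct) (auto intro: smooth_on_set_const smooth_on_set_add)

lemma smooth_on_set_componentwise:
  assumes "\<And>b. b \<in> Basis \<Longrightarrow> smooth_on_set (\<lambda>x. F x \<bullet> b) S"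
  shows "smooth_on_set F S"
proof -
  have "smooth_on_set (\<lambda>x. \<Sum>b\<in>Basis. (F x \<bullet> b) *\<^sub>R b) S"
    by (intro smooth_on_set_sum smooth_on_set_linear[OF bounded_linear_scaleR_left] assms)
  then show ?thesis by (simp add: euclidean_representation)
qed

lemma smooth_on_set_matrixI:
  fixes F :: "_ \<Rightarrow> real^'n^'m"
  assumes "\<And>i j. smooth_on_set (\<lambda>x. F x $ i $ j) S"
  shows "smooth_on_set F S"
  by (rule smooth_on_set_componentwise) (auto simp: Basis_vec_def inner_axis assms)

lemma smooth_on_set_entry:
  "smooth_on_set F S \<Longrightarrow> smooth_on_set (\<lambda>x. F x $ i $ j) S"
  by (rule smooth_on_set_linear[of "\<lambda>M. M $ i $ j"])
    (auto intro: bounded_linear_compose[OF bounded_linear_vec_nth bounded_linear_vec_nth])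

lemma smooth_on_set_ident: "smooth_on_set (\<lambda>x. x) S"
  by (intro smooth_on_set_map smooth_map_linear) auto

lemmas smooth_on_set_mm = smooth_on_set_bilinear[OF matrix_mult_bilinear]
lemmas smooth_on_set_transpose = smooth_on_set_linear[OF transpose_linear]

text \<open>\<open>has_dl F g X d\<close>: the derivative of \<open>F\<close> at \<open>g\<close> along the left-invariant vector field on \<open>SO(8)\<close>
  with value \<open>X\<close> at the identity is \<open>d\<close>.\<close>

definition has_dl :: "(real^'n^'n \<Rightarrow> 'b::real_normed_vector) \<Rightarrow> real^'n^'n \<Rightarrow> real^'n^'n \<Rightarrow> 'b \<Rightarrow> bool" where
  "has_dl F g X d \<longleftrightarrow> ((\<lambda>t. F (g ** curve X t)) has_vector_derivative d) (at 0)"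

definition dl :: "(real^'n^'n \<Rightarrow> 'b::real_normed_vector) \<Rightarrow> real^'n^'n \<Rightarrow> real^'n^'n \<Rightarrow> 'b" where
  "dl F g X = vector_derivative (\<lambda>t. F (g ** curve X t)) (at 0)"

lemma has_dl_imp_dl: "has_dl F g X d \<Longrightarrow> dl F g X = d"
  by (simp add: has_dl_def dl_def vector_derivative_at)

lemma has_dl_ident: "skew X \<Longrightarrow> has_dl (\<lambda>h. h) g X (g ** X)"
  unfolding has_dl_def
  using bounded_linear.has_vector_derivative[OF mm.bounded_linear_right curve_has_vector_derivative] .

lemma has_dl_const: "has_dl (\<lambda>h. c) g X 0"
  by (simp add: has_dl_def)

lemma has_dl_linear: "bounded_linear L \<Longrightarrow> has_dl F g X d \<Longrightarrow> has_dl (\<lambda>h. L (F h)) g X (L d)"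
  unfolding has_dl_def by (rule bounded_linear.has_vector_derivative)

lemma has_dl_bilinear:
  "bounded_bilinear m \<Longrightarrow> has_dl F g X d \<Longrightarrow> has_dl G g X e
    \<Longrightarrow> has_dl (\<lambda>h. m (F h) (G h)) g X (m (F g) e + m d (G g))"
  unfolding has_dl_def
  using bounded_bilinear.has_vector_derivative[of m "\<lambda>t. F (g ** curve X t)" d 0 UNIV "\<lambda>t. G (g ** curve X t)" e]
  by (simp add: curve_0)

lemma has_dl_add: "has_dl F g X d \<Longrightarrow> has_dl G g X e \<Longrightarrow> has_dl (\<lambda>h. F h + G h) g X (d + e)"
  unfolding has_dl_def by (rule has_vector_derivative_add)

lemmas has_dl_mm = has_dl_bilinear[OF matrix_mult_bilinear]

lemma has_dl_transpose: "skew X \<Longrightarrow> has_dl transpose g X (- (X ** transpose g))"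
  using has_dl_linear[OF transpose_linear has_dl_ident[of X g]]
  by (simp add: transpose_algebra skew_def mm.minus_left)

lemma has_dl_conj:
  assumes "skew X"
  shows "has_dl (\<lambda>h. h ** M ** transpose h) g X (g ** comm X M ** transpose g)"
proof -
  have "has_dl (\<lambda>h. h ** M ** transpose h) g X
      (g ** M ** (- (X ** transpose g)) + (g ** 0 + g ** X ** M) ** transpose g)"
    by (intro has_dl_mm has_dl_ident has_dl_transpose has_dl_const assms)
  then show ?thesis by (simp add: comm_def matrix_algebra)
qed

lemma has_dl_conj_field:
  assumes "skew X" "has_dl M g X d"
  shows "has_dl (\<lambda>h. h ** M h ** transpose h) g X (g ** (comm X (M g) + d) ** transpose g)"
proof -
  have "has_dl (\<lambda>h. h ** M h ** transpose h) g X
      (g ** M g ** (- (X ** transpose g)) + (g ** d + g ** X ** M g) ** transpose g)"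
    by (intro has_dl_mm has_dl_ident has_dl_transpose assms)
  then show ?thesis by (simp add: comm_def matrix_algebra algebra_simps)
qed

text \<open>The curve stays in SO(8), where the extension agrees with \<open>F\<close> near
  \<open>g\<close>. The derivative is thereby seen to be linear in \<open>X\<close>.\<close>

lemma has_dl_extension:
  assumes "(G has_derivative D) (at g)" "open U" "g \<in> U" "\<And>x. x \<in> U \<inter> SO8 \<Longrightarrow> G x = F x"
    and "g \<in> SO8" "skew X"
  shows "has_dl F g X (D (g ** X))"
proof -
  let ?c = "\<lambda>t. g ** curve X t"
  have c: "(?c has_vector_derivative g ** X) (at 0)"
    using has_dl_ident[OF assms(6), of g] by (simp add: has_dl_def)
  have "((\<lambda>t. G (?c t)) has_derivative (\<lambda>t. D (t *\<^sub>R (g ** X)))) (at 0)"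
    using has_derivative_compose[OF c[unfolded has_vector_derivative_def], of G D] assms(1)
    by (simp add: curve_0)
  then have 1: "((\<lambda>t. G (?c t)) has_vector_derivative D (g ** X)) (at 0)"
    by (simp add: has_vector_derivative_def linear_scale[OF has_derivative_linear[OF assms(1)]])
  have "isCont ?c 0"
    using c has_vector_derivative_continuous by blast
  then have "eventually (\<lambda>t. ?c t \<in> U) (nhds 0)"
    using assms(2,3) by (simp add: continuous_at_open eventually_nhds curve_0)
  then have "eventually (\<lambda>t. G (?c t) = F (?c t)) (nhds 0)"
    by eventually_elim (use assms SO8_mult curve_SO8 in auto)
  then show ?thesis
    unfolding has_dl_def
    using 1 has_vector_derivative_cong_ev[where x = 0 and S = UNIV and f = "\<lambda>t. G (?c t)" and g = "\<lambda>t. F (?c t)"]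
      eventually_nhds_x_imp_x[of "\<lambda>t. G (?c t) = F (?c t)" 0] by simp
qed

lemma smooth_on_set_dl:
  assumes "smooth_on_set F SO8" "g \<in> SO8"
  obtains D where "bounded_linear D" "\<And>X. skew X \<Longrightarrow> has_dl F g X (D (g ** X))"
proof -
  obtain U G where U: "open U" "g \<in> U" "smooth_map G U" "\<forall>x\<in>U \<inter> SO8. G x = F x"
    using assms unfolding smooth_on_set_def by blast
  note G = smooth_map_has_derivative[OF U(3,2)]
  show ?thesis
    using that[OF has_derivative_bounded_linear[OF G]] has_dl_extension[OF G U(1,2) _ assms(2)] U(4)
    by blast
qed

lemma smooth_on_set_has_dl:
  "smooth_on_set F SO8 \<Longrightarrow> g \<in> SO8 \<Longrightarrow> skew X \<Longrightarrow> has_dl F g X (dl F g X)"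
  using smooth_on_set_dl has_dl_imp_dl by metis

text \<open>A local extension is obtained from extensions G of \<open>F\<close> and Y of
  \<open>X\<close>: the derivative of G at h in the direction h Y(h), expanded in the basis.\<close>

lemma smooth_on_set_dl_field:
  fixes F :: "real^idx8^idx8 \<Rightarrow> real"
  assumes F: "smooth_on_set F SO8" and X: "smooth_on_set X SO8" "\<And>h. h \<in> SO8 \<Longrightarrow> skew (X h)"
  shows "smooth_on_set (\<lambda>h. dl F h (X h)) SO8"
  unfolding smooth_on_set_def
proof
  fix g assume g: "g \<in> SO8"
  obtain U G where U: "open U" "g \<in> U" "smooth_map G U" "\<forall>x\<in>U \<inter> SO8. G x = F x"
    using F g unfolding smooth_on_set_def by blast
  obtain V Y where V: "open V" "g \<in> V" "smooth_map Y V" "\<forall>x\<in>V \<inter> SO8. Y x = X x"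
    using X(1) g unfolding smooth_on_set_def by blast
  let ?W = "U \<inter> V"
  define H where "H h = (\<Sum>b\<in>Basis. ((h ** Y h) \<bullet> b) * frechet_derivative G (at h) b)" for h
  have W: "open ?W" using U V by auto
  have G: "Cinf_on G U" using U(3) by (simp add: smooth_map_real)
  have "smooth_map (\<lambda>h. h ** Y h) ?W"
    by (intro smooth_map_bilinear[OF matrix_mult_bilinear W] smooth_map_linear[OF W] smooth_map_subset[OF V(3)]) auto
  then have "Cinf_on H ?W"
    unfolding H_def
    by (intro Cinf_on_sum Cinf_on_mult W Cinf_on_subset[OF Cinf_on_frechet[OF G]]) (auto simp: smooth_map_def)
  moreover have "H h = dl F h (X h)" if h: "h \<in> ?W \<inter> SO8" for h
  proof -
    have D: "(G has_derivative frechet_derivative G (at h)) (at h)"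
      using smooth_map_has_derivative[OF U(3)] h by blast
    have "dl F h (X h) = frechet_derivative G (at h) (h ** X h)"
      by (rule has_dl_imp_dl, rule has_dl_extension[OF D U(1)]) (use h U(4) X(2) in auto)
    also have "h ** X h = (\<Sum>b\<in>Basis. ((h ** Y h) \<bullet> b) *\<^sub>R b)"
      using h V(4) by (simp add: euclidean_representation)
    finally show ?thesis
      by (simp add: H_def linear_sum[OF has_derivative_linear[OF D]] linear_scale[OF has_derivative_linear[OF D]])
  qed
  ultimately show "\<exists>U H. open U \<and> g \<in> U \<and> smooth_map H U \<and> (\<forall>h\<in>U \<inter> SO8. H h = dl F h (X h))"
    using U V W by (intro exI[of _ ?W] exI[of _ H]) (auto simp: smooth_map_real)
qed

section \<open>Tangent spaces of the flag manifold\<close>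

lemma coset_of_proj: "g \<in> SO8 \<Longrightarrow> coset_of (proj g) = (\<lambda>k. g ** k) ` U1U3"
  unfolding proj_def by (rule Abs_flag_inverse) blast

lemma proj_surj: obtains g where "g \<in> SO8" "p = proj g"
proof -
  obtain g where "g \<in> SO8" "coset_of p = (\<lambda>k. g ** k) ` U1U3"
    using coset_of[of p] by blast
  then show ?thesis using that[of g] coset_of_inverse[of p] by (simp add: proj_def)
qed

lemma proj_eq_iff:
  assumes "g \<in> SO8" "h \<in> SO8"
  shows "proj g = proj h \<longleftrightarrow> transpose g ** h \<in> U1U3"
proof
  assume "proj g = proj h"
  then have "(\<lambda>k. g ** k) ` U1U3 = (\<lambda>k. h ** k) ` U1U3"
    using assms coset_of_proj by metis
  moreover have "h \<in> (\<lambda>k. h ** k) ` U1U3" using U1U3_one by (intro image_eqI[of _ _ "mat 1"]) auto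
  ultimately obtain k where "k \<in> U1U3" "h = g ** k" by auto
  then show "transpose g ** h \<in> U1U3" by (simp add: SO8_cancel assms)
next
  assume k: "transpose g ** h \<in> U1U3" (is "?k \<in> _")
  have h: "h = g ** ?k" by (simp add: SO8_cancel assms)
  have "(\<lambda>k. h ** k) ` U1U3 = (\<lambda>k. g ** k) ` U1U3"
  proof (intro equalityI subsetI)
    fix x assume "x \<in> (\<lambda>k. h ** k) ` U1U3"
    then obtain l where "l \<in> U1U3" "x = h ** l" by auto
    then have "x = g ** (?k ** l)" "?k ** l \<in> U1U3"
      using h k U1U3_mult by (metis matrix_mul_assoc) (simp add: U1U3_mult k \<open>l \<in> U1U3\<close>)
    then show "x \<in> (\<lambda>k. g ** k) ` U1U3" by blast
  next
    fix x assume "x \<in> (\<lambda>k. g ** k) ` U1U3"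
    then obtain l where l: "l \<in> U1U3" "x = g ** l" by auto
    have "transpose ?k ** l \<in> U1U3" using k l(1) U1U3_transpose U1U3_mult by blast
    moreover have "h ** (transpose ?k ** l) = x"
      by (simp add: transpose_algebra matrix_mul_assoc[symmetric] SO8_cancel assms l(2))
    ultimately show "x \<in> (\<lambda>k. h ** k) ` U1U3" by blast
  qed
  then show "proj g = proj h" by (simp add: proj_def)
qed

lemma left_action_proj:
  assumes "k \<in> SO8" "g \<in> SO8"
  shows "left_action k (proj g) = proj (k ** g)"
proof -
  have "(\<lambda>a. k ** a) ` coset_of (proj g) = (\<lambda>l. (k ** g) ** l) ` U1U3"
    by (simp add: coset_of_proj assms image_image matrix_mul_assoc)
  then show ?thesis by (simp only: left_action_def) (simp only: proj_def)
qed

definition rep :: "flag \<Rightarrow> real^idx8^idx8" where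
  "rep p = (SOME g. g \<in> SO8 \<and> proj g = p)"

lemma rep: "rep p \<in> SO8" "proj (rep p) = p"
proof -
  obtain g where "g \<in> SO8 \<and> proj g = p" using proj_surj by metis
  then have "rep p \<in> SO8 \<and> proj (rep p) = p" unfolding rep_def by (rule someI)
  then show "rep p \<in> SO8" "proj (rep p) = p" by auto
qed

lemma Cinf_flag_iff: "f \<in> Cinf_flag \<longleftrightarrow> smooth_on_set (\<lambda>g. f (proj g)) SO8"
  by (simp add: Cinf_flag_def smooth_on_set_real)

lemma function_algebra_flag: "function_algebra Cinf_flag"
  unfolding function_algebra_def
  by (auto simp: Cinf_flag_iff intro: smooth_on_set_const smooth_on_set_add smooth_on_set_bilinear[OF bounded_bilinear_mult])

text \<open>For \<open>M = I0\<close> and \<open>M = S0\<close>, which commute with \<open>U(1) \<times> U(3)\<close>, this does not depend on the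
  choice of the representative.\<close>

definition coord :: "real^idx8^idx8 \<Rightarrow> flag \<Rightarrow> real^idx8^idx8" where
  "coord M p = rep p ** M ** transpose (rep p)"

lemma coord_proj:
  assumes "M = I0 \<or> M = S0" "g \<in> SO8"
  shows "coord M (proj g) = g ** M ** transpose g"
proof -
  let ?r = "rep (proj g)" let ?k = "transpose g ** ?r"
  have "?k \<in> U1U3" using proj_eq_iff[OF assms(2) rep(1)[of "proj g"]] rep(2)[of "proj g"] by simp
  then have k: "?k ** M = M ** ?k" "?k ** transpose ?k = mat 1"
    using assms(1) by (auto simp: U1U3_iff orthogonal_matrix_def)
  have "?r = g ** ?k" by (simp add: SO8_cancel assms)
  then have "coord M (proj g) = (g ** ?k) ** M ** transpose (g ** ?k)"
    unfolding coord_def by simp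
  also have "\<dots> = g ** (?k ** M) ** (transpose ?k ** transpose g)"
    by (simp only: matrix_transpose_mul matrix_mul_assoc)
  also have "\<dots> = g ** M ** (?k ** transpose ?k) ** transpose g"
    by (simp only: k(1) matrix_mul_assoc)
  finally show ?thesis by (simp only: k(2) matrix_mul_rid)
qed

lemma smooth_on_set_coord:
  assumes "M = I0 \<or> M = S0"
  shows "smooth_on_set (\<lambda>g. coord M (proj g)) SO8"
proof (rule smooth_on_set_cong)
  show "smooth_on_set (\<lambda>g. g ** M ** transpose g) SO8"
    by (intro smooth_on_set_mm smooth_on_set_transpose smooth_on_set_ident smooth_on_set_const)
qed (simp add: coord_proj assms)

lemma coord_entry_flag: "M = I0 \<or> M = S0 \<Longrightarrow> (\<lambda>p. coord M p $ i $ j) \<in> Cinf_flag"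
  unfolding Cinf_flag_iff by (intro smooth_on_set_entry smooth_on_set_coord)

text \<open>The image of the left-invariant vector \<open>X\<close> at \<open>g\<close> under the
  differential of the projection. The value 0 outside the algebra is the convention of
  \<open>tangent_space\<close>.\<close>

definition Dv :: "real^idx8^idx8 \<Rightarrow> real^idx8^idx8 \<Rightarrow> flag tvec" where
  "Dv g X = (\<lambda>f. if f \<in> Cinf_flag then dl (\<lambda>h. f (proj h)) g X else 0)"

lemma has_dl_flag:
  assumes "f \<in> Cinf_flag" "g \<in> SO8" "skew X"
  shows "has_dl (\<lambda>h. f (proj h)) g X (Dv g X f)"
  using smooth_on_set_has_dl assms by (simp add: Dv_def Cinf_flag_iff)

lemma Dv_eqI: "f \<in> Cinf_flag \<Longrightarrow> has_dl (\<lambda>h. f (proj h)) g X d \<Longrightarrow> Dv g X f = d"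
  by (simp add: Dv_def has_dl_imp_dl)

lemma Dv_tangent:
  assumes g: "g \<in> SO8" "skew X"
  shows "Dv g X \<in> tangent_space Cinf_flag (proj g)"
  unfolding tangent_space_def mem_Collect_eq
proof (intro conjI ballI allI impI)
  note alg = function_algebra_flag
  fix f1 f2 and c :: real assume f: "f1 \<in> Cinf_flag" "f2 \<in> Cinf_flag"
  note d = has_dl_flag[OF f(1) g] has_dl_flag[OF f(2) g]
  show "Dv g X (\<lambda>x. f1 x + f2 x) = Dv g X f1 + Dv g X f2"
    by (rule Dv_eqI[OF function_algebra_add[OF alg f] has_dl_add[OF d]])
  show "Dv g X (\<lambda>x. f1 x * f2 x) = f1 (proj g) * Dv g X f2 + Dv g X f1 * f2 (proj g)"
    by (rule Dv_eqI[OF function_algebra_mult[OF alg f] has_dl_bilinear[OF bounded_bilinear_mult d]])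
next
  fix f and c :: real assume f: "f \<in> Cinf_flag"
  show "Dv g X (\<lambda>x. c * f x) = c * Dv g X f"
    by (rule Dv_eqI[OF function_algebra_mult[OF function_algebra_flag function_algebra_const[OF function_algebra_flag] f]
        has_dl_linear[OF bounded_linear_mult_right has_dl_flag[OF f g]]])
qed (simp add: Dv_def)

lemma Dv_linear:
  assumes "g \<in> SO8" "skew X" "skew Y"
  shows "Dv g (a *\<^sub>R X + b *\<^sub>R Y) f = a * Dv g X f + b * Dv g Y f"
proof (cases "f \<in> Cinf_flag")
  case True
  then obtain D where D: "bounded_linear D" "\<And>X. skew X \<Longrightarrow> has_dl (\<lambda>h. f (proj h)) g X (D (g ** X))"
    using smooth_on_set_dl[OF _ assms(1)] by (metis Cinf_flag_iff)
  interpret D: bounded_linear D by (rule D(1))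
  have "Dv g Z f = D (g ** Z)" if "skew Z" for Z
    using Dv_eqI[OF True D(2)[OF that]] .
  then show ?thesis
    using assms by (simp add: skew_add skew_scaleR matrix_algebra D.add D.scaleR)
qed (simp add: Dv_def)

text \<open>The Cayley transform commutes with the matrices that commute with \<open>X\<close>, so
  the curve stays in the isotropy group and its translate by \<open>g\<close> in a single
  coset.\<close>

lemma Dv_stabilizer:
  assumes "g \<in> SO8" "skew X" "X ** I0 = I0 ** X" "X ** S0 = S0 ** X"
  shows "Dv g X f = 0"
proof (cases "f \<in> Cinf_flag")
  case True
  have "proj (g ** curve X t) = proj g" for t
  proof -
    have c: "curve X t \<in> SO8" by (rule curve_SO8[OF assms(2)])
    have "curve X t ** I0 = I0 ** curve X t" "curve X t ** S0 = S0 ** curve X t"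
      using assms curve_commute by metis+
    then have "curve X t \<in> U1U3" using c by (simp add: U1U3_iff SO8_iff)
    then show ?thesis
      using proj_eq_iff[of g "g ** curve X t"] assms(1) c by (simp add: SO8_mult SO8_cancel)
  qed
  then have "has_dl (\<lambda>h. f (proj h)) g X 0"
    by (simp add: has_dl_def)
  then show ?thesis by (rule Dv_eqI[OF True])
qed (simp add: Dv_def)

lemma Dv_mproj:
  assumes "g \<in> SO8" "skew X"
  shows "Dv g (I0S0.mproj X) = Dv g X"
proof
  fix f
  let ?Y = "X - I0S0.mproj X"
  have Y: "skew ?Y" using assms I0S0.skew_mproj skew_diff by blast
  have "I0S0.mproj ?Y = 0"
    using bounded_linear.linear[OF I0S0.mproj_linear] by (simp add: linear_diff I0S0.mproj_mproj)
  then have "Dv g ?Y f = 0" using Dv_stabilizer[OF assms(1) Y] I0S0.mproj_eq_0 by blast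
  moreover have "Dv g X f = 1 * Dv g ?Y f + 1 * Dv g (I0S0.mproj X) f"
    using Dv_linear[OF assms(1) Y I0S0.skew_mproj[OF assms(2)], of 1 1 f] by simp
  ultimately show "Dv g (I0S0.mproj X) f = Dv g X f" by simp
qed

lemma cayley_conj:
  assumes "skew S" "orthogonal_matrix Q"
  shows "cayley (Q ** S ** transpose Q) = Q ** cayley S ** transpose Q"
proof -
  let ?S = "Q ** S ** transpose Q"
  have Q: "transpose Q ** Q = mat 1" "Q ** transpose Q = mat 1" "transpose Q ** (Q ** X) = X" for X :: "real^'a^'a"
    using assms(2) by (simp_all add: orthogonal_matrix_def matrix_mul_assoc)
  have "(mat 1 - S) ** cayley S = mat 1 + S"
    by (simp add: cayley_def matrix_mul_assoc skew_invertible[OF assms(1)])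
  then have "cayley S - S ** cayley S = mat 1 + S" by (simp add: mm.diff_left)
  then have "Q ** (cayley S - S ** cayley S) ** transpose Q = Q ** (mat 1 + S) ** transpose Q" by simp
  then have "(mat 1 - ?S) ** (Q ** cayley S ** transpose Q) = mat 1 + ?S"
    by (simp add: matrix_algebra Q)
  then have "matrix_inv (mat 1 - ?S) ** (mat 1 - ?S) ** (Q ** cayley S ** transpose Q) = cayley ?S"
    by (simp add: cayley_def matrix_mul_assoc[symmetric])
  then show ?thesis by (simp add: skew_invertible[OF skew_conj[OF assms(1)]])
qed

text \<open>The curve through g k in direction X is the curve through g in the direction obtained by
  conjugating X with k, multiplied by k from the right; the two have the same projection.\<close>

lemma Dv_right:
  assumes "g \<in> SO8" "k \<in> U1U3" "k \<in> SO8" "skew X"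
  shows "Dv (g ** k) X = Dv g (k ** X ** transpose k)"
proof
  fix f
  have "proj (g ** k ** curve X t) = proj (g ** curve (k ** X ** transpose k) t)" for t
  proof -
    have c: "curve (k ** X ** transpose k) t = k ** curve X t ** transpose k"
      using cayley_conj[of "(t / 2) *\<^sub>R X" k] assms
      by (simp add: curve_def SO8_iff skew_scaleR mm.scaleR_left mm.scaleR_right)
    have "transpose (g ** k ** curve X t) ** (g ** curve (k ** X ** transpose k) t) = transpose k"
      unfolding c using assms curve_SO8[OF assms(4), of t]
      by (simp add: transpose_algebra matrix_mul_assoc[symmetric] SO8_cancel)
    then show ?thesis
      using assms U1U3_transpose curve_SO8[OF assms(4)] curve_SO8[OF skew_conj[OF assms(4)]]
      by (subst proj_eq_iff) (auto intro!: SO8_mult)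
  qed
  then show "Dv (g ** k) X f = Dv g (k ** X ** transpose k) f"
    by (simp add: Dv_def dl_def)
qed

text \<open>The push-forward of a tangent vector under the embedding into matrices, entry by entry
  because tangent vectors act on real functions.\<close>

definition vmat :: "flag tvec \<Rightarrow> real^idx8^idx8 \<Rightarrow> real^idx8^idx8" where
  "vmat v M = (\<chi> i j. v (\<lambda>p. coord M p $ i $ j))"

lemma vmat_Dv:
  assumes "M = I0 \<or> M = S0" "g \<in> SO8" "skew X"
  shows "vmat (Dv g X) M = g ** comm X M ** transpose g"
proof -
  have "Dv g X (\<lambda>p. coord M p $ i $ j) = (g ** comm X M ** transpose g) $ i $ j" for i j
  proof (rule Dv_eqI[OF coord_entry_flag[OF assms(1)]])
    have "has_dl (\<lambda>h. (h ** M ** transpose h) $ i $ j) g X ((g ** comm X M ** transpose g) $ i $ j)"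
      by (rule has_dl_linear[OF _ has_dl_conj[OF assms(3)], of "\<lambda>A. A $ i $ j"])
        (rule bounded_linear_compose[OF bounded_linear_vec_nth bounded_linear_vec_nth])
    then show "has_dl (\<lambda>h. coord M (proj h) $ i $ j) g X ((g ** comm X M ** transpose g) $ i $ j)"
      using assms curve_SO8 by (simp add: has_dl_def coord_proj SO8_mult)
  qed
  then show ?thesis by (simp add: vmat_def vec_eq_iff)
qed

text \<open>Undoes the conjugation seen in \<open>vmat_Dv\<close> and recovers the Lie algebra
  element from its commutators. Unlike a chosen preimage under \<open>Dv g\<close>, it is an
  explicit expression that varies smoothly.\<close>

definition lie :: "real^idx8^idx8 \<Rightarrow> flag tvec \<Rightarrow> real^idx8^idx8" where
  "lie g v = I0S0.recover (transpose g ** vmat v I0 ** g) (transpose g ** vmat v S0 ** g)"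

lemma lie_Dv:
  assumes "g \<in> SO8" "skew X"
  shows "lie g (Dv g X) = I0S0.mproj X"
  using assms
  by (simp add: lie_def vmat_Dv matrix_mul_assoc[symmetric] SO8_cancel flip: I0S0.recover_comm)

lemma two_structures_conj:
  assumes "Q \<in> SO8"
  shows "two_structures (Q ** I0 ** transpose Q) (Q ** S0 ** transpose Q)"
  by unfold_locales
    (simp_all add: transpose_algebra matrix_algebra SO8_cancel assms I0S0.relations I0S0.I_skew I0S0.S_sym)

text \<open>Translation by the inverse of \<open>g\<close> moves the point to the base point, where
  the section \<open>s\<close> is defined. Along \<open>s\<close>, a smooth function becomes a
  function of the embedding coordinates, to which the chain rule for derivations applies. The matrix
  sought is the derivative of \<open>s\<close> in the direction \<open>w\<close> that
  \<open>v\<close> prescribes for the coordinates.\<close>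

lemma tangent_representation:
  assumes g: "g \<in> SO8" and v: "v \<in> tangent_space Cinf_flag (proj g)"
  obtains X where "skew X" "v = Dv g X"
proof -
  obtain U s where U: "open U" "(I0, S0) \<in> U" "smooth_map s U" and s1: "s (I0, S0) = mat 1"
    and s: "\<And>A B. (A, B) \<in> U \<Longrightarrow> two_structures A B \<Longrightarrow>
      s (A, B) \<in> SO8 \<and> s (A, B) ** I0 = A ** s (A, B) \<and> s (A, B) ** S0 = B ** s (A, B)"
    using frame_exists by blast
  define x where "x q = (transpose g ** coord I0 q ** g, transpose g ** coord S0 q ** g)" for q
  define w where "w = (\<Sum>b\<in>Basis. v (\<lambda>q. x q \<bullet> b) *\<^sub>R b)"
  let ?x0 = "(I0, S0) :: (real^idx8^idx8) \<times> (real^idx8^idx8)"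
  have xp: "x (proj h) = ((transpose g ** h) ** I0 ** transpose (transpose g ** h),
      (transpose g ** h) ** S0 ** transpose (transpose g ** h))" if "h \<in> SO8" for h
    using that by (simp add: x_def coord_proj transpose_algebra matrix_mul_assoc)
  have x0: "x (proj g) = ?x0" using xp[OF g] g by (simp add: SO8_cancel)
  have xA: "(\<lambda>q. \<Psi> (x q)) \<in> Cinf_flag" if "Cinf_on \<Psi> UNIV" for \<Psi>
  proof -
    have "smooth_on_set (\<lambda>h. x (proj h)) SO8"
      unfolding x_def
      by (intro smooth_on_set_Pair smooth_on_set_mm smooth_on_set_const smooth_on_set_coord) auto
    then show ?thesis
      using smooth_on_set_compose[of "\<lambda>h. x (proj h)" SO8 UNIV \<Psi>] that
      by (simp add: Cinf_flag_iff smooth_map_real)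
  qed
  have chain: "v f = frechet_derivative \<Psi> (at ?x0) w"
    if "open V" "?x0 \<in> V" "Cinf_on \<Psi> V" "f \<in> Cinf_flag" "\<And>q. x q \<in> V \<Longrightarrow> f q = \<Psi> (x q)"
    for V \<Psi> f
    unfolding w_def x0[symmetric]
    by (rule tangent_vector_chain[OF function_algebra_flag v xA that(1) _ that(3-5)])
      (simp_all add: x0 that(2))
  define D where "D = frechet_derivative s (at ?x0)"
  have D: "(s has_derivative D) (at ?x0)"
    unfolding D_def by (rule smooth_map_has_derivative[OF U(3,2)])
  \<comment> \<open>The value of the section conjugates (I0, S0) to the same pair as the translate
    of \<open>h\<close> by the inverse of \<open>g\<close>, so the two differ by an element of the
    isotropy group.\<close>
  have sx: "s (x (proj h)) \<in> SO8" "transpose h ** (g ** s (x (proj h))) \<in> U1U3"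
    if h: "h \<in> SO8" "x (proj h) \<in> U" for h
  proof -
    define Q where "Q = transpose g ** h"
    let ?A = "Q ** I0 ** transpose Q" and ?B = "Q ** S0 ** transpose Q"
    have Q: "Q \<in> SO8" using g h by (simp add: Q_def SO8_mult SO8_transpose)
    have x: "x (proj h) = (?A, ?B)" unfolding Q_def by (rule xp[OF h(1)])
    define k where "k = s (?A, ?B)"
    have k: "k \<in> SO8 \<and> k ** I0 = ?A ** k \<and> k ** S0 = ?B ** k"
      using h(2) unfolding x k_def by (intro s two_structures_conj[OF Q])
    then show "s (x (proj h)) \<in> SO8" by (simp add: x k_def)
    have "transpose Q ** k \<in> SO8" using k Q by (simp add: SO8_mult SO8_transpose)
    moreover have "transpose Q ** k ** I0 = I0 ** (transpose Q ** k)"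
      "transpose Q ** k ** S0 = S0 ** (transpose Q ** k)"
      using k by (simp_all add: matrix_mul_assoc[symmetric] SO8_cancel[OF Q])
    ultimately have "transpose Q ** k \<in> U1U3" by (simp add: U1U3_iff SO8_iff)
    then have "transpose h ** (g ** k) \<in> U1U3"
      by (simp add: Q_def transpose_algebra matrix_mul_assoc)
    then show "transpose h ** (g ** s (x (proj h))) \<in> U1U3" by (simp only: x k_def)
  qed
  \<comment> \<open>The matrices in the image of the section are orthogonal, and \<open>v\<close>
    annihilates constants. Since \<open>s\<close> is 1 at the base point, the derivative of this
    relation says that \<open>D w\<close> is skew.\<close>
  have skew: "skew (D w)"
  proof -
    have "(transpose (D w) + D w) $ i $ j = 0" for i j
    proof -
      let ?\<Psi> = "\<lambda>z. (transpose (s z) ** s z) $ i $ j"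
      have ent: "bounded_linear (\<lambda>A :: real^idx8^idx8. A $ i $ j)"
        by (rule bounded_linear_compose[OF bounded_linear_vec_nth bounded_linear_vec_nth])
      have "smooth_map ?\<Psi> U"
        by (intro smooth_map_bounded_linear[OF U(1) ent] smooth_map_bilinear[OF matrix_mult_bilinear U(1)]
            smooth_map_bounded_linear[OF U(1) transpose_linear] U(3))
      then have \<Psi>: "Cinf_on ?\<Psi> U" by (simp add: smooth_map_real)
      have "?\<Psi> (x q) = (mat 1 :: real^idx8^idx8) $ i $ j" if "x q \<in> U" for q
      proof -
        obtain h where "h \<in> SO8" "q = proj h" by (rule proj_surj)
        then show ?thesis using sx(1)[of h] that by (simp add: SO8_cancel)
      qed
      then have "v (\<lambda>q. (mat 1 :: real^idx8^idx8) $ i $ j) = frechet_derivative ?\<Psi> (at ?x0) w"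
        by (intro chain[OF U(1,2) \<Psi>] function_algebra_const[OF function_algebra_flag]) simp
      moreover have "(?\<Psi> has_derivative (\<lambda>w. (transpose (s ?x0) ** D w + transpose (D w) ** s ?x0) $ i $ j)) (at ?x0)"
        by (intro bounded_linear.has_derivative[OF ent] mm.FDERIV
            bounded_linear.has_derivative[OF transpose_linear] D)
      then have "frechet_derivative ?\<Psi> (at ?x0) w = (D w + transpose (D w)) $ i $ j"
        using frechet_derivative_at[symmetric] s1 by fastforce
      moreover have "v (\<lambda>q. (mat 1 :: real^idx8^idx8) $ i $ j) = 0"
        by (rule tangent_space_const[OF function_algebra_flag v])
      ultimately show ?thesis by simp
    qed
    then have "transpose (D w) + D w = 0" by (simp add: vec_eq_iff)
    then show ?thesis by (simp add: skew_def eq_neg_iff_add_eq_0)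
  qed
  have "v f = Dv g (D w) f" for f
  proof (cases "f \<in> Cinf_flag")
    case True
    then obtain V G where V: "open V" "g \<in> V" "smooth_map G V" "\<forall>h\<in>V \<inter> SO8. G h = f (proj h)"
      using g unfolding Cinf_flag_iff smooth_on_set_def by blast
    \<comment> \<open>Here the translated section stays in the domain of the local extension
      \<open>G\<close> of \<open>f\<close>, which expresses \<open>f\<close> through the
      coordinates.\<close>
    let ?W = "U \<inter> (\<lambda>z. g ** s z) -` V" and ?\<Psi> = "\<lambda>z. G (g ** s z)"
    have gs: "smooth_map (\<lambda>z. g ** s z) U"
      by (rule smooth_map_bounded_linear[OF U(1) mm.bounded_linear_right U(3)])
    have W: "open ?W"
      by (rule continuous_open_preimage[OF smooth_map_continuous[OF gs] U(1) V(1)])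
    have x0W: "?x0 \<in> ?W" using U(2) V(2) s1 by simp
    have "smooth_map ?\<Psi> ?W"
      by (rule smooth_map_compose[OF W V(1) _ V(3) smooth_map_subset[OF gs]]) auto
    then have \<Psi>: "Cinf_on ?\<Psi> ?W" by (simp add: smooth_map_real)
    have "f q = ?\<Psi> (x q)" if "x q \<in> ?W" for q
    proof -
      obtain h where h: "h \<in> SO8" "q = proj h" by (rule proj_surj)
      have gsx: "g ** s (x q) \<in> V \<inter> SO8" using that sx(1)[of h] h g by (auto intro: SO8_mult)
      have "proj h = proj (g ** s (x q))"
        using proj_eq_iff[OF h(1), of "g ** s (x q)"] sx(2)[of h] gsx h that by auto
      then have "q = proj (g ** s (x q))" by (rule trans[OF h(2)])
      from arg_cong[OF this, of f] show ?thesis by (rule trans[OF _ bspec[OF V(4) gsx, symmetric]])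
    qed
    then have "v f = frechet_derivative ?\<Psi> (at ?x0) w"
      by (rule chain[OF W x0W \<Psi> True])
    moreover have G: "(G has_derivative frechet_derivative G (at g)) (at g)"
      by (rule smooth_map_has_derivative[OF V(3,2)])
    have "(?\<Psi> has_derivative (\<lambda>w. frechet_derivative G (at g) (g ** D w))) (at ?x0)"
      using has_derivative_compose[OF bounded_linear.has_derivative[OF mm.bounded_linear_right D, of g], of G] G s1
      by simp
    then have "frechet_derivative ?\<Psi> (at ?x0) w = frechet_derivative G (at g) (g ** D w)"
      using frechet_derivative_at[symmetric] by metis
    moreover have "Dv g (D w) f = frechet_derivative G (at g) (g ** D w)"
      by (rule Dv_eqI[OF True has_dl_extension[OF G V(1,2) _ g skew]]) (use V(4) in auto)
    ultimately show ?thesis by simp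
  qed (use v in \<open>simp add: Dv_def tangent_space_outside\<close>)
  then show ?thesis using that[OF skew] by blast
qed

lemma Dv_lie:
  assumes "g \<in> SO8" "v \<in> tangent_space Cinf_flag (proj g)"
  shows "skew (lie g v)" "I0S0.mproj (lie g v) = lie g v" "Dv g (lie g v) = v"
proof -
  obtain X where "skew X" "v = Dv g X" using tangent_representation[OF assms] .
  then show "skew (lie g v)" "I0S0.mproj (lie g v) = lie g v" "Dv g (lie g v) = v"
    using assms(1) by (simp_all add: lie_Dv I0S0.skew_mproj I0S0.mproj_mproj Dv_mproj)
qed

section \<open>The Nijenhuis tensor\<close>

definition lie_bracket :: "('p \<Rightarrow> real) set \<Rightarrow> ('p \<Rightarrow> 'p tvec) \<Rightarrow> ('p \<Rightarrow> 'p tvec) \<Rightarrow> 'p \<Rightarrow> 'p tvec" where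
  "lie_bracket A X Y p = (\<lambda>f. if f \<in> A then X p (\<lambda>q. Y q f) - Y p (\<lambda>q. X q f) else 0)"

definition nijenhuis ::
    "('p \<Rightarrow> real) set \<Rightarrow> ('p \<Rightarrow> 'p tvec \<Rightarrow> 'p tvec) \<Rightarrow> ('p \<Rightarrow> 'p tvec) \<Rightarrow> ('p \<Rightarrow> 'p tvec) \<Rightarrow> 'p \<Rightarrow> 'p tvec" where
  "nijenhuis A J X Y p f =
     lie_bracket A (\<lambda>q. J q (X q)) (\<lambda>q. J q (Y q)) p f - J p (lie_bracket A (\<lambda>q. J q (X q)) Y p) f
     - J p (lie_bracket A X (\<lambda>q. J q (Y q)) p) f - lie_bracket A X Y p f"

text \<open>Tested on global vector fields and global functions, which diffeomorphisms carry to
  objects of the same kind.\<close>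

definition integrable_acs :: "('p \<Rightarrow> real) set \<Rightarrow> ('p \<Rightarrow> 'p tvec \<Rightarrow> 'p tvec) \<Rightarrow> bool" where
  "integrable_acs A J \<longleftrightarrow> (\<forall>X\<in>smooth_vector_fields A. \<forall>Y\<in>smooth_vector_fields A.
     \<forall>p. \<forall>f\<in>A. nijenhuis A J X Y p f = 0)"

lemma smooth_vector_fieldsD:
  "X \<in> smooth_vector_fields A \<Longrightarrow> X p \<in> tangent_space A p"
  "X \<in> smooth_vector_fields A \<Longrightarrow> f \<in> A \<Longrightarrow> (\<lambda>q. X q f) \<in> A"
  by (simp_all add: smooth_vector_fields_def)

lemma lie_bracket_tangent:
  assumes A: "function_algebra A" and X: "X \<in> smooth_vector_fields A" and Y: "Y \<in> smooth_vector_fields A"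
  shows "lie_bracket A X Y p \<in> tangent_space A p"
  unfolding tangent_space_def mem_Collect_eq
proof (intro conjI ballI allI impI)
  note T = smooth_vector_fieldsD(1)[OF X] smooth_vector_fieldsD(1)[OF Y]
  note S = smooth_vector_fieldsD(2)[OF X] smooth_vector_fieldsD(2)[OF Y]
  fix f g assume f: "f \<in> A" and g: "g \<in> A"
  show "lie_bracket A X Y p (\<lambda>x. f x + g x) = lie_bracket A X Y p f + lie_bracket A X Y p g"
    using f g S by (simp add: lie_bracket_def function_algebra_add[OF A] tangent_space_add[OF T(1)]
      tangent_space_add[OF T(2)])
  show "lie_bracket A X Y p (\<lambda>x. f x * g x) = f p * lie_bracket A X Y p g + lie_bracket A X Y p f * g p"
    using f g S by (simp add: lie_bracket_def function_algebra_add[OF A] function_algebra_mult[OF A]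
      tangent_space_add[OF T(1)] tangent_space_add[OF T(2)] tangent_space_mult[OF T(1)]
      tangent_space_mult[OF T(2)] algebra_simps)
next
  note T = smooth_vector_fieldsD(1)[OF X] smooth_vector_fieldsD(1)[OF Y]
  note S = smooth_vector_fieldsD(2)[OF X] smooth_vector_fieldsD(2)[OF Y]
  fix c :: real and f assume f: "f \<in> A"
  have "(\<lambda>x. c * f x) \<in> A"
    using function_algebra_mult[OF A function_algebra_const[OF A] f] .
  then show "lie_bracket A X Y p (\<lambda>x. c * f x) = c * lie_bracket A X Y p f"
    using f S by (simp add: lie_bracket_def tangent_space_scale[OF T(1)] tangent_space_scale[OF T(2)]
      algebra_simps)
qed (simp add: lie_bracket_def)

lemma acs_field:
  "almost_complex_structure A J \<Longrightarrow> X \<in> smooth_vector_fields A \<Longrightarrow> (\<lambda>p. J p (X p)) \<in> smooth_vector_fields A"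
  and acs_tangent:
  "almost_complex_structure A J \<Longrightarrow> v \<in> tangent_space A p \<Longrightarrow> J p v \<in> tangent_space A p"
  by (simp_all add: almost_complex_structure_def)

lemma acs_uminus:
  assumes "almost_complex_structure A J" "v \<in> tangent_space A p"
  shows "J p (\<lambda>f. - v f) = (\<lambda>f. - J p v f)"
proof -
  have "J p (\<lambda>f. (-1) * v f + 0 * v f) = (\<lambda>f. (-1) * J p v f + 0 * J p v f)"
    using assms unfolding almost_complex_structure_def by blast
  then show ?thesis by simp
qed

lemma tangent_space_uminus: "v \<in> tangent_space A p \<Longrightarrow> f \<in> A \<Longrightarrow> v (\<lambda>x. - f x) = - v f"
  using tangent_space_scale[of v A p f "-1"] by simp

text \<open>Every term of the Nijenhuis expression is of even degree in \<open>J\<close>.\<close>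

lemma integrable_acs_conjugate:
  assumes A: "function_algebra A" and J: "almost_complex_structure A J" and "integrable_acs A J"
  shows "integrable_acs A (acs_conjugate J)"
  unfolding integrable_acs_def
proof (intro ballI allI)
  fix X Y p f assume X: "X \<in> smooth_vector_fields A" and Y: "Y \<in> smooth_vector_fields A" and f: "f \<in> A"
  note JX = acs_field[OF J X] and JY = acs_field[OF J Y]
  note neg = tangent_space_uminus[OF smooth_vector_fieldsD(1)[OF X]]
    tangent_space_uminus[OF smooth_vector_fieldsD(1)[OF Y]]
    tangent_space_uminus[OF smooth_vector_fieldsD(1)[OF JX]]
    tangent_space_uminus[OF smooth_vector_fieldsD(1)[OF JY]]
  note field = smooth_vector_fieldsD(2)[OF X] smooth_vector_fieldsD(2)[OF Y]
    smooth_vector_fieldsD(2)[OF JX] smooth_vector_fieldsD(2)[OF JY]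
  let ?JX = "\<lambda>q. J q (X q)" and ?JY = "\<lambda>q. J q (Y q)"
  have 1: "lie_bracket A (\<lambda>q f. - ?JX q f) (\<lambda>q f. - ?JY q f) p f = lie_bracket A ?JX ?JY p f"
    using f by (simp add: lie_bracket_def neg field)
  have 2: "lie_bracket A (\<lambda>q f. - ?JX q f) Y p = (\<lambda>f. - lie_bracket A ?JX Y p f)"
    by (auto simp: lie_bracket_def neg field)
  have 3: "lie_bracket A X (\<lambda>q f. - ?JY q f) p = (\<lambda>f. - lie_bracket A X ?JY p f)"
    by (auto simp: lie_bracket_def neg field)
  have "nijenhuis A (acs_conjugate J) X Y p f = nijenhuis A J X Y p f"
    using acs_uminus[OF J lie_bracket_tangent[OF A JX Y], of p] acs_uminus[OF J lie_bracket_tangent[OF A X JY], of p]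
    by (simp add: nijenhuis_def acs_conjugate_def 1 2 3)
  then show "nijenhuis A (acs_conjugate J) X Y p f = 0"
    using assms(3) X Y f unfolding integrable_acs_def by simp
qed

section \<open>Transport by diffeomorphisms and invariance of integrability\<close>

lemma diffeomorphismD:
  assumes "diffeomorphism A \<phi>"
  shows "inv \<phi> (\<phi> p) = p" "\<phi> (inv \<phi> p) = p" "f \<in> A \<Longrightarrow> f \<circ> \<phi> \<in> A" "f \<in> A \<Longrightarrow> f \<circ> inv \<phi> \<in> A"
    "diffeomorphism A (inv \<phi>)"
  using assms by (auto simp: diffeomorphism_def bij_is_inj bij_is_surj surj_f_inv_f bij_imp_bij_inv inv_inv_eq)

lemma differential_tangent:
  assumes "function_algebra A" "diffeomorphism A \<phi>" "v \<in> tangent_space A p"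
  shows "differential A \<phi> v \<in> tangent_space A (\<phi> p)"
proof -
  note c = diffeomorphismD(3)[OF assms(2), unfolded comp_def] and T = assms(3)
  show ?thesis
    unfolding tangent_space_def mem_Collect_eq
  proof (intro conjI ballI allI impI)
    fix f g assume "f \<in> A" "g \<in> A"
    then show "differential A \<phi> v (\<lambda>x. f x + g x) = differential A \<phi> v f + differential A \<phi> v g"
      "differential A \<phi> v (\<lambda>x. f x * g x) = f (\<phi> p) * differential A \<phi> v g + differential A \<phi> v f * g (\<phi> p)"
      using c by (simp_all add: differential_def comp_def tangent_space_add[OF T] tangent_space_mult[OF T]
          function_algebra_add[OF assms(1)] function_algebra_mult[OF assms(1)])
  next
    fix r :: real and f assume f: "f \<in> A"
    have "(\<lambda>x. r * f x) \<in> A"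
      using function_algebra_mult[OF assms(1) function_algebra_const[OF assms(1)] f] .
    then show "differential A \<phi> v (\<lambda>x. r * f x) = r * differential A \<phi> v f"
      using c f by (simp add: differential_def comp_def tangent_space_scale[OF T])
  qed (simp add: differential_def)
qed

lemma differential_inverse:
  assumes "diffeomorphism A \<phi>" "v \<in> tangent_space A p"
  shows "differential A (inv \<phi>) (differential A \<phi> v) = v"
    "differential A \<phi> (differential A (inv \<phi>) v) = v"
proof -
  have "f \<circ> inv \<phi> \<circ> \<phi> = f" "f \<circ> \<phi> \<circ> inv \<phi> = f" for f :: "'a \<Rightarrow> real"
    using diffeomorphismD(1,2)[OF assms(1)] by (auto simp: fun_eq_iff)
  then show "differential A (inv \<phi>) (differential A \<phi> v) = v"
    "differential A \<phi> (differential A (inv \<phi>) v) = v"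
    using diffeomorphismD(3,4)[OF assms(1)] tangent_space_outside[OF assms(2)]
    by (auto simp: differential_def intro!: ext)
qed

text \<open>Serves to transfer integrability in both directions, while
  \<open>integrable_acs_equivalent\<close> passes only from the target to the source.\<close>

lemma acs_equivalent_sym:
  assumes A: "function_algebra A" and J1: "almost_complex_structure A J1" and "acs_equivalent A J1 J2"
  shows "acs_equivalent A J2 J1"
proof -
  obtain \<phi> where \<phi>: "diffeomorphism A \<phi>"
    and eq: "\<And>p v. v \<in> tangent_space A p \<Longrightarrow> differential A \<phi> (J1 p v) = J2 (\<phi> p) (differential A \<phi> v)"
    using assms(3) unfolding acs_equivalent_def by blast
  have "differential A (inv \<phi>) (J2 p v) = J1 (inv \<phi> p) (differential A (inv \<phi>) v)"
    if v: "v \<in> tangent_space A p" for p v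
  proof -
    let ?w = "differential A (inv \<phi>) v"
    have w: "?w \<in> tangent_space A (inv \<phi> p)"
      by (rule differential_tangent[OF A diffeomorphismD(5)[OF \<phi>] v])
    have "J2 p v = differential A \<phi> (J1 (inv \<phi> p) ?w)"
      using eq[OF w] differential_inverse(2)[OF \<phi> v] diffeomorphismD(2)[OF \<phi>] by simp
    then show ?thesis using differential_inverse(1)[OF \<phi> acs_tangent[OF J1 w]] by simp
  qed
  then show ?thesis using diffeomorphismD(5)[OF \<phi>] unfolding acs_equivalent_def by blast
qed

text \<open>Push-forward intertwines the brackets and the two structures, so the Nijenhuis
  expressions correspond under the differential.\<close>

lemma integrable_acs_equivalent:
  assumes A: "function_algebra A" and J1: "almost_complex_structure A J1"
    and "acs_equivalent A J1 J2" and int: "integrable_acs A J2"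
  shows "integrable_acs A J1"
  unfolding integrable_acs_def
proof (intro ballI allI)
  obtain \<phi> where \<phi>: "diffeomorphism A \<phi>"
    and eq: "\<And>p v. v \<in> tangent_space A p \<Longrightarrow> differential A \<phi> (J1 p v) = J2 (\<phi> p) (differential A \<phi> v)"
    using assms(3) unfolding acs_equivalent_def by blast
  define push where "push X q = differential A \<phi> (X (inv \<phi> q))" for X q
  have push_apply: "push X (\<phi> p) = differential A \<phi> (X p)" for X p
    by (simp add: push_def diffeomorphismD(1)[OF \<phi>])
  have push_comp: "(\<lambda>q. push X q f) \<circ> \<phi> = (\<lambda>p. X p (f \<circ> \<phi>))" if "f \<in> A" for X f
    using that by (simp add: fun_eq_iff push_apply differential_def)
  have push_field: "push X \<in> smooth_vector_fields A" if X: "X \<in> smooth_vector_fields A" for X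
    unfolding smooth_vector_fields_def mem_Collect_eq
  proof (intro conjI allI ballI)
    show "push X q \<in> tangent_space A q" for q
      using differential_tangent[OF A \<phi> smooth_vector_fieldsD(1)[OF X], of "inv \<phi> q"]
      by (simp add: push_def diffeomorphismD(2)[OF \<phi>])
    fix f assume f: "f \<in> A"
    have "(\<lambda>q. push X q f) = (\<lambda>p. X p (f \<circ> \<phi>)) \<circ> inv \<phi>"
      using f by (simp add: fun_eq_iff push_def differential_def)
    also have "\<dots> \<in> A"
      by (intro diffeomorphismD(4)[OF \<phi>] smooth_vector_fieldsD(2)[OF X] diffeomorphismD(3)[OF \<phi>] f)
    finally show "(\<lambda>q. push X q f) \<in> A" .
  qed
  have bracket: "lie_bracket A (push X) (push Y) (\<phi> p) = differential A \<phi> (lie_bracket A X Y p)"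
    if X: "X \<in> smooth_vector_fields A" and Y: "Y \<in> smooth_vector_fields A" for X Y p
  proof
    fix f
    show "lie_bracket A (push X) (push Y) (\<phi> p) f = differential A \<phi> (lie_bracket A X Y p) f"
    proof (cases "f \<in> A")
      case True
      have "(\<lambda>q. push X q f) \<in> A" "(\<lambda>q. push Y q f) \<in> A"
        using push_field X Y True smooth_vector_fieldsD(2) by blast+
      then show ?thesis
        using True diffeomorphismD(3)[OF \<phi> True] push_comp[OF True]
        by (simp add: lie_bracket_def push_apply differential_def)
    qed (simp add: lie_bracket_def differential_def)
  qed
  have J_push: "(\<lambda>q. J2 q (push X q)) = push (\<lambda>q. J1 q (X q))" if X: "X \<in> smooth_vector_fields A" for X
  proof
    fix q
    show "J2 q (push X q) = push (\<lambda>q. J1 q (X q)) q"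
      using eq[OF smooth_vector_fieldsD(1)[OF X], of "inv \<phi> q"]
      by (simp add: push_def diffeomorphismD(2)[OF \<phi>])
  qed
  fix X Y p f assume X: "X \<in> smooth_vector_fields A" and Y: "Y \<in> smooth_vector_fields A" and f: "f \<in> A"
  note JX = acs_field[OF J1 X] and JY = acs_field[OF J1 Y]
  \<comment> \<open>The function on the target whose pull-back is \<open>f\<close>.\<close>
  let ?f = "f \<circ> inv \<phi>"
  have fA: "?f \<in> A" by (rule diffeomorphismD(4)[OF \<phi> f])
  have ff: "?f \<circ> \<phi> = f" by (simp add: fun_eq_iff diffeomorphismD(1)[OF \<phi>])
  have d: "differential A \<phi> v ?f = v f" for v using fA ff by (simp add: differential_def)
  have "nijenhuis A J2 (push X) (push Y) (\<phi> p) ?f = nijenhuis A J1 X Y p f"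
    by (simp add: nijenhuis_def J_push X Y bracket JX JY d
        eq[OF lie_bracket_tangent[OF A JX Y], symmetric] eq[OF lie_bracket_tangent[OF A X JY], symmetric])
  moreover have "nijenhuis A J2 (push X) (push Y) (\<phi> p) ?f = 0"
    using int push_field[OF X] push_field[OF Y] fA unfolding integrable_acs_def by blast
  ultimately show "nijenhuis A J1 X Y p f = 0" by simp
qed

lemma integrable_acs_up_to_conj:
  assumes A: "function_algebra A" and "acs_equivalent_up_to_conj A J1 J2"
  shows "integrable_acs A J1 \<longleftrightarrow> integrable_acs A J2"
proof -
  have step: "integrable_acs A J \<longleftrightarrow> integrable_acs A J'"
    if J: "almost_complex_structure A J" and J': "almost_complex_structure A J'"
      and "J' = acs_conjugate J \<or> acs_equivalent A J J'" for J J'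
    using that(3)
  proof
    assume c: "J' = acs_conjugate J"
    then have "J = acs_conjugate J'" by (simp add: acs_conjugate_def)
    then show ?thesis using integrable_acs_conjugate[OF A] J J' c by metis
  next
    assume "acs_equivalent A J J'"
    then show ?thesis using integrable_acs_equivalent[OF A] acs_equivalent_sym[OF A] J J' by blast
  qed
  show ?thesis
    using assms(2) unfolding acs_equivalent_up_to_conj_def
    by (induction rule: equivclp_induct) (use step in blast)+
qed

section \<open>Invariant almost complex structures\<close>

text \<open>The translate of \<open>acs e\<close> to the point, through a chosen representative of
  the coset; \<open>flag_acs_Dv\<close> shows that every representative gives the same
  result.\<close>

definition flag_acs :: "real \<Rightarrow> flag \<Rightarrow> flag tvec \<Rightarrow> flag tvec" where
  "flag_acs e p v = Dv (rep p) (I0S0.acs e (lie (rep p) v))"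

lemma rep_proj:
  assumes "g \<in> SO8"
  obtains k where "k \<in> U1U3" "k \<in> SO8" "rep (proj g) = g ** k"
proof
  let ?k = "transpose g ** rep (proj g)"
  show "?k \<in> U1U3" using proj_eq_iff[OF assms rep(1)[of "proj g"]] rep(2)[of "proj g"] by simp
  show "?k \<in> SO8" "rep (proj g) = g ** ?k"
    using assms rep(1)[of "proj g"] by (simp_all add: SO8_mult SO8_transpose SO8_cancel)
qed

lemma Dv_change_rep:
  assumes "g \<in> SO8" "k \<in> U1U3" "k \<in> SO8" "skew X"
  shows "Dv (g ** k) (transpose k ** X ** k) = Dv g X"
  using Dv_right[OF assms(1-3), of "transpose k ** X ** k"] skew_conj[OF assms(4), of "transpose k"] assms(3)
  by (simp add: matrix_mul_assoc[symmetric] SO8_cancel)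

text \<open>A smooth vector field sends the coordinate functions to smooth functions, and
  \<open>lie\<close> combines these with the group element by linear and bilinear
  operations.\<close>

lemma smooth_on_set_lie:
  assumes "X \<in> smooth_vector_fields Cinf_flag"
  shows "smooth_on_set (\<lambda>h. lie h (X (proj h))) SO8"
proof -
  have "smooth_on_set (\<lambda>h. vmat (X (proj h)) M) SO8" if "M = I0 \<or> M = S0" for M
    by (rule smooth_on_set_matrixI)
      (use smooth_vector_fieldsD(2)[OF assms coord_entry_flag[OF that]] in \<open>simp add: vmat_def Cinf_flag_iff\<close>)
  note v = this[of I0, simplified] this[of S0, simplified]
  have "bounded_linear (\<lambda>z. I0S0.recover (fst z) (snd z))"
    unfolding I0S0.recover_def
    by (intro bounded_linear_add bounded_linear_compose[OF bounded_linear_scaleR_right]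
        bounded_linear_compose[OF I0S0.offd_linear] bounded_linear_compose[OF mm.bounded_linear_left]
        bounded_linear_fst bounded_linear_snd)
  note rec = smooth_on_set_linear[OF this smooth_on_set_Pair, simplified]
  show ?thesis unfolding lie_def
    by (intro rec smooth_on_set_mm smooth_on_set_transpose smooth_on_set_ident v)
qed

lemma smooth_vector_fields_flagI:
  assumes X: "\<And>h. h \<in> SO8 \<Longrightarrow> X (proj h) = Dv h (\<xi> h)"
    and \<xi>: "smooth_on_set \<xi> SO8" "\<And>h. h \<in> SO8 \<Longrightarrow> skew (\<xi> h)"
  shows "X \<in> smooth_vector_fields Cinf_flag"
  unfolding smooth_vector_fields_def mem_Collect_eq
proof (intro conjI allI ballI)
  show "X p \<in> tangent_space Cinf_flag p" for p
    using Dv_tangent[OF rep(1)[of p] \<xi>(2)[OF rep(1)[of p]]] X[OF rep(1)[of p]] by (simp add: rep(2))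
  fix f assume f: "f \<in> Cinf_flag"
  have "smooth_on_set (\<lambda>h. dl (\<lambda>h. f (proj h)) h (\<xi> h)) SO8"
    using f by (intro smooth_on_set_dl_field \<xi>) (simp_all add: Cinf_flag_iff)
  then have "smooth_on_set (\<lambda>h. X (proj h) f) SO8"
    by (rule smooth_on_set_cong) (simp add: X Dv_def f)
  then show "(\<lambda>p. X p f) \<in> Cinf_flag" by (simp add: Cinf_flag_iff)
qed

text \<open>On \<open>SO(8)\<close> a smooth vector field on the flag manifold becomes a smooth function with values in
  the complement of the isotropy algebra.\<close>

definition field_lift :: "(flag \<Rightarrow> flag tvec) \<Rightarrow> real^idx8^idx8 \<Rightarrow> real^idx8^idx8" where
  "field_lift X h = lie h (X (proj h))"

lemma field_lift:
  assumes "X \<in> smooth_vector_fields Cinf_flag"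
  shows "smooth_on_set (field_lift X) SO8"
    and "h \<in> SO8 \<Longrightarrow> skew (field_lift X h)"
    and "h \<in> SO8 \<Longrightarrow> I0S0.mproj (field_lift X h) = field_lift X h"
    and "h \<in> SO8 \<Longrightarrow> X (proj h) = Dv h (field_lift X h)"
  using smooth_on_set_lie[OF assms] Dv_lie[OF _ smooth_vector_fieldsD(1)[OF assms]]
  by (simp_all add: field_lift_def[abs_def])

lemma has_dl_cong:
  assumes "g \<in> SO8" "skew X" "\<And>h. h \<in> SO8 \<Longrightarrow> F h = G h"
  shows "has_dl F g X d \<longleftrightarrow> has_dl G g X d"
  using assms by (simp add: has_dl_def SO8_mult curve_SO8)

lemma dl_field_lift:
  assumes X: "X \<in> smooth_vector_fields Cinf_flag" and g: "g \<in> SO8" "skew Z"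
  shows "has_dl (field_lift X) g Z (dl (field_lift X) g Z)"
    and "I0S0.mproj (dl (field_lift X) g Z) = dl (field_lift X) g Z"
proof -
  show d: "has_dl (field_lift X) g Z (dl (field_lift X) g Z)"
    by (rule smooth_on_set_has_dl[OF field_lift(1)[OF X] g])
  have "has_dl (\<lambda>h. I0S0.mproj (field_lift X h)) g Z (I0S0.mproj (dl (field_lift X) g Z))"
    by (rule has_dl_linear[OF I0S0.mproj_linear d])
  then have "has_dl (field_lift X) g Z (I0S0.mproj (dl (field_lift X) g Z))"
    using has_dl_cong[OF g, of "\<lambda>h. I0S0.mproj (field_lift X h)" "field_lift X"] field_lift(3)[OF X] by simp
  then show "I0S0.mproj (dl (field_lift X) g Z) = dl (field_lift X) g Z"
    by (rule has_dl_imp_dl[symmetric])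
qed

text \<open>Evaluation on the coordinate functions determines the lift. The iterated derivatives
  produce double commutators, whose difference the Jacobi identity turns into a commutator with the
  bracket. The derivatives of the lifts lie in the complement already, so only the bracket is
  projected.\<close>

lemma lie_bracket_lift:
  assumes X: "X \<in> smooth_vector_fields Cinf_flag" and Y: "Y \<in> smooth_vector_fields Cinf_flag"
    and g: "g \<in> SO8"
  shows "lie g (lie_bracket Cinf_flag X Y (proj g)) = I0S0.mproj (comm (field_lift X g) (field_lift Y g))
    + dl (field_lift Y) g (field_lift X g) - dl (field_lift X) g (field_lift Y g)"
proof -
  have iter: "X (proj g) (\<lambda>q. Y q (\<lambda>p. coord M p $ i $ j)) =
      (g ** (comm (field_lift X g) (comm (field_lift Y g) M)
        + comm (dl (field_lift Y) g (field_lift X g)) M) ** transpose g) $ i $ j"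
    if M: "M = I0 \<or> M = S0" and X: "X \<in> smooth_vector_fields Cinf_flag"
      and Y: "Y \<in> smooth_vector_fields Cinf_flag" for M i j X Y
  proof -
    let ?\<xi> = "field_lift X g" and ?d = "dl (field_lift Y) g (field_lift X g)"
    note sk = field_lift(2)[OF X g]
    have comm_lin: "bounded_linear (\<lambda>A. comm A M)"
      unfolding comm_def by (intro bounded_linear_sub mm.bounded_linear_left mm.bounded_linear_right)
    have ent: "bounded_linear (\<lambda>A :: real^idx8^idx8. A $ i $ j)"
      by (rule bounded_linear_compose[OF bounded_linear_vec_nth bounded_linear_vec_nth])
    have "has_dl (\<lambda>h. (h ** comm (field_lift Y h) M ** transpose h) $ i $ j) g ?\<xi>
        ((g ** (comm ?\<xi> (comm (field_lift Y g) M) + comm ?d M) ** transpose g) $ i $ j)"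
      by (intro has_dl_linear[OF ent] has_dl_conj_field has_dl_linear[OF comm_lin] dl_field_lift(1)[OF Y g] sk)
    moreover have "Y (proj h) (\<lambda>p. coord M p $ i $ j) = (h ** comm (field_lift Y h) M ** transpose h) $ i $ j"
      if "h \<in> SO8" for h
      using vmat_Dv[OF M that field_lift(2)[OF Y that]] field_lift(4)[OF Y that]
      by (simp add: vmat_def vec_eq_iff)
    ultimately have "has_dl (\<lambda>h. Y (proj h) (\<lambda>p. coord M p $ i $ j)) g ?\<xi>
        ((g ** (comm ?\<xi> (comm (field_lift Y g) M) + comm ?d M) ** transpose g) $ i $ j)"
      using has_dl_cong[OF g sk, of "\<lambda>h. Y (proj h) (\<lambda>p. coord M p $ i $ j)"] by simp
    then show ?thesis
      using Dv_eqI[OF smooth_vector_fieldsD(2)[OF Y coord_entry_flag[OF M]]] field_lift(4)[OF X g] by simp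
  qed
  let ?Z = "comm (field_lift X g) (field_lift Y g) + dl (field_lift Y) g (field_lift X g)
      - dl (field_lift X) g (field_lift Y g)"
  have v: "vmat (lie_bracket Cinf_flag X Y (proj g)) M = g ** comm ?Z M ** transpose g"
    if M: "M = I0 \<or> M = S0" for M
  proof -
    have "vmat (lie_bracket Cinf_flag X Y (proj g)) M =
        g ** (comm (field_lift X g) (comm (field_lift Y g) M) + comm (dl (field_lift Y) g (field_lift X g)) M)
          ** transpose g
        - g ** (comm (field_lift Y g) (comm (field_lift X g) M) + comm (dl (field_lift X) g (field_lift Y g)) M)
          ** transpose g"
      by (simp add: vmat_def vec_eq_iff lie_bracket_def coord_entry_flag[OF M] iter[OF M X Y] iter[OF M Y X])
    also have "\<dots> = g ** comm ?Z M ** transpose g"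
      by (simp add: comm_def matrix_algebra algebra_simps)
    finally show ?thesis .
  qed
  have "lie g (lie_bracket Cinf_flag X Y (proj g)) = I0S0.mproj ?Z"
    using g by (simp add: lie_def v matrix_mul_assoc[symmetric] SO8_cancel flip: I0S0.recover_comm)
  also have "\<dots> = I0S0.mproj (comm (field_lift X g) (field_lift Y g))
    + dl (field_lift Y) g (field_lift X g) - dl (field_lift X) g (field_lift Y g)"
    using bounded_linear.linear[OF I0S0.mproj_linear] dl_field_lift(2)[OF X g field_lift(2)[OF Y g]]
      dl_field_lift(2)[OF Y g field_lift(2)[OF X g]]
    by (simp add: linear_add linear_diff)
  finally show ?thesis .
qed

text \<open>The curve acts from the right, so left translation changes only the base point.\<close>

lemma differential_left_action:
  assumes "k \<in> SO8" "g \<in> SO8" "skew X"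
  shows "differential Cinf_flag (left_action k) (Dv g X) = Dv (k ** g) X"
proof
  fix f
  show "differential Cinf_flag (left_action k) (Dv g X) f = Dv (k ** g) X f"
  proof (cases "f \<in> Cinf_flag")
    case True
    have "smooth_on_set (\<lambda>h. f (proj (k ** h))) SO8"
      unfolding smooth_on_set_def
    proof
      fix h assume h: "h \<in> SO8"
      then have "k ** h \<in> SO8" using assms(1) by (simp add: SO8_mult)
      then obtain U G where U: "open U" "k ** h \<in> U" "smooth_map G U" "\<forall>x\<in>U \<inter> SO8. G x = f (proj x)"
        using True unfolding Cinf_flag_iff smooth_on_set_def by blast
      let ?W = "(\<lambda>x. k ** x) -` U"
      have k: "smooth_map (\<lambda>x. k ** x) V" if "open V" for V
        by (rule smooth_map_linear[OF that mm.bounded_linear_right])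
      have W: "open ?W"
        using continuous_open_preimage[OF smooth_map_continuous[OF k[OF open_UNIV]] open_UNIV U(1)] by simp
      have "smooth_map (\<lambda>x. G (k ** x)) ?W"
        by (rule smooth_map_compose[OF W U(1) _ U(3) k[OF W]]) auto
      then show "\<exists>V G. open V \<and> h \<in> V \<and> smooth_map G V \<and> (\<forall>x\<in>V \<inter> SO8. G x = f (proj (k ** x)))"
        using W U assms(1) by (intro exI[of _ ?W] exI[of _ "\<lambda>x. G (k ** x)"]) (auto simp: SO8_mult)
    qed
    then have "f \<circ> left_action k \<in> Cinf_flag"
      unfolding Cinf_flag_iff comp_def
      by (rule smooth_on_set_cong) (simp add: left_action_proj assms)
    then show ?thesis
      using True assms by (simp add: differential_def Dv_def dl_def left_action_proj SO8_mult curve_SO8 matrix_mul_assoc)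
  qed (simp add: differential_def Dv_def)
qed

context
  fixes e :: real
  assumes e: "e = 1 \<or> e = -1"
begin

text \<open>Passing from g to g k replaces the direction X by its conjugate under the inverse of k,
  and \<open>acs e\<close> commutes with this conjugation.\<close>

lemma flag_acs_Dv:
  assumes "g \<in> SO8" "skew X"
  shows "flag_acs e (proj g) (Dv g X) = Dv g (I0S0.acs e X)"
proof -
  obtain k where k: "k \<in> U1U3" "k \<in> SO8" "rep (proj g) = g ** k" using rep_proj[OF assms(1)] .
  let ?Y = "transpose k ** X ** k"
  have Y: "skew ?Y" using skew_conj[OF assms(2), of "transpose k"] by simp
  have gk: "g ** k \<in> SO8" using assms k by (simp add: SO8_mult)
  have "flag_acs e (proj g) (Dv g X) = Dv (g ** k) (I0S0.acs e (lie (g ** k) (Dv (g ** k) ?Y)))"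
    by (simp add: flag_acs_def k(3) Dv_change_rep assms k)
  also have "\<dots> = Dv (g ** k) (I0S0.acs e ?Y)"
    by (simp add: lie_Dv gk Y I0S0.acs_acs[OF e])
  also have "I0S0.acs e ?Y = transpose k ** I0S0.acs e X ** k"
    using I0S0.equivariance(2)[of "transpose k" e X] U1U3_transpose[OF k(1)] by (simp add: U1U3_iff)
  also have "Dv (g ** k) \<dots> = Dv g (I0S0.acs e X)"
    by (rule Dv_change_rep[OF assms(1) k(1,2) I0S0.skew_acs[OF assms(2)]])
  finally show ?thesis .
qed

lemma flag_acs_field:
  assumes "X \<in> smooth_vector_fields Cinf_flag"
  shows "(\<lambda>p. flag_acs e p (X p)) \<in> smooth_vector_fields Cinf_flag"
proof (rule smooth_vector_fields_flagI)
  note X = smooth_vector_fieldsD(1)[OF assms]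
  show "flag_acs e (proj h) (X (proj h)) = Dv h (I0S0.acs e (lie h (X (proj h))))" if "h \<in> SO8" for h
    using flag_acs_Dv[OF that Dv_lie(1)[OF that X]] Dv_lie(3)[OF that X] by simp
  show "smooth_on_set (\<lambda>h. I0S0.acs e (lie h (X (proj h)))) SO8"
    by (rule smooth_on_set_linear[OF I0S0.acs_linear smooth_on_set_lie[OF assms]])
  show "skew (I0S0.acs e (lie h (X (proj h))))" if "h \<in> SO8" for h
    by (rule I0S0.skew_acs[OF Dv_lie(1)[OF that X]])
qed

lemma almost_complex_structure_flag_acs: "almost_complex_structure Cinf_flag (flag_acs e)"
  unfolding almost_complex_structure_def
proof (intro conjI allI ballI)
  fix p v assume v: "v \<in> tangent_space Cinf_flag p"
  obtain g where g: "g \<in> SO8" "p = proj g" by (rule proj_surj)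
  obtain X where X: "skew X" "v = Dv g X"
    using tangent_representation[OF g(1)] v g(2) by blast
  note JX = I0S0.skew_acs[OF X(1), of e]
  show "flag_acs e p v \<in> tangent_space Cinf_flag p"
    using Dv_tangent[OF g(1) JX] by (simp add: g X flag_acs_Dv)
  have "flag_acs e p (flag_acs e p v) f = - v f" for f
    using Dv_linear[OF g(1) I0S0.skew_mproj[OF X(1)] X(1), of "-1" 0 f] g X JX
    by (simp add: flag_acs_Dv I0S0.acs_acs[OF e] Dv_mproj)
  then show "flag_acs e p (flag_acs e p v) = (\<lambda>f. - v f)" by blast
  fix w a b assume "w \<in> tangent_space Cinf_flag p"
  then obtain Y where Y: "skew Y" "w = Dv g Y"
    using tangent_representation[OF g(1)] g(2) by blast
  have "(\<lambda>f. a * v f + b * w f) = Dv g (a *\<^sub>R X + b *\<^sub>R Y)"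
    using Dv_linear[OF g(1) X(1) Y(1)] by (auto simp: X Y)
  moreover have "skew (a *\<^sub>R X + b *\<^sub>R Y)" using X Y by (simp add: skew_add skew_scaleR)
  moreover have "I0S0.acs e (a *\<^sub>R X + b *\<^sub>R Y) = a *\<^sub>R I0S0.acs e X + b *\<^sub>R I0S0.acs e Y"
    using bounded_linear.linear[OF I0S0.acs_linear] by (simp add: linear_add linear_scale)
  ultimately have "flag_acs e p (\<lambda>f. a * v f + b * w f)
      = Dv g (a *\<^sub>R I0S0.acs e X + b *\<^sub>R I0S0.acs e Y)"
    using flag_acs_Dv[OF g(1), of "a *\<^sub>R X + b *\<^sub>R Y"] by (simp only: g(2))
  then show "flag_acs e p (\<lambda>f. a * v f + b * w f) = (\<lambda>f. a * flag_acs e p v f + b * flag_acs e p w f)"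
    using Dv_linear[OF g(1) JX I0S0.skew_acs[OF Y(1)]] g X Y by (auto simp: flag_acs_Dv)
qed (rule flag_acs_field)

lemma flag_acs_invariant: "flag_acs e \<in> invariant_acs"
  unfolding invariant_acs_def mem_Collect_eq
proof (intro conjI ballI allI almost_complex_structure_flag_acs)
  fix k p v assume k: "k \<in> SO8" and v: "v \<in> tangent_space Cinf_flag p"
  obtain g where g: "g \<in> SO8" "p = proj g" by (rule proj_surj)
  obtain X where X: "skew X" "v = Dv g X"
    using tangent_representation[OF g(1)] v g(2) by blast
  show "flag_acs e (left_action k p) (differential Cinf_flag (left_action k) v) =
      differential Cinf_flag (left_action k) (flag_acs e p v)"
    using k g X I0S0.skew_acs[OF X(1), of e]
    by (simp add: left_action_proj differential_left_action flag_acs_Dv SO8_mult)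
qed

lemma field_lift_acs:
  assumes "X \<in> smooth_vector_fields Cinf_flag" "h \<in> SO8"
  shows "field_lift (\<lambda>p. flag_acs e p (X p)) h = I0S0.acs e (field_lift X h)"
proof -
  have "flag_acs e (proj h) (X (proj h)) = Dv h (I0S0.acs e (field_lift X h))"
    using flag_acs_Dv[OF assms(2) field_lift(2)[OF assms]] field_lift(4)[OF assms] by simp
  then show ?thesis
    using lie_Dv[OF assms(2) I0S0.skew_acs[OF field_lift(2)[OF assms], of e]] I0S0.acs_acs(2)[OF e]
    by (simp add: field_lift_def)
qed

lemma dl_field_lift_acs:
  assumes X: "X \<in> smooth_vector_fields Cinf_flag" and g: "g \<in> SO8" "skew Z"
  shows "dl (field_lift (\<lambda>p. flag_acs e p (X p))) g Z = I0S0.acs e (dl (field_lift X) g Z)"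
proof -
  have "has_dl (\<lambda>h. I0S0.acs e (field_lift X h)) g Z (I0S0.acs e (dl (field_lift X) g Z))"
    by (rule has_dl_linear[OF I0S0.acs_linear dl_field_lift(1)[OF assms]])
  then have "has_dl (field_lift (\<lambda>p. flag_acs e p (X p))) g Z (I0S0.acs e (dl (field_lift X) g Z))"
    using has_dl_cong[OF g, of "field_lift (\<lambda>p. flag_acs e p (X p))" "\<lambda>h. I0S0.acs e (field_lift X h)"]
      field_lift_acs[OF X] by simp
  then show ?thesis
    by (rule has_dl_imp_dl)
qed

text \<open>On lifts the structure is the constant linear map \<open>acs e\<close>, which commutes
  with differentiation. As its square is -1 on the complement, the derivative terms of the four
  brackets cancel in pairs and only the commutators remain.\<close>

lemma nijenhuis_flag_acs:
  assumes X: "X \<in> smooth_vector_fields Cinf_flag" and Y: "Y \<in> smooth_vector_fields Cinf_flag"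
    and g: "g \<in> SO8"
  shows "nijenhuis Cinf_flag (flag_acs e) X Y (proj g) f
    = Dv g (I0S0.nij e (field_lift X g) (field_lift Y g)) f"
proof -
  let ?JX = "\<lambda>p. flag_acs e p (X p)" and ?JY = "\<lambda>p. flag_acs e p (Y p)"
  let ?u = "field_lift X g" and ?w = "field_lift Y g"
  let ?B = "\<lambda>X Y. lie_bracket Cinf_flag X Y (proj g)"
  note JX = flag_acs_field[OF X] and JY = flag_acs_field[OF Y]
  note B = lie_bracket_tangent[OF function_algebra_flag]
  note su = field_lift(2)[OF X g] and sw = field_lift(2)[OF Y g]
  have br: "?B X' Y' = Dv g (lie g (?B X' Y'))" "skew (lie g (?B X' Y'))"
    "flag_acs e (proj g) (?B X' Y') = Dv g (I0S0.acs e (lie g (?B X' Y')))"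
    if "X' \<in> smooth_vector_fields Cinf_flag" "Y' \<in> smooth_vector_fields Cinf_flag" for X' Y'
    using Dv_lie[OF g B[OF that]] flag_acs_Dv[OF g, of "lie g (?B X' Y')"] by simp_all
  let ?Z1 = "lie g (?B ?JX ?JY)" and ?Z2 = "I0S0.acs e (lie g (?B ?JX Y))"
    and ?Z3 = "I0S0.acs e (lie g (?B X ?JY))" and ?Z4 = "lie g (?B X Y)"
  have sk: "skew ?Z1" "skew ?Z2" "skew ?Z3" "skew ?Z4"
    using br(2)[OF JX JY] br(2)[OF JX Y] br(2)[OF X JY] br(2)[OF X Y] I0S0.skew_acs by blast+
  have sub: "Dv g (Z - Z') f = Dv g Z f - Dv g Z' f" if "skew Z" "skew Z'" for Z Z'
    using Dv_linear[OF g that, of 1 "-1" f] by simp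
  have "nijenhuis Cinf_flag (flag_acs e) X Y (proj g) f = Dv g ?Z1 f - Dv g ?Z2 f - Dv g ?Z3 f - Dv g ?Z4 f"
    unfolding nijenhuis_def br(3)[OF JX Y] br(3)[OF X JY]
    using br(1)[OF JX JY] br(1)[OF X Y] by simp
  also have "\<dots> = Dv g (?Z1 - ?Z2 - ?Z3 - ?Z4) f"
    using sk by (simp add: sub skew_diff)
  also have "?Z1 - ?Z2 - ?Z3 - ?Z4 = I0S0.nij e ?u ?w"
  proof -
    note lin = bounded_linear.linear[OF I0S0.acs_linear[of e]]
    have J: "skew (I0S0.acs e ?u)" "skew (I0S0.acs e ?w)" using I0S0.skew_acs su sw by blast+
    show ?thesis
      unfolding lie_bracket_lift[OF JX JY g] lie_bracket_lift[OF JX Y g] lie_bracket_lift[OF X JY g]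
        lie_bracket_lift[OF X Y g] field_lift_acs[OF X g] field_lift_acs[OF Y g]
        dl_field_lift_acs[OF X g su] dl_field_lift_acs[OF X g sw] dl_field_lift_acs[OF Y g su]
        dl_field_lift_acs[OF Y g sw] dl_field_lift_acs[OF X g J(1)] dl_field_lift_acs[OF X g J(2)]
        dl_field_lift_acs[OF Y g J(1)] dl_field_lift_acs[OF Y g J(2)]
      by (simp add: I0S0.nij_def linear_add[OF lin] linear_diff[OF lin] I0S0.acs_acs[OF e]
          dl_field_lift(2)[OF X g sw] dl_field_lift(2)[OF Y g su])
  qed
  finally show ?thesis .
qed

end

lemma flag_acs_1_integrable: "integrable_acs Cinf_flag (flag_acs 1)"
  unfolding integrable_acs_def
proof (intro ballI allI)
  fix X Y p f
  assume X: "X \<in> smooth_vector_fields Cinf_flag" and Y: "Y \<in> smooth_vector_fields Cinf_flag"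
  obtain g where g: "g \<in> SO8" "p = proj g" by (rule proj_surj)
  have "I0S0.nij 1 (field_lift X g) (field_lift Y g) = 0"
    by (rule I0S0.nij_1_eq_0[OF field_lift(3)[OF X g(1)] field_lift(3)[OF Y g(1)]])
  moreover have "Dv g 0 f = 0"
    by (rule Dv_stabilizer[OF g(1)]) (simp_all add: skew_def transpose_def vec_eq_iff)
  ultimately show "nijenhuis Cinf_flag (flag_acs 1) X Y p f = 0"
    using nijenhuis_flag_acs[OF _ X Y g(1), of 1 f] g(2) by simp
qed

text \<open>The fundamental vector fields of the action of \<open>SO(8)\<close>.\<close>

lemma vector_field_through:
  assumes "skew A" "I0S0.mproj A = A"
  obtains X where "X \<in> smooth_vector_fields Cinf_flag" "field_lift X (mat 1) = A"
proof
  \<comment> \<open>The left action generated by \<open>A\<close> moves h with velocity A h, which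
    is h times \<open>transpose h ** A ** h\<close>.\<close>
  let ?X = "\<lambda>p. Dv (rep p) (transpose (rep p) ** A ** rep p)"
  have sk: "skew (transpose h ** A ** h)" for h
    using skew_conj[OF assms(1), of "transpose h"] by simp
  have X: "?X (proj h) = Dv h (transpose h ** A ** h)" if h: "h \<in> SO8" for h
  proof -
    obtain k where k: "k \<in> U1U3" "k \<in> SO8" "rep (proj h) = h ** k" using rep_proj[OF h] .
    have "transpose (h ** k) ** A ** (h ** k) = transpose k ** (transpose h ** A ** h) ** k"
      by (simp add: matrix_transpose_mul matrix_mul_assoc)
    then show ?thesis using Dv_change_rep[OF h k(1,2) sk] by (simp add: k(3))
  qed
  show "?X \<in> smooth_vector_fields Cinf_flag"
    by (rule smooth_vector_fields_flagI[OF X _ sk], assumption)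
      (intro smooth_on_set_mm smooth_on_set_transpose smooth_on_set_const smooth_on_set_ident)
  show "field_lift ?X (mat 1) = A"
    using X[OF SO8_one] lie_Dv[OF SO8_one assms(1)] assms(2) by (simp add: field_lift_def)
qed

lemma flag_acs_minus_1_not_integrable: "\<not> integrable_acs Cinf_flag (flag_acs (-1))"
proof
  assume int: "integrable_acs Cinf_flag (flag_acs (-1))"
  obtain A B where AB: "skew A" "skew B" "I0S0.mproj A = A" "I0S0.mproj B = B"
    and ne: "I0S0.nij (-1) A B \<noteq> 0"
    using nij_minus_1_nonzero .
  obtain X where X: "X \<in> smooth_vector_fields Cinf_flag" "field_lift X (mat 1) = A"
    using vector_field_through[OF AB(1,3)] .
  obtain Y where Y: "Y \<in> smooth_vector_fields Cinf_flag" "field_lift Y (mat 1) = B"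
    using vector_field_through[OF AB(2,4)] .
  let ?Z = "I0S0.nij (-1) A B"
  \<comment> \<open>Within the complement, \<open>lie\<close> recovers a matrix from its tangent
    vector, so a vanishing vector forces the matrix to vanish.\<close>
  have Z: "skew ?Z" "I0S0.mproj ?Z = ?Z"
    using AB bounded_linear.linear[OF I0S0.mproj_linear]
    by (simp_all add: I0S0.nij_def skew_diff skew_comm I0S0.skew_acs I0S0.skew_mproj linear_diff
        I0S0.mproj_mproj I0S0.acs_acs)
  have "Dv (mat 1) ?Z f = 0" for f
  proof (cases "f \<in> Cinf_flag")
    case True
    then have "nijenhuis Cinf_flag (flag_acs (-1)) X Y (proj (mat 1)) f = 0"
      using int X(1) Y(1) unfolding integrable_acs_def by blast
    then show ?thesis
      using nijenhuis_flag_acs[OF _ X(1) Y(1) SO8_one, of "-1" f] X(2) Y(2) by simp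
  qed (simp add: Dv_def)
  then have "vmat (Dv (mat 1) ?Z) M = 0" for M
    by (simp add: vmat_def vec_eq_iff)
  then have "lie (mat 1) (Dv (mat 1) ?Z) = I0S0.recover 0 0"
    by (simp add: lie_def)
  also have "\<dots> = 0"
    using bounded_linear.linear[OF I0S0.offd_linear] by (simp add: I0S0.recover_def linear_0)
  finally show False using lie_Dv[OF SO8_one Z(1)] Z(2) ne by simp
qed

theorem proposition8p8:
  shows "\<exists>C. C \<subseteq> invariant_acs // invariant_acs_rel \<and> card C = 2"
proof -
  let ?c = "\<lambda>e. invariant_acs_rel `` {flag_acs e}"
  have inv: "flag_acs 1 \<in> invariant_acs" "flag_acs (-1) \<in> invariant_acs"
    by (simp_all add: flag_acs_invariant)
  have "?c 1 \<noteq> ?c (-1)"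
  proof
    assume "?c 1 = ?c (-1)"
    then have "(flag_acs 1, flag_acs (-1)) \<in> invariant_acs_rel"
      using eq_equiv_class[OF _ equiv_invariant_acs_rel inv(2)] by blast
    then have "acs_equivalent_up_to_conj Cinf_flag (flag_acs 1) (flag_acs (-1))"
      by (simp add: invariant_acs_rel_def)
    then show False
      using integrable_acs_up_to_conj[OF function_algebra_flag] flag_acs_1_integrable
        flag_acs_minus_1_not_integrable by blast
  qed
  then have "card {?c 1, ?c (-1)} = 2" by simp
  moreover have "{?c 1, ?c (-1)} \<subseteq> invariant_acs // invariant_acs_rel"
    using inv by (simp add: quotientI)
  ultimately show ?thesis by blast
qed

end
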